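(* In (a completion of) $U_q^{(D)}(\widehat{\mathfrak{sl}}_2)\otimes U_q^{(D)}(\widehat{\mathfrak{sl}}_2)$ let $$\overline{\mathcal R}=\overrightarrow{\prod_{n\in\mathbb Z}}\exp_{q^2}\bigl(-(q-q^{-1})f_{-n}\otimes e_n\bigr),$$ the factor of the universal $R$-matrix $\mathcal R_{(I)}=\mathcal K\cdot\overline{\mathcal R}$. Then $$\overline{\mathcal R}=1+\sum_{n>0}\frac{(q^{-1}-q)^n}{n!(2\pi i)^n}\oint_{C_n}\frac{dz_n}{z_n}\oint_{C_{n-1}}\frac{dz_{n-1}}{z_{n-1}}\cdots\oint_{C_1}\frac{dz_1}{z_1}\,f(z_1)f(z_2)\cdots f(z_n)\otimes e(z_1)e(z_2)\cdots e(z_n),$$ where the contours $C_k$ enclose the origin and are such that the points $z_i=q^2z_j$ are outside the contours $C_i$ and the points $z_i=q^{-2}z_j$ are inside the contours $C_i$ ($j\neq i$).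
   Context: $U_q^{(D)}(\widehat{\mathfrak{sl}}_2)$ is the algebra generated by the coefficients of $e(z)=\sum_{k\in\mathbb Z}e_kz^{-k}$, $f(z)=\sum_{k\in\mathbb Z}f_kz^{-k}$, $K^\pm(z)=k^{\pm1}\exp\bigl(\pm(q-q^{-1})\sum_{n>0}a_{\pm n}z^{\mp n}\bigr)$, and a central element $c$, with relations $$(z-q^2w)e(z)e(w)=e(w)e(z)(q^2z-w),\qquad (z-q^{-2}w)f(z)f(w)=f(w)f(z)(q^{-2}z-w),$$ $$\frac{q^{c/2}z-q^2w}{q^{2+c/2}z-w}K^+(z)e(w)=e(w)K^+(z),\quad K^-(z)e(w)=\frac{q^{2-c/2}z-w}{q^{-c/2}z-q^2w}e(w)K^-(z),$$ $$\frac{q^{-c/2}z-q^{-2}w}{q^{-2-c/2}z-w}K^+(z)f(w)=f(w)K^+(z),\quad K^-(z)f(w)=\frac{q^{-2+c/2}z-w}{q^{c/2}z-q^{-2}w}f(w)K^-(z),$$ $$\frac{(z-q^{2-c}w)(z-q^{-2+c}w)}{(q^{2+c}z-w)(q^{-2-c}z-w)}K^+(z)K^-(w)=K^-(w)K^+(z),\quad K^\pm(z)K^\pm(w)=K^\pm(w)K^\pm(z),$$ $$[e(z),f(w)]=\frac1{q-q^{-1}}\bigl(\delta(z/q^cw)K^+(zq^{-c/2})-\delta(zq^c/w)K^-(wq^{-c/2})\bigr),\quad\delta(z)=\sum_{k\in\mathbb Z}z^k.$$ It is extended by the degree operator $d=-z\frac{d}{dz}$ and restricted to highest weight representations (equalities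 are understood in terms of normally ordered series of generators). It carries the comultiplication $$\Delta_{(I)}e(z)=e(z)\otimes1+K^-(zq^{c_1/2})\otimes e(zq^{c_1}),\quad\Delta_{(I)}f(z)=1\otimes f(z)+f(zq^{c_2})\otimes K^+(zq^{c_2/2}),$$ $$\Delta_{(I)}K^+(z)=K^+(zq^{c_2/2})\otimes K^+(zq^{-c_1/2}),\quad\Delta_{(I)}K^-(z)=K^-(zq^{-c_2/2})\otimes K^-(zq^{c_1/2}),$$ with $c_1=c\otimes1$, $c_2=1\otimes c$, and is viewed as the quantum double of the subalgebra generated by $f(z)$ and $K^+(z)$. Its universal $R$-matrix (recalled by the paper from earlier work with the restriction $|q|<1$) is $\mathcal R_{(I)}=\mathcal K\,\overline{\mathcal R}$, where with $h=\log_qk$ $$\mathcal K=q^{-\frac{h\otimes h}2}q^{\frac{-c\otimes d-d\otimes c}2}\exp\Bigl(-(q-q^{-1})\sum_{n>0}\frac n{[2n]_q}a_n\otimes a_{-n}\Bigr)q^{\frac{-c\otimes d-d\otimes c}2}.$$ $\overline{\mathcal R}$ is the canonical tensor of the Hopf pairing between the algebras generated by the $f_n$ and by the $e_n$, with $\langle f(z),e(w)\rangle=-\delta(z/w)/(q-q^{-1})$. $\exp_p(x)=1+x+\frac{x^2}{1+p}+\dots+\frac{x^n}{(n)_p!}+\cdots$, with $(n)_p=1+p+\dots+p^{n-1}$. In the ordered product, the index $n$ increases from left to right. The integrand is the meromorphic function on $(\mathbb C^* )^n$ obtained by analytic continuation from $|z_1|\gg|z_2|\gg\cdots\gg|z_n|$;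 its poles are simple and lie on $z_i=q^{\pm2}z_j$. The contours can be chosen so that $C_1$ encloses the origin and the points $q^{-2}z_j$, $j>1$, with the points $q^2z_j$, $j>1$, outside; $C_2$ likewise for $j>2$; and so on. Equivalently, for $|q|>1$ one continues the integrand to the region $|q^{-2}z_j|<|z_i|<|q^2z_j|$, $i\ne j$, and takes Laurent coefficients there; the resulting component expression does not depend on a restriction on $|q|$. *)

theory Defs
  imports "HOL-Complex_Analysis.Complex_Analysis"
begin

section \<open>Representations in terms of the current generators\<close>

text \<open>
  The data of a representation on a complex vector space: the operators of the modes of
  \<open>e(z) = \<Sum>\<^sub>k e\<^sub>k z\<^sup>-\<^sup>k\<close> and \<open>f(z) = \<Sum>\<^sub>k f\<^sub>k z\<^sup>-\<^sup>k\<close>, the operators \<open>a\<^sub>n\<close> (\<open>n \<noteq> 0\<close>; the field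
  \<open>aop\<close> at \<open>0\<close> is never used), \<open>k\<close> and \<open>d\<close>, and the scalar \<open>level\<close> by which the central
  element \<open>c\<close> acts.
\<close>

record 'v uq_module =
  scl :: "complex \<Rightarrow> 'v \<Rightarrow> 'v"
  eop :: "int \<Rightarrow> 'v \<Rightarrow> 'v"
  fop :: "int \<Rightarrow> 'v \<Rightarrow> 'v"
  aop :: "int \<Rightarrow> 'v \<Rightarrow> 'v"
  kop :: "'v \<Rightarrow> 'v"
  dop :: "'v \<Rightarrow> 'v"
  level :: complex

definition compositions :: "nat \<Rightarrow> nat list set" where
  "compositions n = {ms. 0 \<notin> set ms \<and> sum_list ms = n}"

text \<open>
  The coefficient of \<open>z\<^sup>-\<^sup>m\<close> in
  \<open>K\<^sup>\<plusminus>(z) = k\<^sup>\<plusminus>\<^sup>1 exp (\<plusminus>(q - q\<^sup>-\<^sup>1) \<Sum>\<^sub>n\<^sub>>\<^sub>0 a\<^sub>\<plusminus>\<^sub>n z\<^sup>\<mp>\<^sup>n)\<close>, the exponential being expanded as a sum over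
  compositions.  So \<open>Kplus q V m\<close> vanishes for \<open>m < 0\<close> and \<open>Kminus q V m\<close> for \<open>m > 0\<close>.
\<close>

definition Kplus :: "complex \<Rightarrow> ('v::ab_group_add) uq_module \<Rightarrow> int \<Rightarrow> 'v \<Rightarrow> 'v" where
  "Kplus q V m v =
     (if m < 0 then 0
      else kop V (\<Sum>ms\<in>compositions (nat m).
             scl V ((q - 1/q) ^ length ms / fact (length ms))
                   (foldr (\<lambda>j. aop V (int j)) ms v)))"

definition Kminus :: "complex \<Rightarrow> ('v::ab_group_add) uq_module \<Rightarrow> int \<Rightarrow> 'v \<Rightarrow> 'v" where
  "Kminus q V m v =
     (if m > 0 then 0
      else inv (kop V) (\<Sum>ms\<in>compositions (nat (- m)).
             scl V ((- (q - 1/q)) ^ length ms / fact (length ms))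
                   (foldr (\<lambda>j. aop V (- int j)) ms v)))"

text \<open>
  The defining relations, as identities of formal distributions with the denominators cleared,
  written out for the coefficient of \<open>z\<^sup>-\<^sup>m w\<^sup>-\<^sup>n\<close>.  Since \<open>K\<^sup>+(z)\<close> contains only nonpositive and
  \<open>K\<^sup>-(z)\<close> only nonnegative powers of \<open>z\<close>, clearing the denominators is equivalent to expanding the
  rational coefficients in the direction in which \<open>K\<^sup>\<plusminus>\<close> are expanded.  Here \<open>g = q\<^sup>c\<^sup>/\<^sup>2\<close>.  Using the
  principal branch of \<open>q\<^sup>c\<^sup>/\<^sup>2\<close> is no restriction: another branch amounts to another level.
\<close>

definition drinfeld_relations :: "complex \<Rightarrow> ('v::ab_group_add) uq_module \<Rightarrow> bool" where
  "drinfeld_relations q V \<longleftrightarrow>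
   (let s = scl V; e = eop V; f = fop V; Kp = Kplus q V; Km = Kminus q V;
        g = q powr (level V / 2)
    in \<forall>m n v.
      \<comment> \<open>\<open>e\<close>-\<open>e\<close> and \<open>f\<close>-\<open>f\<close>\<close>
      e (m+1) (e n v) - s (q^2) (e m (e (n+1) v))
        = s (q^2) (e n (e (m+1) v)) - e (n+1) (e m v) \<and>
      f (m+1) (f n v) - s (1/q^2) (f m (f (n+1) v))
        = s (1/q^2) (f n (f (m+1) v)) - f (n+1) (f m v) \<and>
      \<comment> \<open>\<open>K\<^sup>\<plusminus>\<close>-\<open>e\<close>\<close>
      s g (Kp (m+1) (e n v)) - s (q^2) (Kp m (e (n+1) v))
        = s (q^2 * g) (e n (Kp (m+1) v)) - e (n+1) (Kp m v) \<and>
      s (1/g) (Km (m+1) (e n v)) - s (q^2) (Km m (e (n+1) v))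
        = s (q^2 / g) (e n (Km (m+1) v)) - e (n+1) (Km m v) \<and>
      \<comment> \<open>\<open>K\<^sup>\<plusminus>\<close>-\<open>f\<close>\<close>
      s (1/g) (Kp (m+1) (f n v)) - s (1/q^2) (Kp m (f (n+1) v))
        = s (1 / (q^2 * g)) (f n (Kp (m+1) v)) - f (n+1) (Kp m v) \<and>
      s g (Km (m+1) (f n v)) - s (1/q^2) (Km m (f (n+1) v))
        = s (g / q^2) (f n (Km (m+1) v)) - f (n+1) (Km m v) \<and>
      \<comment> \<open>\<open>K\<close>-\<open>K\<close>\<close>
      Kp (m+2) (Km n v) - s (q^2/g^2 + g^2/q^2) (Kp (m+1) (Km (n+1) v)) + Kp m (Km (n+2) v)
        = Km n (Kp (m+2) v) - s (q^2*g^2 + 1/(q^2*g^2)) (Km (n+1) (Kp (m+1) v))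
            + Km (n+2) (Kp m v) \<and>
      Kp m (Kp n v) = Kp n (Kp m v) \<and>
      Km m (Km n v) = Km n (Km m v) \<and>
      \<comment> \<open>\<open>e\<close>-\<open>f\<close>\<close>
      e m (f n v) - f n (e m v)
        = s (1 / (q - 1/q)) (s (g powi (m - n)) (Kp (m+n) v) - s (g powi (n - m)) (Km (m+n) v)))"

text \<open>The operator \<open>d = - z d/dz\<close> multiplies the coefficient of \<open>z\<^sup>-\<^sup>n\<close> by \<open>n\<close>.\<close>

definition degree_relations :: "('v::ab_group_add) uq_module \<Rightarrow> bool" where
  "degree_relations V \<longleftrightarrow>
   (\<forall>n v. dop V (eop V n v) - eop V n (dop V v) = scl V (of_int n) (eop V n v) \<and>
          dop V (fop V n v) - fop V n (dop V v) = scl V (of_int n) (fop V n v) \<and>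
          (n \<noteq> 0 \<longrightarrow> dop V (aop V n v) - aop V n (dop V v) = scl V (of_int n) (aop V n v)) \<and>
          dop V (kop V v) = kop V (dop V v))"

definition uq_rep :: "complex \<Rightarrow> ('v::ab_group_add) uq_module \<Rightarrow> bool" where
  "uq_rep q V \<longleftrightarrow>
     vector_space (scl V) \<and>
     (\<forall>n. Vector_Spaces.linear (scl V) (scl V) (eop V n)) \<and>
     (\<forall>n. Vector_Spaces.linear (scl V) (scl V) (fop V n)) \<and>
     (\<forall>n. n \<noteq> 0 \<longrightarrow> Vector_Spaces.linear (scl V) (scl V) (aop V n)) \<and>
     Vector_Spaces.linear (scl V) (scl V) (kop V) \<and> bij (kop V) \<and>
     Vector_Spaces.linear (scl V) (scl V) (dop V) \<and>
     drinfeld_relations q V \<and> degree_relations V"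

text \<open>
  Weights are pairs (eigenvalue of \<open>k = q\<^sup>h\<close>, eigenvalue of \<open>d\<close>).  The simple root \<open>\<alpha>\<^sub>1\<close> is the weight
  of \<open>e\<^sub>0\<close>, that is \<open>(q\<^sup>2, 0)\<close>, and \<open>\<alpha>\<^sub>0\<close> is the weight of \<open>f\<^sub>1\<close>, that is \<open>(q\<^sup>-\<^sup>2, 1)\<close>;
  \<open>lower_cone q \<kappa>\<close> is the set of weights \<open>\<kappa> - a \<alpha>\<^sub>0 - b \<alpha>\<^sub>1\<close>.
\<close>

definition weight_space :: "('v::ab_group_add) uq_module \<Rightarrow> complex \<times> complex \<Rightarrow> 'v set" where
  "weight_space V \<mu> = {v. kop V v = scl V (fst \<mu>) v \<and> dop V v = scl V (snd \<mu>) v}"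

definition lower_cone :: "complex \<Rightarrow> complex \<times> complex \<Rightarrow> (complex \<times> complex) set" where
  "lower_cone q \<kappa> =
     {(fst \<kappa> * q powi (2 * (int a - int b)), snd \<kappa> - of_nat a) | a b. True}"

text \<open>
  Highest weight representations in the sense of category \<open>O\<close>: weight modules whose weights are
  bounded above by finitely many highest weights.  Neither cyclicity nor finite-dimensional weight
  spaces are required, so every module generated by a highest weight vector (annihilated by \<open>e\<^sub>n\<close>
  for \<open>n \<ge> 0\<close> and by \<open>f\<^sub>n\<close>, \<open>a\<^sub>n\<close> for \<open>n > 0\<close>) is included.
\<close>

definition highest_weight_rep :: "complex \<Rightarrow> ('v::ab_group_add) uq_module \<Rightarrow> bool" where
  "highest_weight_rep q V \<longleftrightarrow>
     uq_rep q V \<and>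
     module.span (scl V) (\<Union>\<mu>. weight_space V \<mu>) = UNIV \<and>
     (\<exists>\<Lambda>. finite \<Lambda> \<and>
        (\<forall>\<mu>. weight_space V \<mu> \<noteq> {0} \<longrightarrow> (\<exists>\<kappa>\<in>\<Lambda>. \<mu> \<in> lower_cone q \<kappa>)))"


section \<open>Tensor products\<close>

definition bilinear_map ::
  "(complex \<Rightarrow> 'v \<Rightarrow> 'v) \<Rightarrow> (complex \<Rightarrow> 'w \<Rightarrow> 'w) \<Rightarrow> (complex \<Rightarrow> 't \<Rightarrow> 't) \<Rightarrow>
   ('v::ab_group_add \<Rightarrow> 'w::ab_group_add \<Rightarrow> 't::ab_group_add) \<Rightarrow> bool" where
  "bilinear_map sV sW sT B \<longleftrightarrow>
     (\<forall>v. Vector_Spaces.linear sW sT (B v)) \<and>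
     (\<forall>w. Vector_Spaces.linear sV sT (\<lambda>v. B v w))"

text \<open>
  The universal property is stated for bilinear forms only.  Over a field this determines the
  tensor product: existence of the linear extension makes \<open>V \<otimes> W \<rightarrow> T\<close> injective, uniqueness makes
  it surjective.
\<close>

definition tensor_product ::
  "(complex \<Rightarrow> 'v \<Rightarrow> 'v) \<Rightarrow> (complex \<Rightarrow> 'w \<Rightarrow> 'w) \<Rightarrow> (complex \<Rightarrow> 't \<Rightarrow> 't) \<Rightarrow>
   ('v::ab_group_add \<Rightarrow> 'w::ab_group_add \<Rightarrow> 't::ab_group_add) \<Rightarrow> bool" where
  "tensor_product sV sW sT tens \<longleftrightarrow>
     vector_space sT \<and> bilinear_map sV sW sT tens \<and>
     (\<forall>B :: 'v \<Rightarrow> 'w \<Rightarrow> complex. bilinear_map sV sW (*) B \<longrightarrow>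
        (\<exists>!L. Vector_Spaces.linear sT (*) L \<and> (\<forall>v w. L (tens v w) = B v w)))"

text \<open>The operator \<open>A \<otimes> B\<close> on the tensor product.\<close>

definition tensor_map ::
  "(complex \<Rightarrow> 't \<Rightarrow> 't) \<Rightarrow> ('v \<Rightarrow> 'w \<Rightarrow> 't::ab_group_add) \<Rightarrow> ('v \<Rightarrow> 'v) \<Rightarrow> ('w \<Rightarrow> 'w) \<Rightarrow> 't \<Rightarrow> 't" where
  "tensor_map sT tens A B =
     (THE X. Vector_Spaces.linear sT sT X \<and> (\<forall>v w. X (tens v w) = tens (A v) (B w)))"

text \<open>
  The restricted dual of the tensor product: linear forms vanishing on all but finitely many
  \<open>V\<^sub>\<mu> \<otimes> W\<^sub>\<nu>\<close>.  These forms separate the points of \<open>V \<otimes> W\<close>.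
\<close>

definition restricted_dual ::
  "('v::ab_group_add) uq_module \<Rightarrow> ('w::ab_group_add) uq_module \<Rightarrow>
   (complex \<Rightarrow> 't \<Rightarrow> 't) \<Rightarrow> ('v \<Rightarrow> 'w \<Rightarrow> 't::ab_group_add) \<Rightarrow> ('t \<Rightarrow> complex) set" where
  "restricted_dual V W sT tens =
     {L. Vector_Spaces.linear sT (*) L \<and>
         finite {(\<mu>, \<nu>). \<exists>v\<in>weight_space V \<mu>. \<exists>w\<in>weight_space W \<nu>. L (tens v w) \<noteq> 0}}"


section \<open>The ordered product of \<open>q\<close>-exponentials\<close>

definition q_factorial :: "complex \<Rightarrow> nat \<Rightarrow> complex" where
  "q_factorial p n = (\<Prod>k=1..n. \<Sum>j<k. p ^ j)"

text \<open>\<open>exp\<^sub>p(A)\<close> for a locally nilpotent operator \<open>A\<close>.\<close>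

definition q_exp :: "(complex \<Rightarrow> 't \<Rightarrow> 't) \<Rightarrow> complex \<Rightarrow> ('t \<Rightarrow> 't) \<Rightarrow> 't \<Rightarrow> 't::ab_group_add" where
  "q_exp s p A t = (\<Sum>k | (A ^^ k) t \<noteq> 0. s (1 / q_factorial p k) ((A ^^ k) t))"

definition R_exponent ::
  "complex \<Rightarrow> ('v::ab_group_add) uq_module \<Rightarrow> ('w::ab_group_add) uq_module \<Rightarrow>
   (complex \<Rightarrow> 't \<Rightarrow> 't) \<Rightarrow> ('v \<Rightarrow> 'w \<Rightarrow> 't::ab_group_add) \<Rightarrow> int \<Rightarrow> 't \<Rightarrow> 't" where
  "R_exponent q V W sT tens n t =
     sT (- (q - 1/q)) (tensor_map sT tens (fop V (- n)) (eop W n) t)"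

text \<open>The finite product over \<open>n = -N, \<dots>, N\<close>; the factor for \<open>n = N\<close> acts first.\<close>

definition R_partial ::
  "complex \<Rightarrow> ('v::ab_group_add) uq_module \<Rightarrow> ('w::ab_group_add) uq_module \<Rightarrow>
   (complex \<Rightarrow> 't \<Rightarrow> 't) \<Rightarrow> ('v \<Rightarrow> 'w \<Rightarrow> 't::ab_group_add) \<Rightarrow> nat \<Rightarrow> 't \<Rightarrow> 't" where
  "R_partial q V W sT tens N =
     foldr (\<lambda>n. q_exp sT (q^2) (R_exponent q V W sT tens n)) [- int N..int N]"

text \<open>
  \<open>R\<close> is the infinite ordered product: all the exponentials are locally finite sums, and on
  each vector the finite products are eventually constant.
\<close>

definition is_R_bar ::
  "complex \<Rightarrow> ('v::ab_group_add) uq_module \<Rightarrow> ('w::ab_group_add) uq_module \<Rightarrow>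
   (complex \<Rightarrow> 't \<Rightarrow> 't) \<Rightarrow> ('v \<Rightarrow> 'w \<Rightarrow> 't::ab_group_add) \<Rightarrow> ('t \<Rightarrow> 't) \<Rightarrow> bool" where
  "is_R_bar q V W sT tens R \<longleftrightarrow>
     (\<forall>n t. \<exists>k. (R_exponent q V W sT tens n ^^ k) t = 0) \<and>
     (\<forall>t. \<forall>\<^sub>F N in sequentially. R_partial q V W sT tens N t = R t)"


section \<open>The integrand\<close>

text \<open>
  Points of \<open>\<complex>\<^sup>n\<close> are functions \<open>z\<close> on \<open>nat\<close> of which only the coordinates \<open>z 1, \<dots>, z n\<close> matter.
\<close>

definition torus :: "nat \<Rightarrow> (nat \<Rightarrow> complex) set" where
  "torus n = {z. \<forall>i\<in>{1..n}. z i \<noteq> 0}"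

definition pole_complement :: "complex \<Rightarrow> nat \<Rightarrow> (nat \<Rightarrow> complex) set" where
  "pole_complement q n =
     {z \<in> torus n. \<forall>i\<in>{1..n}. \<forall>j\<in>{1..n}. i \<noteq> j \<longrightarrow> z i \<noteq> q^2 * z j \<and> z i \<noteq> z j / q^2}"

text \<open>By Osgood's lemma this is holomorphy in the variables \<open>z 1, \<dots>, z n\<close> jointly.\<close>

definition holomorphic_in ::
  "nat \<Rightarrow> (nat \<Rightarrow> complex) set \<Rightarrow> ((nat \<Rightarrow> complex) \<Rightarrow> complex) \<Rightarrow> bool" where
  "holomorphic_in n S F \<longleftrightarrow>
     continuous_on S F \<and>
     (\<forall>z\<in>S. \<forall>i\<in>{1..n}. (\<lambda>w. F (z(i := w))) holomorphic_on {w. z(i := w) \<in> S})"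

text \<open>
  The term indexed by \<open>(k\<^sub>1,\<dots>,k\<^sub>n)\<close>, \<open>(l\<^sub>1,\<dots>,l\<^sub>n)\<close> of the series
  \<open>L (f(z\<^sub>1)\<cdots>f(z\<^sub>n) v \<otimes> e(z\<^sub>1)\<cdots>e(z\<^sub>n) w)\<close>.
\<close>

definition current_term ::
  "('v::ab_group_add) uq_module \<Rightarrow> ('w::ab_group_add) uq_module \<Rightarrow> ('v \<Rightarrow> 'w \<Rightarrow> 't) \<Rightarrow>
   ('t \<Rightarrow> complex) \<Rightarrow> 'v \<Rightarrow> 'w \<Rightarrow> nat \<Rightarrow> (nat \<Rightarrow> complex) \<Rightarrow> int list \<times> int list \<Rightarrow> complex" where
  "current_term V W tens L v w n z =
     (\<lambda>(ks, ls). L (tens (foldr (fop V) ks v) (foldr (eop W) ls w)) *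
                 (\<Prod>i<n. z (Suc i) powi (- ks ! i - ls ! i)))"

text \<open>
  \<open>F\<close> is the sum of this series for \<open>|z\<^sub>1| \<gg> |z\<^sub>2| \<gg> \<dots> \<gg> |z\<^sub>n|\<close>, continued to a meromorphic function on
  the torus whose poles are simple and lie on the hypersurfaces \<open>z\<^sub>i = q\<^sup>\<plusminus>\<^sup>2 z\<^sub>j\<close>.  The complement
  of these hypersurfaces is connected, so \<open>F\<close> is uniquely determined there.
\<close>

definition is_integrand ::
  "complex \<Rightarrow> ('v::ab_group_add) uq_module \<Rightarrow> ('w::ab_group_add) uq_module \<Rightarrow> ('v \<Rightarrow> 'w \<Rightarrow> 't) \<Rightarrow>
   ('t \<Rightarrow> complex) \<Rightarrow> 'v \<Rightarrow> 'w \<Rightarrow> nat \<Rightarrow> ((nat \<Rightarrow> complex) \<Rightarrow> complex) \<Rightarrow> bool" where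
  "is_integrand q V W tens L v w n F \<longleftrightarrow>
     (\<exists>\<rho>>0. \<forall>z\<in>torus n. (\<forall>i\<in>{1..<n}. norm (z i) > \<rho> * norm (z (Suc i))) \<longrightarrow>
        (current_term V W tens L v w n z has_sum F z)
          ({ks. length ks = n} \<times> {ls. length ls = n})) \<and>
     holomorphic_in n (pole_complement q n) F \<and>
     (\<exists>G. holomorphic_in n (torus n) G \<and>
        (\<forall>z\<in>pole_complement q n.
           G z = F z * (\<Prod>j\<in>{1..n}. \<Prod>i\<in>{1..<j}. (z i - q^2 * z j) * (z i - z j / q^2))))"


section \<open>Contours and iterated integrals\<close>

definition contour :: "(real \<Rightarrow> complex) \<Rightarrow> bool" where
  "contour \<gamma> \<longleftrightarrow> valid_path \<gamma> \<and> simple_path \<gamma> \<and> pathfinish \<gamma> = pathstart \<gamma> \<and>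
     0 \<in> inside (path_image \<gamma>) \<and> winding_number \<gamma> 0 = 1"

text \<open>
  Fixed contours \<open>C\<^sub>1, \<dots>, C\<^sub>n\<close> satisfying all the conditions simultaneously.  For \<open>n \<ge> 2\<close> such
  contours exist only if \<open>|q| > 1\<close>, for instance \<open>|z\<^sub>i| = 1\<close>.
\<close>

definition fixed_contours :: "complex \<Rightarrow> nat \<Rightarrow> (nat \<Rightarrow> real \<Rightarrow> complex) \<Rightarrow> bool" where
  "fixed_contours q n C \<longleftrightarrow>
     (\<forall>i\<in>{1..n}. contour (C i)) \<and>
     (\<forall>i\<in>{1..n}. \<forall>j\<in>{1..n}. i \<noteq> j \<longrightarrow> (\<forall>z\<in>path_image (C j).
        z / q^2 \<in> inside (path_image (C i)) \<and> q^2 * z \<in> outside (path_image (C i))))"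

text \<open>
  For general \<open>q\<close> the contour \<open>C\<^sub>k\<close> of the variable \<open>z\<^sub>k\<close> has to depend on the values of the outer
  integration variables \<open>z\<^sub>j\<close>, \<open>j > k\<close>.  With \<open>m = 1\<close> the conditions below are those on the points
  \<open>q\<^sup>\<plusminus>\<^sup>2 z\<^sub>j\<close>, \<open>j > k\<close>.  The conditions with \<open>m > 1\<close> express those relative to the inner variables, whose
  contours have been integrated over already: the points \<open>q\<^sup>-\<^sup>2 z\<^sub>i\<close> with \<open>i < k\<close> are inside \<open>C\<^sub>k\<close>,
  where \<open>z\<^sub>i\<close> itself has the points \<open>q\<^sup>-\<^sup>2 z\<^sub>j\<close> inside its contour, and so on, which gives the points
  \<open>q\<^sup>-\<^sup>2\<^sup>m z\<^sub>j\<close> for the chains of length \<open>m \<le> k\<close> that pass through distinct indices; in the same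
  way \<open>q\<^sup>2\<^sup>m z\<^sub>j\<close> are outside.  These are the poles in \<open>z\<^sub>k\<close> of the integral over \<open>z\<^sub>1, \<dots>, z\<^sub>k\<^sub>-\<^sub>1\<close>, and
  for fixed contours as above the conditions with \<open>m > 1\<close> are automatic.
\<close>

definition nested_contours ::
  "complex \<Rightarrow> nat \<Rightarrow> (nat \<Rightarrow> (nat \<Rightarrow> complex) \<Rightarrow> real \<Rightarrow> complex) \<Rightarrow> bool" where
  "nested_contours q n C \<longleftrightarrow>
     (\<forall>k\<in>{1..n}. \<forall>z z'. (\<forall>j\<in>{k<..n}. z j = z' j) \<longrightarrow> C k z = C k z') \<and>
     (\<forall>k\<in>{1..n}. \<forall>z. (\<forall>j\<in>{k<..n}. z j \<in> path_image (C j z)) \<longrightarrow>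
        contour (C k z) \<and>
        (\<forall>j\<in>{k<..n}. \<forall>m\<in>{1..k}.
           z j / q^(2*m) \<in> inside (path_image (C k z)) \<and>
           q^(2*m) * z j \<in> outside (path_image (C k z))))"

definition separating_contours ::
  "complex \<Rightarrow> nat \<Rightarrow> (nat \<Rightarrow> (nat \<Rightarrow> complex) \<Rightarrow> real \<Rightarrow> complex) \<Rightarrow> bool" where
  "separating_contours q n C \<longleftrightarrow>
     (\<exists>C'. fixed_contours q n C' \<and> C = (\<lambda>k z. C' k)) \<or> nested_contours q n C"

text \<open>
  \<open>\<oint> dz\<^sub>n/z\<^sub>n \<oint> dz\<^sub>n\<^sub>-\<^sub>1/z\<^sub>n\<^sub>-\<^sub>1 \<cdots> \<oint> dz\<^sub>1/z\<^sub>1 F(z)\<close>, where the integral over \<open>z 1\<close> is the innermost one; the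
  outer variables are stored in \<open>z\<close>.
\<close>

primrec iterated_integral ::
  "(nat \<Rightarrow> (nat \<Rightarrow> complex) \<Rightarrow> real \<Rightarrow> complex) \<Rightarrow> ((nat \<Rightarrow> complex) \<Rightarrow> complex) \<Rightarrow>
   nat \<Rightarrow> (nat \<Rightarrow> complex) \<Rightarrow> complex" where
  "iterated_integral C F 0 z = F z"
| "iterated_integral C F (Suc k) z =
     contour_integral (C (Suc k) z) (\<lambda>w. iterated_integral C F k (z(Suc k := w)) / w)"

end

theory Submission
  imports Defs
begin

text \<open>
  Fix \<open>v\<close>, \<open>w\<close> and a form \<open>L\<close> in the restricted dual, and put
  \<open>c(k, l) = L (f\<^sub>k\<^sub>1 \<cdots> f\<^sub>k\<^sub>n v \<otimes> e\<^sub>l\<^sub>1 \<cdots> e\<^sub>l\<^sub>n w)\<close>.  By the exchange relations, \<open>c\<close> is determined by its values on weakly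
  increasing \<open>k\<close> and \<open>l\<close>, and only finitely many of these are nonzero.  Explicitly, with \<open>s = q\<^sup>2\<close> and
  \<open>\<theta>\<^sub>w(z) = \<Prod> (s z\<^sub>a - z\<^sub>b) / (z\<^sub>a - s z\<^sub>b)\<close> over the pairs \<open>a < b\<close> inverted by \<open>w\<close>, the series of \<open>e\<close>-coefficients is
  \<open>\<Sum>\<^sub>\<mu> c(k, \<mu>) / v\<^sub>\<mu> \<Sum>\<^sub>w \<theta>\<^sub>w(z) (w z)\<^sup>-\<^sup>\<mu>\<close>, where \<open>\<mu>\<close> is increasing and \<open>v\<^sub>\<mu> = \<Sum> s\<^sup>i\<^sup>n\<^sup>v\<close> over the stabilizer of \<open>\<mu>\<close>
  is a product of \<open>s\<close>-factorials (this is the theory of Hall-Littlewood polynomials); the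
  \<open>f\<close>-coefficients are treated in the same way with \<open>1/s\<close> in place of \<open>s\<close>.  Since the factors \<open>\<theta>\<^sub>w\<close> for
  \<open>s\<close> and \<open>1/s\<close> are inverse to each other, the integrand is \<open>\<Sum>\<^sub>w T(w z)\<close>, where \<open>T\<close> has poles only at
  \<open>z\<^sub>i = q\<^sup>-\<^sup>2 z\<^sub>j\<close> with \<open>i < j\<close>.

  In each summand \<open>T(w z)\<close> all poles point in one direction.  Integrating one variable at a time, by
  partial fractions, the separating contours may therefore be replaced by circles with
  \<open>|z\<^sub>w\<^sub>1| \<gg> |z\<^sub>w\<^sub>2| \<gg> \<dots>\<close>, where the integral is the constant term of the expansion of \<open>T\<close>.  All \<open>n!\<close>
  summands contribute \<open>\<Sum>\<^sub>\<mu> c(-\<mu>, \<mu>) / v\<^sub>\<mu>\<close>, which is the term of degree \<open>n\<close> of the ordered product of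
  \<open>q\<close>-exponentials.
\<close>

section \<open>Sequences satisfying exchange relations\<close>

text \<open>The obstacle is that the integrand has poles of both kinds, z_i = q^2 z_j and z_i = q^-2
  z_j. For |q| < 1 no concentric circles put them on the required sides, and the admissible contours
  depend on the outer variables. Put t = q^-2. In a single summand, for variables a before b in the
  order w, only z_a = t z_b is a pole: it has to lie inside the contour of z_a, and seen from z_b it
  is the point z_a / t, which has to lie outside. These sides are prescribed by the separating
  contours and equally by the circles, so the two systems can be compared one summand at a time,
  although they cannot be compared for the whole integrand. The comparison uses no deformation of
  contours. Integrating one variable by partial fractions gives a rational function that depends
  only on which poles are enclosed, and whose new poles z_a = t^m z_b have the same direction. Hence
  one sequence of rational functions computes the iterated integral for both systems. The powers t^m
  explain why nested contours must control all points q^(2m) z_j and q^(-2m) z_j.\<close>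

definition idx :: "nat \<Rightarrow> (nat \<Rightarrow> int) set" where
  "idx n = {k. \<forall>i. i \<notin> {1..n} \<longrightarrow> k i = 0}"

text \<open>
  The coefficient of \<open>z\<^sup>-\<^sup>k\<close> in \<open>(z\<^sub>i - s z\<^sub>i\<^sub>+\<^sub>1) E(z) = (s z\<^sub>i - z\<^sub>i\<^sub>+\<^sub>1) E(s\<^sub>i z)\<close>, where \<open>E(z) = \<Sum>\<^sub>k E\<^sub>k z\<^sup>-\<^sup>k\<close> and
  \<open>s\<^sub>i\<close> exchanges the variables \<open>i\<close> and \<open>i + 1\<close>.
\<close>

definition exchange_rel :: "complex \<Rightarrow> nat \<Rightarrow> ((nat \<Rightarrow> int) \<Rightarrow> complex) \<Rightarrow> bool" where
  "exchange_rel s n E \<longleftrightarrow> (\<forall>k\<in>idx n. \<forall>i\<in>{1..<n}.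
     E (k(i := k i + 1)) - s * E (k(Suc i := k (Suc i) + 1)) =
     s * E (k(i := k (Suc i), Suc i := k i + 1)) - E (k(i := k (Suc i) + 1, Suc i := k i)))"

lemma idx_upd: "k \<in> idx n \<Longrightarrow> i \<in> {1..n} \<Longrightarrow> k(i := x) \<in> idx n"
  by (auto simp: idx_def)

lemma exchange_rel_pair:
  assumes "exchange_rel s n E" "k \<in> idx n" "i \<in> {1..<n}"
  shows "E (k(i := a + 1, Suc i := b)) - s * E (k(i := a, Suc i := b + 1)) =
         s * E (k(i := b, Suc i := a + 1)) - E (k(i := b + 1, Suc i := a))"
proof -
  let ?k = "k(i := a, Suc i := b)"
  have "?k \<in> idx n" using assms by (intro idx_upd) auto
  with assms(1,3) have "E (?k(i := ?k i + 1)) - s * E (?k(Suc i := ?k (Suc i) + 1)) =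
     s * E (?k(i := ?k (Suc i), Suc i := ?k i + 1)) - E (?k(i := ?k (Suc i) + 1, Suc i := ?k i))"
    unfolding exchange_rel_def by blast
  moreover have "?k(i := ?k i + 1) = k(i := a + 1, Suc i := b)" by (auto simp: fun_eq_iff)
  ultimately show ?thesis by simp
qed

text \<open>Straightening of one descent. The relation expresses the pair \<open>(a, b)\<close>
  through \<open>(b, a)\<close>, \<open>(b + 1, a - 1)\<close> and \<open>(a - 1, b + 1)\<close>.
  For a gap of at least 2 the first two are weakly increasing, and the third has a gap smaller by 2,
  so the induction runs on \<open>a - b\<close>.\<close>

lemma exchange_pair_zero:
  assumes rel: "exchange_rel s n E" and k: "k \<in> idx n" and i: "i \<in> {1..<n}"
    and zero: "\<And>c d. \<lbrakk>c \<le> d; c + d = a + b; b \<le> c\<rbrakk> \<Longrightarrow> E (k(i := c, Suc i := d)) = 0"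
    and "b < a"
  shows "E (k(i := a, Suc i := b)) = 0"
  using \<open>b < a\<close> zero
proof (induction "nat (a - b)" arbitrary: a b rule: less_induct)
  case less
  note rel' = exchange_rel_pair[OF rel k i, of "a - 1" b]
  have 1: "E (k(i := b, Suc i := a)) = 0" using less.prems by auto
  show ?case
  proof (cases "a = b + 1")
    case True
    \<comment> \<open>At gap 1 the relation contains the unknown on both sides with opposite signs,
      which forces it to vanish.\<close>
    have "E (k(i := a, Suc i := b)) = - E (k(i := a, Suc i := b))"
      using rel' True 1 by simp
    then show ?thesis by simp
  next
    case False
    have mid: "E (k(i := a - 1, Suc i := b + 1)) = 0"
    proof (cases "a - 1 = b + 1")
      case True then show ?thesis using less.prems(1) by (intro less.prems(2)) auto
    next
      case neq: False
      show ?thesis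
        by (rule less.hyps) (use less.prems(1) False neq in \<open>auto intro!: less.prems(2)\<close>)
    qed
    have "E (k(i := b + 1, Suc i := a - 1)) = 0"
      using less.prems(1) False by (intro less.prems(2)) auto
    with rel' 1 mid show ?thesis by simp
  qed
qed

text \<open>Repeated straightening reduces any exponent to weakly increasing ones. Replacing a
  descent by a weakly increasing pair with the same sum moves weight to the right, so the weighted
  sum of \<open>M - k i\<close> drops. The bound \<open>M\<close> on the entries keeps this sum
  nonnegative, and it is preserved because the new entries lie between the old ones.\<close>

lemma exchange_rel_zero:
  assumes rel: "exchange_rel s n E"
    and zero: "\<And>k. k \<in> idx n \<Longrightarrow> mono_on {1..n} k \<Longrightarrow> E k = 0"
    and k: "k \<in> idx n"
  shows "E k = 0"
proof -
  define M where "M = Max (k ` {1..n} \<union> {0})"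
  have M: "\<And>i. i \<in> {1..n} \<Longrightarrow> k i \<le> M" unfolding M_def by (intro Max_ge) auto
  have "E k = 0" if "k \<in> idx n" "\<And>i. i \<in> {1..n} \<Longrightarrow> k i \<le> M" for k
    using that
  proof (induction "nat (\<Sum>i\<in>{1..n}. int i * (M - k i))" arbitrary: k rule: less_induct)
    case less
    show ?case
    proof (cases "\<forall>i\<in>{1..<n}. k i \<le> k (Suc i)")
      case True
      have "k i \<le> k j" if "i \<le> j" "1 \<le> i" "j \<le> n" for i j
        using that
      proof (induction j rule: dec_induct)
        case (step j)
        then have "k i \<le> k j" "k j \<le> k (Suc j)" using True by auto
        then show ?case by linarith
      qed simp
      then have "mono_on {1..n} k" by (auto intro!: monotone_onI)
      with zero less.prems show ?thesis by blast
    next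
      case False
      then obtain i where i: "i \<in> {1..<n}" "k (Suc i) < k i" by auto
      have "E (k(i := k i, Suc i := k (Suc i))) = 0"
      proof (rule exchange_pair_zero[OF rel less.prems(1) i(1) _ i(2)])
        fix c d assume cd: "c \<le> d" "c + d = k i + k (Suc i)" "k (Suc i) \<le> c"
        let ?k = "k(i := c, Suc i := d)"
        have split: "{1..n} = insert i (insert (Suc i) ({1..n} - {i, Suc i}))" using i by auto
        have sum_split: "(\<Sum>j\<in>{1..n}. int j * (M - h j)) =
             int i * (M - h i) + (int (Suc i) * (M - h (Suc i)) + (\<Sum>j\<in>{1..n} - {i, Suc i}. int j * (M - h j)))"
          for h by (subst split) (simp del: of_nat_Suc)
        have rest: "(\<Sum>j\<in>{1..n} - {i, Suc i}. int j * (M - ?k j)) = (\<Sum>j\<in>{1..n} - {i, Suc i}. int j * (M - k j))"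
          by (rule sum.cong) auto
        have "c < k i" using cd i by linarith
        have dle: "d \<le> M" using cd less.prems(2)[of i] i by auto
        have cle: "c \<le> M" using cd(1) dle by linarith
        have d: "d = k i + k (Suc i) - c" using cd by linarith
        have "(\<Sum>j\<in>{1..n}. int j * (M - ?k j)) < (\<Sum>j\<in>{1..n}. int j * (M - k j))"
        proof -
          have "int i * c + int i * d = int i * k i + int i * k (Suc i)"
            using cd(2) by (metis distrib_left)
          moreover have "k (Suc i) < d" using \<open>c < k i\<close> d by linarith
          ultimately show ?thesis unfolding sum_split rest by (simp add: algebra_simps)
        qed
        moreover have "0 \<le> (\<Sum>j\<in>{1..n}. int j * (M - ?k j))"
          using less.prems(2) cle dle by (intro sum_nonneg) auto
        ultimately have "nat (\<Sum>j\<in>{1..n}. int j * (M - ?k j)) < nat (\<Sum>j\<in>{1..n}. int j * (M - k j))"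
          by linarith
        moreover have "?k \<in> idx n" using less.prems(1) i by (intro idx_upd) auto
        ultimately show "E ?k = 0"
          by (rule less.hyps) (use less.prems(2) cle dle in auto)
      qed
      then show ?thesis by simp
    qed
  qed
  with k M show ?thesis by blast
qed

section \<open>Expansions of products of theta factors\<close>

definition zpow :: "nat \<Rightarrow> (nat \<Rightarrow> int) \<Rightarrow> (nat \<Rightarrow> complex) \<Rightarrow> complex" where
  "zpow n k z = (\<Prod>i\<in>{1..n}. z i powi (- k i))"

text \<open>
  \<open>theta_coeff s\<close> are the coefficients of \<open>(s - u) / (1 - s u)\<close>, and \<open>theta_series s ps \<kappa>\<close> those of
  \<open>z\<^sup>-\<^sup>\<kappa> \<Prod> (s z\<^sub>a - z\<^sub>b) / (z\<^sub>a - s z\<^sub>b)\<close>, the product over the pairs \<open>(a, b)\<close> in \<open>ps\<close>, expanded for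
  \<open>|z\<^sub>a| > |s z\<^sub>b|\<close>.  For \<open>a < b\<close> the sums over \<open>r\<close> are finite; otherwise \<open>suminf\<close> may be junk.
\<close>

definition theta_coeff :: "complex \<Rightarrow> nat \<Rightarrow> complex" where
  "theta_coeff s r = (if r = 0 then s else s ^ (r - 1) * (s^2 - 1))"

fun theta_series :: "complex \<Rightarrow> (nat \<times> nat) list \<Rightarrow> (nat \<Rightarrow> int) \<Rightarrow> (nat \<Rightarrow> int) \<Rightarrow> complex" where
  "theta_series s [] \<kappa> l = (if l = \<kappa> then 1 else 0)"
| "theta_series s ((a, b) # ps) \<kappa> l =
     (\<Sum>r. theta_coeff s r * theta_series s ps \<kappa> (l(a := l a - int r, b := l b + int r)))"

text \<open>Each factor contributes a nonnegative multiple of \<open>e_a - e_b\<close> to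
  \<open>l - \<kappa>\<close>, and a functional \<open>\<mu>\<close> with
  \<open>\<mu> a \<le> \<mu> b\<close> is nonpositive on all of these.\<close>

lemma theta_series_support:
  assumes "theta_series s ps \<kappa> l \<noteq> 0"
    and "\<forall>(a, b)\<in>set ps. a \<in> {1..n} \<and> b \<in> {1..n} \<and> a \<noteq> b \<and> \<mu> a \<le> (\<mu> b :: int)"
  shows "(\<Sum>i\<in>{1..n}. (l i - \<kappa> i) * \<mu> i) \<le> 0"
  using assms
proof (induction ps arbitrary: l)
  case Nil
  then show ?case by (simp split: if_splits)
next
  case (Cons p ps)
  obtain a b where p: "p = (a, b)" by (cases p)
  \<comment> \<open>Convergence is no issue here: \<open>suminf\<close> is 0 as soon as all terms
    are.\<close>
  have "\<exists>r. theta_coeff s r * theta_series s ps \<kappa> (l(a := l a - int r, b := l b + int r)) \<noteq> 0"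
  proof (rule ccontr)
    assume "\<not> ?thesis"
    then have "(\<lambda>r. theta_coeff s r * theta_series s ps \<kappa> (l(a := l a - int r, b := l b + int r))) = (\<lambda>r. 0)"
      by auto
    then have "theta_series s (p # ps) \<kappa> l = 0" by (simp only: p theta_series.simps suminf_zero)
    with Cons.prems show False by simp
  qed
  then obtain r where r: "theta_series s ps \<kappa> (l(a := l a - int r, b := l b + int r)) \<noteq> 0" by auto
  let ?l = "l(a := l a - int r, b := l b + int r)"
  have ab: "a \<in> {1..n}" "b \<in> {1..n}" "a \<noteq> b" "\<mu> a \<le> \<mu> b" using Cons.prems(2) p by auto
  have split: "{1..n} = insert a (insert b ({1..n} - {a, b}))" using ab by auto
  have rest: "(\<Sum>j\<in>{1..n} - {a, b}. (?l j - \<kappa> j) * \<mu> j) = (\<Sum>j\<in>{1..n} - {a, b}. (l j - \<kappa> j) * \<mu> j)"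
    by (rule sum.cong) auto
  have "(\<Sum>i\<in>{1..n}. (?l i - \<kappa> i) * \<mu> i) \<le> 0"
    by (rule Cons.IH[OF r]) (use Cons.prems(2) in auto)
  moreover have "(\<Sum>i\<in>{1..n}. (?l i - \<kappa> i) * \<mu> i) =
      (\<Sum>i\<in>{1..n}. (l i - \<kappa> i) * \<mu> i) + int r * (\<mu> b - \<mu> a)"
    by (subst (1 2) split) (use ab rest in \<open>simp add: algebra_simps\<close>)
  moreover have "int r * (\<mu> b - \<mu> a) \<ge> 0" using ab by simp
  ultimately show ?case by linarith
qed

text \<open>Paired with the functional \<open>i |-> i\<close>, each unit of \<open>r\<close>
  contributes \<open>b - a\<close>, which is at least 1, while the support condition bounds the
  total.\<close>

lemma theta_series_finite:
  assumes ps: "\<forall>(a, b)\<in>set ps. a \<in> {1..n} \<and> b \<in> {1..n} \<and> a < b"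
    and ab: "a \<in> {1..n}" "b \<in> {1..n}" "a < b"
  shows "finite {r. theta_series s ps \<kappa> (l(a := l a - int r, b := l b + int r)) \<noteq> 0}"
proof (rule finite_subset)
  let ?S = "\<Sum>i\<in>{1..n}. (l i - \<kappa> i) * int i"
  show "{r. theta_series s ps \<kappa> (l(a := l a - int r, b := l b + int r)) \<noteq> 0} \<subseteq> {..nat (- ?S)}"
  proof
    fix r assume "r \<in> {r. theta_series s ps \<kappa> (l(a := l a - int r, b := l b + int r)) \<noteq> 0}"
    then have r: "theta_series s ps \<kappa> (l(a := l a - int r, b := l b + int r)) \<noteq> 0" by simp
    let ?l = "l(a := l a - int r, b := l b + int r)"
    have split: "{1..n} = insert a (insert b ({1..n} - {a, b}))" using ab by auto
    have rest: "(\<Sum>j\<in>{1..n} - {a, b}. (?l j - \<kappa> j) * int j) = (\<Sum>j\<in>{1..n} - {a, b}. (l j - \<kappa> j) * int j)"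
      by (rule sum.cong) auto
    have "(\<Sum>i\<in>{1..n}. (?l i - \<kappa> i) * int i) \<le> 0"
      by (rule theta_series_support[OF r]) (use ps in auto)
    moreover have "(\<Sum>i\<in>{1..n}. (?l i - \<kappa> i) * int i) = ?S + int r * (int b - int a)"
      by (subst (1 2) split) (use ab rest in \<open>simp add: algebra_simps\<close>)
    moreover have "int r * (int b - int a) \<ge> int r * 1"
      using ab by (intro mult_left_mono) auto
    ultimately show "r \<in> {..nat (- ?S)}" by auto
  qed
qed auto

text \<open>Test the support condition with \<open>\<mu> = l\<close> and \<open>\<mu> = -\<kappa>\<close>: then \<open>|l - \<kappa>|\<^sup>2 \<le> 0\<close>.\<close>

lemma theta_series_dominant:
  assumes ps: "\<forall>(a, b)\<in>set ps. a \<in> {1..n} \<and> b \<in> {1..n} \<and> a < b \<and> l a \<le> l b \<and> \<kappa> b \<le> \<kappa> a"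
    and l: "l \<in> idx n" and \<kappa>: "\<kappa> \<in> idx n"
  shows "theta_series s ps \<kappa> l = (if l = \<kappa> then s ^ length ps else 0)"
  using ps
proof (induction ps)
  case Nil
  then show ?case by simp
next
  case (Cons p ps)
  obtain a b where p: "p = (a, b)" by (cases p)
  have ab: "a \<in> {1..n}" "b \<in> {1..n}" "a < b" "l a \<le> l b" "\<kappa> b \<le> \<kappa> a" using Cons.prems p by auto
  let ?l = "\<lambda>r. l(a := l a - int r, b := l b + int r)"
  have zero: "theta_series s ps \<kappa> (?l r) = 0" if r: "r > 0" for r
  proof (rule ccontr)
    assume nz: "theta_series s ps \<kappa> (?l r) \<noteq> 0"
    have split: "{1..n} = insert a (insert b ({1..n} - {a, b}))" using ab by auto
    have val: "(\<Sum>i\<in>{1..n}. (?l r i - \<kappa> i) * \<mu> i) = (\<Sum>i\<in>{1..n}. (l i - \<kappa> i) * \<mu> i) + int r * (\<mu> b - \<mu> a)"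
      for \<mu> :: "nat \<Rightarrow> int"
    proof -
      have rest: "(\<Sum>j\<in>{1..n} - {a, b}. (?l r j - \<kappa> j) * \<mu> j) = (\<Sum>j\<in>{1..n} - {a, b}. (l j - \<kappa> j) * \<mu> j)"
        by (rule sum.cong) auto
      show ?thesis by (subst (1 2) split) (use ab rest in \<open>simp add: algebra_simps\<close>)
    qed
    have le: "(\<Sum>i\<in>{1..n}. (l i - \<kappa> i) * \<mu> i) + int r * (\<mu> b - \<mu> a) \<le> 0"
      if "\<forall>(a, b)\<in>set ps. \<mu> a \<le> \<mu> b" for \<mu> :: "nat \<Rightarrow> int"
      unfolding val[symmetric]
      by (rule theta_series_support[OF nz]) (use that Cons.prems in auto)
    have "(\<Sum>i\<in>{1..n}. (l i - \<kappa> i) * l i) \<le> 0"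
    proof -
      have "\<forall>(a, b)\<in>set ps. l a \<le> l b" using Cons.prems by auto
      moreover have "int r * (l b - l a) \<ge> 0" using ab by simp
      ultimately show ?thesis using le[of l] by linarith
    qed
    moreover have "(\<Sum>i\<in>{1..n}. (l i - \<kappa> i) * (- \<kappa> i)) \<le> 0"
    proof -
      have "\<forall>(a, b)\<in>set ps. - \<kappa> a \<le> - \<kappa> b" using Cons.prems by auto
      moreover have "int r * (- \<kappa> b - - \<kappa> a) \<ge> 0" using ab by simp
      ultimately show ?thesis using le[of "\<lambda>i. - \<kappa> i"] by linarith
    qed
    moreover have "(\<Sum>i\<in>{1..n}. (l i - \<kappa> i)\<^sup>2) =
        (\<Sum>i\<in>{1..n}. (l i - \<kappa> i) * l i) + (\<Sum>i\<in>{1..n}. (l i - \<kappa> i) * (- \<kappa> i))"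
      unfolding sum.distrib[symmetric] by (rule sum.cong) (auto simp: power2_eq_square algebra_simps)
    ultimately have "(\<Sum>i\<in>{1..n}. (l i - \<kappa> i)\<^sup>2) \<le> 0" by linarith
    moreover have "(\<Sum>i\<in>{1..n}. (l i - \<kappa> i)\<^sup>2) \<ge> 0" by (intro sum_nonneg) auto
    ultimately have "(\<Sum>i\<in>{1..n}. (l i - \<kappa> i)\<^sup>2) = 0" by linarith
    then have "\<forall>i\<in>{1..n}. l i = \<kappa> i" by (subst (asm) sum_nonneg_eq_0_iff) auto
    \<comment> \<open>Once \<open>l = \<kappa>\<close>, the functional \<open>int\<close> leaves
      only \<open>r (b - a) \<le> 0\<close>, which excludes \<open>r > 0\<close>.\<close>
    then have "(\<Sum>i\<in>{1..n}. (l i - \<kappa> i) * int i) = 0" by simp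
    moreover have "\<forall>(a, b)\<in>set ps. int a \<le> int b" using Cons.prems by auto
    ultimately have "int r * (int b - int a) \<le> 0"
      using le[of int] by linarith
    moreover have "int r * (int b - int a) > 0" using r ab by simp
    ultimately show False by simp
  qed
  have "theta_series s (p # ps) \<kappa> l = (\<Sum>r\<in>{0}. theta_coeff s r * theta_series s ps \<kappa> (?l r))"
    unfolding p theta_series.simps by (rule suminf_finite) (use zero in auto)
  also have "\<dots> = s * theta_series s ps \<kappa> l" by (simp add: theta_coeff_def)
  also have "theta_series s ps \<kappa> l = (if l = \<kappa> then s ^ length ps else 0)"
    using Cons by auto
  finally show ?case by simp
qed

text \<open>Coefficient form of cancelling one denominator: multiplying
  \<open>(s z_a - z_b) / (z_a - s z_b)\<close> by \<open>z_a - s z_b\<close> leaves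
  \<open>s z_a - z_b\<close>. Multiplication by \<open>z_a\<close> raises the index at
  \<open>a\<close>, because exponents are negated.\<close>

lemma theta_series_relation:
  assumes ps: "\<forall>(a, b)\<in>set ps. a \<in> {1..n} \<and> b \<in> {1..n} \<and> a < b"
    and ab: "a \<in> {1..n}" "b \<in> {1..n}" "a < b"
  shows "theta_series s ((a, b) # ps) \<kappa> (l(a := l a + 1)) - s * theta_series s ((a, b) # ps) \<kappa> (l(b := l b + 1))
       = s * theta_series s ps \<kappa> (l(a := l a + 1)) - theta_series s ps \<kappa> (l(b := l b + 1))"
proof -
  define g where "g = (\<lambda>r::nat. theta_series s ps \<kappa> (l(a := l a + 1 - int r, b := l b + int r)))"
  have fin: "finite {r. g r \<noteq> 0}"
    using theta_series_finite[OF ps ab, of s \<kappa> "l(a := l a + 1)"] ab by (simp add: g_def)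
  have summ: "summable (\<lambda>r. h r * g r)" "summable (\<lambda>r. h r * g (Suc r))" for h
    by (rule summable_finite[OF fin]; simp)
       (rule summable_finite[OF finite_vimageI[OF fin, of Suc]]; simp add: vimage_def)
  have gS: "theta_series s ps \<kappa> (l(a := l a - int r, b := l b + 1 + int r)) = g (Suc r)" for r
    by (simp add: g_def algebra_simps)
  have 1: "theta_series s ((a, b) # ps) \<kappa> (l(a := l a + 1)) = (\<Sum>r. theta_coeff s r * g r)"
    using ab by (simp add: g_def)
  have 2: "theta_series s ((a, b) # ps) \<kappa> (l(b := l b + 1)) = (\<Sum>r. theta_coeff s r * g (Suc r))"
    using ab by (simp add: gS[symmetric] fun_upd_twist)
  have head: "(\<Sum>r. theta_coeff s r * g r) = theta_coeff s 0 * g 0 + (\<Sum>r. theta_coeff s (Suc r) * g (Suc r))"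
    using suminf_split_head[OF summ(1)[of "theta_coeff s"]] by simp
  have "(\<Sum>r. theta_coeff s (Suc r) * g (Suc r)) - s * (\<Sum>r. theta_coeff s r * g (Suc r)) =
     (\<Sum>r. (theta_coeff s (Suc r) - s * theta_coeff s r) * g (Suc r))"
    by (simp add: suminf_mult[OF summ(2), symmetric] suminf_diff summ(2) summable_mult left_diff_distrib mult.assoc)
  \<comment> \<open>From index 1 on \<open>theta_coeff\<close> is geometric with ratio
    \<open>s\<close>, so only \<open>r = 0\<close> survives, with coefficient
    \<open>s^2 - 1 - s * s = -1\<close>.\<close>
  also have "\<dots> = (\<Sum>r\<in>{0}. (theta_coeff s (Suc r) - s * theta_coeff s r) * g (Suc r))"
  proof (rule suminf_finite)
    fix r :: nat assume "r \<notin> {0}"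
    then obtain r' where "r = Suc r'" by (cases r) auto
    then show "(theta_coeff s (Suc r) - s * theta_coeff s r) * g (Suc r) = 0"
      by (simp add: theta_coeff_def)
  qed simp
  finally have "(\<Sum>r. theta_coeff s r * g r) - s * (\<Sum>r. theta_coeff s r * g (Suc r)) = s * g 0 - g 1"
    unfolding head by (simp add: theta_coeff_def power2_eq_square algebra_simps)
  moreover have "g 0 = theta_series s ps \<kappa> (l(a := l a + 1))" "g 1 = theta_series s ps \<kappa> (l(b := l b + 1))"
    unfolding g_def using ab by (auto intro!: arg_cong[of _ _ "theta_series s ps \<kappa>"])
  ultimately show ?thesis unfolding 1 2 by simp
qed

lemma theta_series_permute:
  assumes "\<sigma> permutes {1..n}"
  shows "theta_series s ps \<kappa> (l \<circ> \<sigma>) = theta_series s (map (map_prod \<sigma> \<sigma>) ps) (\<kappa> \<circ> inv \<sigma>) l"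
proof (induction ps arbitrary: l)
  case Nil
  have "l \<circ> \<sigma> = \<kappa> \<longleftrightarrow> l = \<kappa> \<circ> inv \<sigma>"
    using permutes_inv_o[OF assms] by (metis comp_assoc comp_id)
  then show ?case by (simp del: o_apply)
next
  case (Cons p ps)
  obtain a b where p: "p = (a, b)" by (cases p)
  have inj: "\<sigma> i = \<sigma> j \<longleftrightarrow> i = j" for i j
    using permutes_inj[OF assms] by (auto simp: inj_def)
  have "(l \<circ> \<sigma>)(a := (l \<circ> \<sigma>) a - int r, b := (l \<circ> \<sigma>) b + int r) =
        l(\<sigma> a := l (\<sigma> a) - int r, \<sigma> b := l (\<sigma> b) + int r) \<circ> \<sigma>" for r
    by (auto simp: fun_eq_iff inj)
  then have "theta_series s (p # ps) \<kappa> (l \<circ> \<sigma>) = (\<Sum>r. theta_coeff s r *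
      theta_series s ps \<kappa> (l(\<sigma> a := l (\<sigma> a) - int r, \<sigma> b := l (\<sigma> b) + int r) \<circ> \<sigma>))"
    by (simp only: p theta_series.simps)
  then show ?case by (simp only: Cons.IH p list.map map_prod_simp theta_series.simps)
qed

section \<open>Convergence of the theta expansions\<close>

definition region :: "nat \<Rightarrow> real \<Rightarrow> (nat \<Rightarrow> complex) set" where
  "region n \<rho> = {z\<in>torus n. \<forall>i\<in>{1..<n}. norm (z i) > \<rho> * norm (z (Suc i))}"

definition theta :: "complex \<Rightarrow> complex \<Rightarrow> complex \<Rightarrow> complex" where
  "theta s x y = (s * x - y) / (x - s * y)"

text \<open>Unconditional convergence of complex series is absolute, which justifies summing over
  the product in either order.\<close>

lemma has_sum_times_complex:
  fixes f :: "'a \<Rightarrow> complex" and g :: "'b \<Rightarrow> complex"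
  assumes "(f has_sum a) A" "(g has_sum b) B"
  shows "((\<lambda>(x, y). f x * g y) has_sum a * b) (A \<times> B)"
proof (rule has_sum_SigmaI)
  show "((\<lambda>y. case (x, y) of (x, y) \<Rightarrow> f x * g y) has_sum f x * b) B" for x
    using has_sum_cmult_right[OF assms(2)] by simp
  show "((\<lambda>x. f x * b) has_sum a * b) A" using has_sum_cmult_left[OF assms(1)] .
  have f: "(\<lambda>x. norm (f x)) summable_on A" and g: "(\<lambda>y. norm (g y)) summable_on B"
    using assms[THEN has_sum_imp_summable] by (simp_all only: summable_on_iff_abs_summable_on_complex)
  have "(\<lambda>p. norm (case p of (x, y) \<Rightarrow> f x * g y)) summable_on (A \<times> B)"
    unfolding Infinite_Sum.abs_summable_on_Sigma_iff
  proof (intro conjI ballI)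
    show "(\<lambda>y. norm (case (x, y) of (x, y) \<Rightarrow> f x * g y)) summable_on B" for x
      using summable_on_cmult_right[OF g, of "norm (f x)"] by (simp add: norm_mult)
    have "(\<lambda>x. norm (f x) * (\<Sum>\<^sub>\<infinity>y\<in>B. norm (g y))) summable_on A"
      by (rule summable_on_cmult_left[OF f])
    moreover have "norm (\<Sum>\<^sub>\<infinity>y\<in>B. norm (f x * g y)) = norm (f x) * (\<Sum>\<^sub>\<infinity>y\<in>B. norm (g y))" for x
      by (simp add: norm_mult infsum_cmult_right' abs_mult infsum_nonneg)
    ultimately show "(\<lambda>x. norm (\<Sum>\<^sub>\<infinity>y\<in>B. norm (case (x, y) of (x, y) \<Rightarrow> f x * g y))) summable_on A"
      by simp
  qed
  then show "(\<lambda>(x, y). f x * g y) summable_on A \<times> B" by (rule abs_summable_summable)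
qed

lemma theta_coeff_has_sum:
  assumes "norm (s * u) < 1"
  shows "((\<lambda>r. theta_coeff s r * u ^ r) has_sum (s - u) / (1 - s * u)) UNIV"
proof (rule norm_summable_imp_has_sum)
  have geo: "(\<lambda>r. (s * u) ^ r) sums (1 / (1 - s * u))" by (rule geometric_sums[OF assms])
  have S: "theta_coeff s (Suc r) * u ^ Suc r = (s^2 - 1) * u * (s * u) ^ r" for r
    by (simp add: theta_coeff_def power_mult_distrib)
  have "1 - s * u \<noteq> 0" using assms by auto
  have "(\<lambda>r. theta_coeff s (Suc r) * u ^ Suc r) sums ((s^2 - 1) * u * (1 / (1 - s * u)))"
    unfolding S by (rule sums_mult[OF geo])
  then have "(\<lambda>r. theta_coeff s r * u ^ r) sums ((s^2 - 1) * u * (1 / (1 - s * u)) + theta_coeff s 0 * u ^ 0)"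
    by (rule sums_Suc)
  also have "(s^2 - 1) * u * (1 / (1 - s * u)) + theta_coeff s 0 * u ^ 0 = (s - u) / (1 - s * u)"
    using \<open>1 - s * u \<noteq> 0\<close> by (simp add: theta_coeff_def field_simps power2_eq_square)
  finally show "(\<lambda>r. theta_coeff s r * u ^ r) sums ((s - u) / (1 - s * u))" .
  have "summable (\<lambda>r. norm ((s^2 - 1) * u) * norm (s * u) ^ r)"
    by (intro summable_mult summable_geometric) (use assms in auto)
  then have "summable (\<lambda>r. norm (theta_coeff s (Suc r) * u ^ Suc r))"
    unfolding S by (simp only: norm_mult norm_power)
  then show "summable (\<lambda>r. norm (theta_coeff s r * u ^ r))"
    by (subst (asm) summable_Suc_iff)
qed

lemma zpow_add: "z \<in> torus n \<Longrightarrow> zpow n (\<lambda>i. k i + l i) z = zpow n k z * zpow n l z"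
  by (simp add: zpow_def torus_def prod.distrib[symmetric] power_int_add power_int_diff field_simps power_int_minus)

lemma zpow_shift:
  assumes "z \<in> torus n" "a \<in> {1..n}" "b \<in> {1..n}" "a \<noteq> b"
  shows "zpow n (k(a := k a + int r, b := k b - int r)) z = (z b / z a) ^ r * zpow n k z"
proof -
  have split: "{1..n} = insert a (insert b ({1..n} - {a, b}))" using assms by auto
  have rest: "(\<Prod>j\<in>{1..n} - {a, b}. z j powi (- (k(a := k a + int r, b := k b - int r)) j)) =
      (\<Prod>j\<in>{1..n} - {a, b}. z j powi (- k j))"
    by (rule prod.cong) auto
  have nz: "z a \<noteq> 0" "z b \<noteq> 0" using assms by (auto simp: torus_def)
  have eq: "- int r - k a = - k a - int r" by simp
  have "z a powi (- int r - k a) = z a powi (- k a) / z a ^ r"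
    unfolding eq using nz power_int_diff[of "z a" "- k a" "int r"] by simp
  moreover have "z b powi (int r - k b) = z b powi (- k b) * z b ^ r"
    using nz power_int_add[of "z b" "- k b" "int r"] by simp
  ultimately show ?thesis
    unfolding zpow_def by (subst (1 2) split) (use assms rest in \<open>simp add: field_simps power_divide\<close>)
qed

text \<open>Multiplying a series by one theta factor acts on its coefficients as the recursion of
  \<open>theta_series\<close> does. The factor is expanded in \<open>z_b / z_a\<close>, whose powers
  are absorbed by shifting the monomial.\<close>

lemma theta_step_has_sum:
  assumes z: "z \<in> torus n" and ab: "a \<in> {1..n}" "b \<in> {1..n}" "a \<noteq> b"
    and lt: "norm (s * z b) < norm (z a)"
    and g: "((\<lambda>k. g k * zpow n k z) has_sum G) (idx n)"
  shows "((\<lambda>k. (\<Sum>r. theta_coeff s r * g (k(a := k a - int r, b := k b + int r))) * zpow n k z)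
           has_sum theta s (z a) (z b) * G) (idx n)"
proof -
  define u where "u = z b / z a"
  have nz: "z a \<noteq> 0" "z b \<noteq> 0" using z ab by (auto simp: torus_def)
  have "norm (s * u) < 1" using lt nz by (simp add: u_def norm_mult norm_divide)
  from has_sum_times_complex[OF theta_coeff_has_sum[OF this] g]
  have "((\<lambda>(r, k). theta_coeff s r * u ^ r * (g k * zpow n k z)) has_sum (s - u) / (1 - s * u) * G) (UNIV \<times> idx n)" .
  also have "(s - u) / (1 - s * u) = theta s (z a) (z b)"
    using nz by (simp add: theta_def u_def divide_simps)
  finally have "((\<lambda>(r, k). theta_coeff s r * u ^ r * (g k * zpow n k z)) has_sum theta s (z a) (z b) * G) (UNIV \<times> idx n)" .
  also have "?this \<longleftrightarrow> ((\<lambda>(k, r). theta_coeff s r * g (k(a := k a - int r, b := k b + int r)) * zpow n k z)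
       has_sum theta s (z a) (z b) * G) (idx n \<times> UNIV)"
  proof (rule has_sum_reindex_bij_witness[of _ "\<lambda>(k, r). (r, k(a := k a - int r, b := k b + int r))"
        "\<lambda>(r, k). (k(a := k a + int r, b := k b - int r), r)"], goal_cases)
    case (1 x) then show ?case using ab by (cases x) (auto simp: fun_eq_iff)
  next
    case (2 x) then show ?case using ab by (cases x) (auto intro!: idx_upd)
  next
    case (3 x) then show ?case using ab by (cases x) (auto simp: fun_eq_iff)
  next
    case (4 x) then show ?case using ab by (cases x) (auto intro!: idx_upd)
  next
    case (5 x)
    obtain r k where x: "x = (r, k)" by (cases x)
    have "(k(a := k a + int r, b := k b - int r))(a := (k(a := k a + int r, b := k b - int r)) a - int r,
       b := (k(a := k a + int r, b := k b - int r)) b + int r) = k" using ab by (auto simp: fun_eq_iff)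
    then show ?case using zpow_shift[OF z ab, of k r] by (simp add: x u_def)
  qed simp
  finally have *: "((\<lambda>(k, r). theta_coeff s r * g (k(a := k a - int r, b := k b + int r)) * zpow n k z)
       has_sum theta s (z a) (z b) * G) (idx n \<times> UNIV)" .
  \<comment> \<open>Summing over \<open>r\<close> first turns the double series into a series over
    \<open>k\<close> whose coefficients are the \<open>suminf\<close> of the recursion.\<close>
  show ?thesis
  proof (rule has_sum_SigmaD[OF *])
    fix k assume k: "k \<in> idx n"
    let ?t = "\<lambda>r. theta_coeff s r * g (k(a := k a - int r, b := k b + int r)) * zpow n k z"
    have "zpow n k z \<noteq> 0" using z by (auto simp: zpow_def torus_def)
    have "?t summable_on UNIV"
      using * k by (intro summable_on_SigmaD1[of "\<lambda>k r. theta_coeff s r * g (k(a := k a - int r, b := k b + int r)) * zpow n k z" "idx n" "\<lambda>_. UNIV"])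
        (auto simp: summable_on_def)
    then have hs: "(?t has_sum infsum ?t UNIV) UNIV" by (rule has_sum_infsum)
    then have "?t sums infsum ?t UNIV" by (rule has_sum_imp_sums)
    then have "infsum ?t UNIV = (\<Sum>r. ?t r)" by (rule sums_unique)
    also have "\<dots> = (\<Sum>r. theta_coeff s r * g (k(a := k a - int r, b := k b + int r))) * zpow n k z"
    proof (rule suminf_mult2[symmetric])
      have "summable ?t" using \<open>?t sums _\<close> by (rule sums_summable)
      then show "summable (\<lambda>r. theta_coeff s r * g (k(a := k a - int r, b := k b + int r)))"
        using \<open>zpow n k z \<noteq> 0\<close> summable_mult2[of ?t "1 / zpow n k z"] by simp
    qed
    finally show "((\<lambda>y. case (k, y) of (k, r) \<Rightarrow> theta_coeff s r * g (k(a := k a - int r, b := k b + int r)) * zpow n k z) has_sum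
      (\<Sum>r. theta_coeff s r * g (k(a := k a - int r, b := k b + int r))) * zpow n k z) UNIV"
      using hs by simp
  qed
qed

text \<open>The bounds for neighbours chain to all pairs because
  \<open>\<rho> \<ge> 1\<close>.\<close>

lemma region_less:
  assumes "z \<in> region n \<rho>" "\<rho> \<ge> 1" "i \<in> {1..n}" "j \<in> {1..n}" "i < j"
  shows "\<rho> * norm (z j) < norm (z i)"
proof -
  have "\<rho> * norm (z j) < norm (z i)" if "1 \<le> i" "Suc i \<le> j" "j \<le> n" for i j
    using that(2,1,3)
  proof (induction j rule: dec_induct)
    case base
    then show ?case using assms by (auto simp: region_def)
  next
    case (step j)
    have "norm (z j) > \<rho> * norm (z (Suc j))" using step assms by (auto simp: region_def)
    moreover have "norm (z j) \<le> \<rho> * norm (z j)" using \<open>\<rho> \<ge> 1\<close> by (simp add: mult_le_cancel_right1)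
    ultimately show ?case using step.IH step.prems by auto
  qed
  with assms show ?thesis by auto
qed

lemma theta_series_has_sum:
  assumes "\<forall>(a, b)\<in>set ps. a \<in> {1..n} \<and> b \<in> {1..n} \<and> a < b"
    and \<rho>: "\<rho> \<ge> 1" "\<rho> \<ge> norm s" and z: "z \<in> region n \<rho>" and \<kappa>: "\<kappa> \<in> idx n"
  shows "((\<lambda>k. theta_series s ps \<kappa> k * zpow n k z) has_sum
          prod_list (map (\<lambda>(a, b). theta s (z a) (z b)) ps) * zpow n \<kappa> z) (idx n)"
  using assms(1)
proof (induction ps)
  case Nil
  have "((\<lambda>k. theta_series s [] \<kappa> k * zpow n k z) has_sum (\<Sum>k\<in>{\<kappa>}. theta_series s [] \<kappa> k * zpow n k z)) (idx n)"
    by (rule has_sum_finite_neutralI[of "{\<kappa>}"]) (use \<kappa> in auto)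
  then show ?case by simp
next
  case (Cons p ps)
  obtain a b where p: "p = (a, b)" by (cases p)
  have ab: "a \<in> {1..n}" "b \<in> {1..n}" "a < b" using Cons.prems p by auto
  have zt: "z \<in> torus n" using z by (simp add: region_def)
  have "norm (s * z b) \<le> \<rho> * norm (z b)" using \<rho> by (simp add: norm_mult mult_right_mono)
  also have "\<dots> < norm (z a)" by (rule region_less[OF z \<rho>(1) ab])
  finally have lt: "norm (s * z b) < norm (z a)" .
  have "((\<lambda>k. theta_series s ps \<kappa> k * zpow n k z) has_sum
          prod_list (map (\<lambda>(a, b). theta s (z a) (z b)) ps) * zpow n \<kappa> z) (idx n)"
    using Cons by auto
  from theta_step_has_sum[OF zt ab(1,2) _ lt this] ab(3)
  show ?case by (simp add: p mult.assoc)
qed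

section \<open>Constant terms as iterated integrals over circles\<close>

lemma has_contour_integral_powi:
  assumes "valid_path g" "pathfinish g = pathstart g" "0 \<notin> path_image g" "m \<noteq> -1"
  shows "((\<lambda>w. w powi m) has_contour_integral 0) g"
proof -
  have "((\<lambda>w. w powi m) has_contour_integral
      (pathfinish g powi (m + 1) / of_int (m + 1) - pathstart g powi (m + 1) / of_int (m + 1))) g"
  proof (rule contour_integral_primitive[of "- {0}"])
    fix x :: complex assume "x \<in> - {0}"
    then have "((\<lambda>w. w powi (m + 1)) has_field_derivative of_int (m + 1) * x powi m) (at x within - {0})"
      using DERIV_power_int[of "\<lambda>w. w" 1 x "- {0}" "m + 1"] by simp
    then have "((\<lambda>w. w powi (m + 1) / of_int (m + 1)) has_field_derivative of_int (m + 1) * x powi m / of_int (m + 1)) (at x within - {0})"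
      by (rule DERIV_cdivide)
    moreover have "(of_int (m + 1) :: complex) \<noteq> 0" unfolding of_int_eq_0_iff using assms(4) by linarith
    ultimately show "((\<lambda>w. w powi (m + 1) / of_int (m + 1)) has_field_derivative x powi m) (at x within - {0})"
      by simp
  qed (use assms in auto)
  with assms(2) show ?thesis by simp
qed

text \<open>The radii may come in any order while \<open>z 1\<close> stays the innermost variable;
  this is what lets each permuted summand use circles of its own.\<close>

lemma iterated_integral_circles:
  fixes r :: "nat \<Rightarrow> real"
  assumes r: "\<And>i. i \<in> {1..n} \<Longrightarrow> r i > 0"
    and sum: "\<And>z. (\<And>i. i \<in> {1..n} \<Longrightarrow> norm (z i) = r i) \<Longrightarrow> ((\<lambda>k. a k * zpow n k z) has_sum f z) (idx n)"
  shows "iterated_integral (\<lambda>k z. circlepath 0 (r k)) f n z0 = (2 * of_real pi * \<i>) ^ n * a (\<lambda>_. 0)"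
proof -
  \<comment> \<open>The exponents that survive the first \<open>m\<close> integrations.\<close>
  define X where "X m = {k\<in>idx n. \<forall>i\<in>{1..m}. k i = 0}" for m
  let ?C = "\<lambda>k (z :: nat \<Rightarrow> complex). circlepath 0 (r k)"
  have exz: "\<exists>z. \<forall>i\<in>{1..n}. norm (z i :: complex) = r i"
    by (rule exI[of _ "\<lambda>i. of_real (r i)"]) (use r in \<open>auto simp: less_imp_le\<close>)
  have summ0: "(\<lambda>k. norm (a k * zpow n k z)) summable_on X m"
    if "\<And>i. i \<in> {1..n} \<Longrightarrow> norm (z i) = r i" for z m
  proof -
    have "(\<lambda>k. a k * zpow n k z) summable_on idx n" using sum[OF that] by (auto simp: summable_on_def)
    then have "(\<lambda>k. a k * zpow n k z) summable_on X m"
      by (rule summable_on_subset_banach) (auto simp: X_def)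
    then show ?thesis by (simp add: summable_on_iff_abs_summable_on_complex)
  qed
  have norm_zpow: "norm (zpow n k z) = (\<Prod>i\<in>{m<..n}. r i powi (- k i))"
    if "k \<in> X m" "\<And>i. i \<in> {m<..n} \<Longrightarrow> norm (z i) = r i" "m \<le> n" for k z m
  proof -
    have "norm (zpow n k z) = (\<Prod>i\<in>{1..n}. norm (z i) powi (- k i))"
      by (simp add: zpow_def prod_norm[symmetric] norm_power_int)
    also have "\<dots> = (\<Prod>i\<in>{m<..n}. norm (z i) powi (- k i))"
      by (rule prod.mono_neutral_right) (use that in \<open>auto simp: X_def\<close>)
    also have "\<dots> = (\<Prod>i\<in>{m<..n}. r i powi (- k i))" by (rule prod.cong) (use that in auto)
    finally show ?thesis .
  qed
  have summ: "(\<lambda>k. norm (a k) * (\<Prod>i\<in>{m<..n}. r i powi (- k i))) summable_on X m" if "m \<le> n" for m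
  proof -
    obtain z where "\<forall>i\<in>{1..n}. norm (z i :: complex) = r i" using exz by blast
    then have z: "\<And>i. i \<in> {1..n} \<Longrightarrow> norm (z i) = r i" by blast
    have "(\<lambda>k. norm (a k * zpow n k z)) summable_on X m" by (rule summ0) (use z in auto)
    moreover have "norm (a k * zpow n k z) = norm (a k) * (\<Prod>i\<in>{m<..n}. r i powi (- k i))" if "k \<in> X m" for k
    proof -
      have "norm (zpow n k z) = (\<Prod>i\<in>{m<..n}. r i powi (- k i))"
        by (rule norm_zpow) (use z that \<open>m \<le> n\<close> in auto)
      then show ?thesis by (simp only: norm_mult)
    qed
    ultimately show ?thesis by (simp cong: summable_on_cong)
  qed
  have main: "iterated_integral ?C f m z = (2 * of_real pi * \<i>) ^ m * (\<Sum>\<^sub>\<infinity>k\<in>X m. a k * zpow n k z)"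
    if "m \<le> n" "\<And>i. i \<in> {m<..n} \<Longrightarrow> norm (z i) = r i" for m z
    using that
  proof (induction m arbitrary: z)
    case 0
    then have "\<And>i. i \<in> {1..n} \<Longrightarrow> norm (z i) = r i" by auto
    from sum[OF this] show ?case by (simp add: X_def infsumI)
  next
    case (Suc m)
    let ?c = "(2 * of_real pi * \<i>) :: complex"
    let ?z = "\<lambda>w. z(Suc m := w)"
    have rpos: "r (Suc m) > 0" using r Suc.prems by auto
    define t where "t = (\<lambda>k w. ?c ^ m * (a k * zpow n k (?z w)) / w)"
    have nrm: "norm (?z w i) = r i" if "w \<in> sphere 0 (r (Suc m))" "i \<in> {m<..n}" for w i
      using that Suc.prems by (auto simp: dist_norm)
    \<comment> \<open>On the circles the norm of a term depends on the radii only, so one summable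
      majorant gives uniform convergence and allows integration term by term.\<close>
    have ul: "uniform_limit (sphere 0 (r (Suc m))) (\<lambda>Y w. \<Sum>k\<in>Y. t k w)
        (\<lambda>w. iterated_integral ?C f m (?z w) / w) (finite_subsets_at_top (X m))"
    proof (rule Weierstrass_m_test_general')
      let ?M = "\<lambda>k. norm (?c ^ m) / r (Suc m) * (norm (a k) * (\<Prod>i\<in>{m<..n}. r i powi (- k i)))"
      show "norm (t k w) \<le> ?M k" if "k \<in> X m" "w \<in> sphere 0 (r (Suc m))" for k w
      proof -
        have "norm (zpow n k (?z w)) = (\<Prod>i\<in>{m<..n}. r i powi (- k i))"
          by (rule norm_zpow[OF that(1) nrm[OF that(2)]]) (use Suc.prems in auto)
        moreover have "norm w = r (Suc m)" using that(2) by simp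
        ultimately show ?thesis unfolding t_def norm_mult norm_divide by simp
      qed
      show "?M summable_on X m" using summ Suc.prems by (intro summable_on_cmult_right) auto
      show "((\<lambda>k. t k w) has_sum iterated_integral ?C f m (?z w) / w) (X m)" if w: "w \<in> sphere 0 (r (Suc m))" for w
      proof -
        have "(\<lambda>k. norm (a k * zpow n k (?z w))) summable_on X m"
        proof -
          have "norm (a k * zpow n k (?z w)) = norm (a k) * (\<Prod>i\<in>{m<..n}. r i powi (- k i))" if "k \<in> X m" for k
          proof -
            have "norm (zpow n k (?z w)) = (\<Prod>i\<in>{m<..n}. r i powi (- k i))"
              by (rule norm_zpow[OF that nrm[OF w]]) (use Suc.prems in auto)
            then show ?thesis by (simp only: norm_mult)
          qed
          then show ?thesis using summ[of m] Suc.prems by (simp cong: summable_on_cong)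
        qed
        then have "(\<lambda>k. a k * zpow n k (?z w)) summable_on X m" by (rule abs_summable_summable)
        then have "((\<lambda>k. a k * zpow n k (?z w)) has_sum (\<Sum>\<^sub>\<infinity>k\<in>X m. a k * zpow n k (?z w))) (X m)"
          by (rule has_sum_infsum)
        note has_sum_divide_const[OF has_sum_cmult_right[OF this, of "?c ^ m"], of w]
        moreover have "iterated_integral ?C f m (?z w) = ?c ^ m * (\<Sum>\<^sub>\<infinity>k\<in>X m. a k * zpow n k (?z w))"
          by (rule Suc.IH[OF _ nrm[OF w]]) (use Suc.prems in auto)
        ultimately show ?thesis unfolding t_def by simp
      qed
    qed
    \<comment> \<open>After the division by \<open>w\<close>, the exponent
      \<open>k (Suc m) = 0\<close> gives the power -1, the only one without a primitive.\<close>
    have tint: "(t k has_contour_integral (if k (Suc m) = 0 then ?c ^ Suc m * (a k * zpow n k z) else 0)) (circlepath 0 (r (Suc m)))"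
      if k: "k \<in> X m" for k
    proof -
      define b where "b = (\<Prod>i\<in>{1..n} - {Suc m}. z i powi (- k i))"
      have z1: "zpow n k (?z w) = w powi (- k (Suc m)) * b" for w
      proof -
        have "Suc m \<in> {1..n}" using Suc.prems by auto
        then have "zpow n k (?z w) = (?z w) (Suc m) powi (- k (Suc m)) * (\<Prod>i\<in>{1..n} - {Suc m}. (?z w) i powi (- k i))"
          unfolding zpow_def by (intro prod.remove) auto
        also have "(?z w) (Suc m) = w" by simp
        also have "(\<Prod>i\<in>{1..n} - {Suc m}. (?z w) i powi (- k i)) = b"
          unfolding b_def by (rule prod.cong) auto
        finally show ?thesis .
      qed
      show ?thesis
      proof (cases "k (Suc m) = 0")
        case True
        have "b = zpow n k z" using z1[of "z (Suc m)"] True by simp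
        have "((\<lambda>w. 1 / (w - 0)) has_contour_integral ?c) (circlepath 0 (r (Suc m)))"
          using has_contour_integral_winding_number[of "circlepath 0 (r (Suc m))" 0] winding_number_circlepath_centre[OF rpos, of 0] rpos
          by simp
        from has_contour_integral_lmul[OF this, of "?c ^ m * (a k * b)"]
        show ?thesis using True \<open>b = zpow n k z\<close> by (simp add: t_def z1 mult_ac)
      next
        case False
        have "((\<lambda>w. w powi (- k (Suc m) - 1)) has_contour_integral 0) (circlepath 0 (r (Suc m)))"
          by (rule has_contour_integral_powi) (use rpos False in auto)
        from has_contour_integral_lmul[OF this, of "?c ^ m * (a k * b)"]
        have "((\<lambda>w. ?c ^ m * (a k * b) * w powi (- k (Suc m) - 1)) has_contour_integral 0) (circlepath 0 (r (Suc m)))"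
          by simp
        then have "(t k has_contour_integral 0) (circlepath 0 (r (Suc m)))"
        proof (rule has_contour_integral_eq)
          fix w assume "w \<in> path_image (circlepath 0 (r (Suc m)))"
          then have "w \<noteq> 0" using rpos by auto
          then show "?c ^ m * (a k * b) * w powi (- k (Suc m) - 1) = t k w"
            by (simp add: t_def z1 power_int_diff)
        qed
        then show ?thesis using False by simp
      qed
    qed
    have "((\<lambda>Y. contour_integral (circlepath 0 (r (Suc m))) (\<lambda>w. \<Sum>k\<in>Y. t k w)) \<longlongrightarrow>
        contour_integral (circlepath 0 (r (Suc m))) (\<lambda>w. iterated_integral ?C f m (?z w) / w)) (finite_subsets_at_top (X m))"
    proof (rule contour_integral_uniform_limit_circlepath(2)[OF _ ul _ rpos])
      show "\<forall>\<^sub>F Y in finite_subsets_at_top (X m). (\<lambda>w. \<Sum>k\<in>Y. t k w) contour_integrable_on circlepath 0 (r (Suc m))"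
        by (rule eventually_finite_subsets_at_top_weakI, rule contour_integrable_sum)
           (use tint in \<open>auto intro: has_contour_integral_integrable\<close>)
    qed auto
    moreover have "\<forall>\<^sub>F Y in finite_subsets_at_top (X m). contour_integral (circlepath 0 (r (Suc m))) (\<lambda>w. \<Sum>k\<in>Y. t k w) =
        (\<Sum>k\<in>Y. if k (Suc m) = 0 then ?c ^ Suc m * (a k * zpow n k z) else 0)"
      by (rule eventually_finite_subsets_at_top_weakI)
         (rule contour_integral_unique, rule has_contour_integral_sum, assumption, rule tint, blast)
    ultimately have *: "((\<lambda>Y. \<Sum>k\<in>Y. if k (Suc m) = 0 then ?c ^ Suc m * (a k * zpow n k z) else 0) \<longlongrightarrow>
        iterated_integral ?C f (Suc m) z) (finite_subsets_at_top (X m))"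
      unfolding iterated_integral.simps by (rule Lim_transform_eventually)
    from * have "((\<lambda>k. if k (Suc m) = 0 then ?c ^ Suc m * (a k * zpow n k z) else 0) has_sum iterated_integral ?C f (Suc m) z) (X m)"
      unfolding has_sum_def .
    also have "?this \<longleftrightarrow> ((\<lambda>k. ?c ^ Suc m * (a k * zpow n k z)) has_sum iterated_integral ?C f (Suc m) z) (X (Suc m))"
      by (rule has_sum_cong_neutral) (auto simp: X_def atLeastAtMostSuc_conv)
    finally have "iterated_integral ?C f (Suc m) z = (\<Sum>\<^sub>\<infinity>k\<in>X (Suc m). ?c ^ Suc m * (a k * zpow n k z))"
      by (simp only: infsumI)
    then show ?case by (simp only: infsum_cmult_right')
  qed
  have "X n = {\<lambda>_. 0}"
  proof (rule equalityI; rule subsetI)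
    fix k assume "k \<in> X n"
    then have "k i = 0" for i by (cases "i \<in> {1..n}") (auto simp: X_def idx_def)
    then show "k \<in> {\<lambda>_. 0}" by auto
  qed (auto simp: X_def idx_def)
  then show ?thesis using main[of n z0] by (simp add: zpow_def)
qed

section \<open>Symmetrized series\<close>

lemma iterated_integral_zero: "iterated_integral C (\<lambda>z. 0) m z = 0"
  by (induction m arbitrary: z) auto

lemma zpow_nonzero: "z \<in> torus n \<Longrightarrow> zpow n k z \<noteq> 0"
  by (auto simp: zpow_def torus_def)

lemma zpow_permute:
  assumes "w permutes {1..n}"
  shows "zpow n k (z \<circ> w) = zpow n (k \<circ> inv w) z"
  unfolding zpow_def
  by (rule prod.reindex_bij_witness[of _ "inv w" w])
     (use assms in \<open>auto simp: permutes_inverses permutes_in_image permutes_inv simp del: atLeastAtMost_iff\<close>)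

lemma idx_permute: "k \<in> idx n \<Longrightarrow> w permutes {1..n} \<Longrightarrow> k \<circ> w \<in> idx n"
  by (auto simp: idx_def permutes_def)

text \<open>After a shift by \<open>k0\<close> the difference of the two coefficients is the
  constant term of a series with sum 0, hence an iterated integral of 0 over circles inside the
  region.\<close>

lemma Laurent_coeff_unique:
  assumes f: "\<And>z. z \<in> region n \<rho> \<Longrightarrow> ((\<lambda>k. a k * zpow n k z) has_sum f z) (idx n)"
    and g: "\<And>z. z \<in> region n \<rho> \<Longrightarrow> ((\<lambda>k. b k * zpow n k z) has_sum f z) (idx n)"
    and k0: "k0 \<in> idx n"
  shows "a k0 = b k0"
proof -
  \<comment> \<open>Any positive \<open>R > \<rho>\<close> puts the circles of radii
    \<open>R ^ (n - i)\<close> into the region.\<close>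
  define R where "R = \<bar>\<rho>\<bar> + 1"
  have R: "R > 0" "R > \<rho>" by (auto simp: R_def)
  let ?d = "\<lambda>k. a (\<lambda>i. k i + k0 i) - b (\<lambda>i. k i + k0 i)"
  have "iterated_integral (\<lambda>k z. circlepath 0 (R ^ (n - k))) (\<lambda>z. 0) n (\<lambda>_. 0) = (2 * of_real pi * \<i>) ^ n * ?d (\<lambda>_. 0)"
  proof (rule iterated_integral_circles)
    fix z :: "nat \<Rightarrow> complex" assume z: "\<And>i. i \<in> {1..n} \<Longrightarrow> norm (z i) = R ^ (n - i)"
    have zt: "z \<in> torus n" using z R by (auto simp: torus_def) (metis atLeastAtMost_iff norm_eq_zero less_irrefl zero_less_power One_nat_def)
    have zr: "z \<in> region n \<rho>"
      unfolding region_def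
    proof (safe intro!: zt)
      fix i assume i: "i \<in> {1..<n}"
      have "norm (z i) = R * norm (z (Suc i))"
        using z[of i] z[of "Suc i"] i by (simp add: Suc_diff_le[symmetric] Suc_diff_Suc flip: power_Suc)
      moreover have "norm (z (Suc i)) > 0" using zt i by (auto simp: torus_def)
      ultimately show "\<rho> * norm (z (Suc i)) < norm (z i)" using R by simp
    qed
    have "((\<lambda>k. a k * zpow n k z - b k * zpow n k z) has_sum (f z - f z)) (idx n)"
      using has_sum_add[OF f[OF zr] has_sum_uminusI[OF g[OF zr]]] by simp
    then have "((\<lambda>k. (a k * zpow n k z - b k * zpow n k z) / zpow n k0 z) has_sum (f z - f z) / zpow n k0 z) (idx n)"
      by (rule has_sum_divide_const)
    also have "?this \<longleftrightarrow> ((\<lambda>k. ?d k * zpow n k z) has_sum 0) (idx n)"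
    proof (rule has_sum_reindex_bij_witness[of _ "\<lambda>k i. k i + k0 i" "\<lambda>k i. k i - k0 i"], goal_cases)
      case (5 k)
      have "zpow n k z = zpow n (\<lambda>i. (k i - k0 i) + k0 i) z" by simp
      also have "\<dots> = zpow n (\<lambda>i. k i - k0 i) z * zpow n k0 z" by (rule zpow_add[OF zt])
      finally show ?case using zpow_nonzero[OF zt, of k0] by (simp add: field_simps)
    qed (use k0 in \<open>auto simp: idx_def\<close>)
    finally show "((\<lambda>k. ?d k * zpow n k z) has_sum 0) (idx n)" .
  qed (use R in auto)
  then show ?thesis by (simp add: iterated_integral_zero)
qed

definition inversions :: "nat \<Rightarrow> (nat \<Rightarrow> nat) \<Rightarrow> (nat \<times> nat) set" where
  "inversions n p = {(a, b). a \<in> {1..n} \<and> b \<in> {1..n} \<and> a < b \<and> p b < p a}"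

text \<open>A list, because \<open>theta_series\<close> recurses over its pairs; the order chosen is
  immaterial by \<open>theta_series_set_cong\<close>.\<close>

definition inv_list :: "nat \<Rightarrow> (nat \<Rightarrow> nat) \<Rightarrow> (nat \<times> nat) list" where
  "inv_list n p = filter (\<lambda>(a, b). a < b \<and> p b < p a) (List.product [1..<Suc n] [1..<Suc n])"

lemma inv_list: "distinct (inv_list n p)" "set (inv_list n p) = inversions n p"
  by (auto simp: inv_list_def inversions_def distinct_product intro!: distinct_filter)

lemma finite_inversions [simp]: "finite (inversions n p)"
  by (metis inv_list(2) finite_set)

lemma length_inv_list: "length (inv_list n p) = card (inversions n p)"
  using distinct_card[OF inv_list(1)] inv_list(2) by metis

text \<open>These are the coefficients of the Hall-Littlewood symmetrization of
  \<open>zpow n \<kappa>\<close>, multiplied by the product of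
  \<open>(z_i - z_j) / (z_i - s z_j)\<close> over \<open>i < j\<close>. The inverse enters because
  the variable \<open>z a\<close> stands at place \<open>inv w a\<close> of
  \<open>z \<circ> w\<close>.\<close>

definition sym_coeff :: "complex \<Rightarrow> nat \<Rightarrow> (nat \<Rightarrow> int) \<Rightarrow> (nat \<Rightarrow> int) \<Rightarrow> complex" where
  "sym_coeff s n \<kappa> l = (\<Sum>w | w permutes {1..n}. theta_series s (inv_list n (inv w)) (\<kappa> \<circ> inv w) l)"

definition sym_fun :: "complex \<Rightarrow> nat \<Rightarrow> (nat \<Rightarrow> int) \<Rightarrow> (nat \<Rightarrow> complex) \<Rightarrow> complex" where
  "sym_fun s n \<kappa> z = (\<Sum>w | w permutes {1..n}.
     (\<Prod>(a, b)\<in>inversions n (inv w). theta s (z a) (z b)) * zpow n \<kappa> (z \<circ> w))"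

lemma has_sum_sum:
  fixes f :: "'a \<Rightarrow> 'b \<Rightarrow> complex"
  assumes "\<And>x. x \<in> S \<Longrightarrow> (f x has_sum c x) A"
  shows "((\<lambda>k. \<Sum>x\<in>S. f x k) has_sum (\<Sum>x\<in>S. c x)) A"
  using assms by (induction S rule: infinite_finite_induct) (auto intro!: has_sum_add)

lemma prod_list_inversions:
  assumes "distinct ps" "set ps = S"
  shows "prod_list (map f ps) = prod f S"
  using prod.distinct_set_conv_list[OF assms(1), of f] assms(2) by simp

lemma sym_coeff_has_sum:
  assumes "\<rho> \<ge> 1" "\<rho> \<ge> norm s" "z \<in> region n \<rho>" "\<kappa> \<in> idx n"
  shows "((\<lambda>k. sym_coeff s n \<kappa> k * zpow n k z) has_sum sym_fun s n \<kappa> z) (idx n)"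
  unfolding sym_coeff_def sum_distrib_right sym_fun_def
proof (rule has_sum_sum)
  fix w assume "w \<in> {w. w permutes {1..n}}"
  then have w: "w permutes {1..n}" by simp
  have "((\<lambda>k. theta_series s (inv_list n (inv w)) (\<kappa> \<circ> inv w) k * zpow n k z) has_sum
     prod_list (map (\<lambda>(a, b). theta s (z a) (z b)) (inv_list n (inv w))) * zpow n (\<kappa> \<circ> inv w) z) (idx n)"
    by (rule theta_series_has_sum[OF _ assms(1-3)])
       (use assms(4) w in \<open>auto simp: inv_list(2) inversions_def intro!: idx_permute permutes_inv\<close>)
  then show "((\<lambda>k. theta_series s (inv_list n (inv w)) (\<kappa> \<circ> inv w) k * zpow n k z) has_sum
     (\<Prod>(a, b)\<in>inversions n (inv w). theta s (z a) (z b)) * zpow n \<kappa> (z \<circ> w)) (idx n)"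
    by (simp add: zpow_permute[OF w] prod_list_inversions[OF inv_list])
qed

text \<open>Both lists describe the same product of theta factors, so uniqueness of Laurent
  coefficients takes the place of a rearrangement of nested series.\<close>

lemma theta_series_set_cong:
  assumes ps: "\<forall>(a, b)\<in>set ps. a \<in> {1..n} \<and> b \<in> {1..n} \<and> a < b"
    and "distinct ps" "distinct qs" "set ps = set qs" "\<kappa> \<in> idx n" "l \<in> idx n"
  shows "theta_series s ps \<kappa> l = theta_series s qs \<kappa> l"
proof (rule Laurent_coeff_unique[OF _ _ \<open>l \<in> idx n\<close>])
  fix z assume z: "z \<in> region n (max 1 (norm s))"
  show "((\<lambda>k. theta_series s ps \<kappa> k * zpow n k z) has_sum
     prod_list (map (\<lambda>(a, b). theta s (z a) (z b)) ps) * zpow n \<kappa> z) (idx n)"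
    by (rule theta_series_has_sum[OF ps _ _ z]) (use assms in auto)
  have "prod_list (map (\<lambda>(a, b). theta s (z a) (z b)) ps) = prod_list (map (\<lambda>(a, b). theta s (z a) (z b)) qs)"
    by (simp add: prod_list_inversions[OF assms(2) refl] prod_list_inversions[OF assms(3) refl] assms(4))
  moreover have "((\<lambda>k. theta_series s qs \<kappa> k * zpow n k z) has_sum
     prod_list (map (\<lambda>(a, b). theta s (z a) (z b)) qs) * zpow n \<kappa> z) (idx n)"
    by (rule theta_series_has_sum[OF _ _ _ z]) (use assms in auto)
  ultimately show "((\<lambda>k. theta_series s qs \<kappa> k * zpow n k z) has_sum
     prod_list (map (\<lambda>(a, b). theta s (z a) (z b)) ps) * zpow n \<kappa> z) (idx n)" by simp
qed

text \<open>Pair \<open>w\<close> with \<open>\<tau> \<circ> w\<close>, where \<open>\<tau>\<close>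
  exchanges \<open>i\<close> and \<open>i + 1\<close>. The theta product of the second is the factor
  of \<open>(i, i + 1)\<close> times the transported product of the first. Clearing that one
  denominator relates the two summands, and together they satisfy the exchange relation.\<close>

lemma sym_coeff_exchange:
  assumes \<kappa>: "\<kappa> \<in> idx n"
  shows "exchange_rel s n (sym_coeff s n \<kappa>)"
  unfolding exchange_rel_def
proof (intro ballI)
  fix l i assume l: "l \<in> idx n" and i: "i \<in> {1..<n}"
  define \<tau> where "\<tau> = Transposition.transpose i (Suc i)"
  have \<tau>: "\<tau> permutes {1..n}" unfolding \<tau>_def by (rule permutes_swap_id) (use i in auto)
  have \<tau>_inv: "inv \<tau> = \<tau>" by (simp add: \<tau>_def)
  have \<tau>\<tau>: "\<tau> (\<tau> a) = a" for a by (simp add: \<tau>_def)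
  have \<tau>_o: "\<tau> \<circ> (\<tau> \<circ> w) = w" for w by (auto simp: fun_eq_iff \<tau>\<tau>)
  define X where "X w = theta_series s (inv_list n (inv w)) (\<kappa> \<circ> inv w)" for w
  \<comment> \<open>The permutations without the factor of \<open>(i, Suc i)\<close>; composition
    with \<open>\<tau>\<close> reaches all others.\<close>
  define A where "A = {w. w permutes {1..n} \<and> inv w i < inv w (Suc i)}"
  \<comment> \<open>An adjacent transposition reverses the order of no other pair, so it only
    relabels the remaining inversions.\<close>
  have \<tau>_less: "\<tau> a < \<tau> b" if "a < b" "(a, b) \<noteq> (i, Suc i)" for a b
    using that by (auto simp: \<tau>_def Transposition.transpose_def)
  have sum_A: "sym_coeff s n \<kappa> k = (\<Sum>w\<in>A. X w k + X (\<tau> \<circ> w) k)" for k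
  proof -
    have tinv: "inv (\<tau> \<circ> w) = inv w \<circ> \<tau>" if "w permutes {1..n}" for w
      using o_inv_distrib[OF permutes_bij[OF \<tau>] permutes_bij[OF that]] by (simp only: \<tau>_inv)
    have split: "{w. w permutes {1..n}} = A \<union> (\<lambda>w. \<tau> \<circ> w) ` A"
    proof (intro equalityI subsetI)
      fix w assume "w \<in> {w. w permutes {1..n}}"
      then have w: "w permutes {1..n}" by simp
      show "w \<in> A \<union> (\<lambda>w. \<tau> \<circ> w) ` A"
      proof (cases "inv w i < inv w (Suc i)")
        case False
        note tinv[OF w]
        moreover have "inv w i \<noteq> inv w (Suc i)" using permutes_inj[OF permutes_inv[OF w]] by (simp add: inj_eq)
        moreover have "\<tau> \<circ> w permutes {1..n}" by (rule permutes_compose[OF w \<tau>])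
        ultimately have "\<tau> \<circ> w \<in> A" using False by (auto simp: A_def \<tau>_def)
        moreover have "w = \<tau> \<circ> (\<tau> \<circ> w)" by (simp only: \<tau>_o)
        ultimately show ?thesis by blast
      qed (use w in \<open>simp add: A_def\<close>)
    qed (use \<tau> in \<open>auto simp: A_def intro: permutes_compose\<close>)
    have disj: "A \<inter> (\<lambda>w. \<tau> \<circ> w) ` A = {}"
    proof -
      have False if "w \<in> A" "\<tau> \<circ> w \<in> A" for w
      proof -
        have "inv (\<tau> \<circ> w) = inv w \<circ> \<tau>" by (rule tinv) (use that in \<open>simp add: A_def\<close>)
        with that show False by (auto simp: A_def \<tau>_def)
      qed
      then show ?thesis by auto
    qed
    have finA: "finite A" by (rule finite_subset[OF _ finite_permutations[of "{1..n}"]]) (auto simp: A_def)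
    have inj: "inj_on (\<lambda>w. \<tau> \<circ> w) A"
    proof (rule inj_onI)
      fix w w' assume "\<tau> \<circ> w = \<tau> \<circ> w'"
      then have "\<tau> \<circ> (\<tau> \<circ> w) = \<tau> \<circ> (\<tau> \<circ> w')" by (rule arg_cong)
      then show "w = w'" by (simp only: \<tau>_o)
    qed
    show ?thesis
      unfolding sym_coeff_def split X_def[symmetric]
      by (simp add: sum.union_disjoint[OF finA _ disj] finA sum.reindex[OF inj] sum.distrib)
  qed
  have Xt: "X (\<tau> \<circ> w) k = theta_series s ((i, Suc i) # map (map_prod \<tau> \<tau>) (inv_list n (inv w))) (\<kappa> \<circ> inv w \<circ> inv \<tau>) k"
    and valid: "\<forall>(a, b)\<in>set (map (map_prod \<tau> \<tau>) (inv_list n (inv w))). a \<in> {1..n} \<and> b \<in> {1..n} \<and> a < b"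
    if w: "w \<in> A" and k: "k \<in> idx n" for w k
  proof -
    have wp: "w permutes {1..n}" "inv w i < inv w (Suc i)" using w by (auto simp: A_def)
    have inv: "inv (\<tau> \<circ> w) = inv w \<circ> \<tau>"
      using o_inv_distrib[OF permutes_bij[OF \<tau>] permutes_bij[OF wp(1)]] by (simp only: \<tau>_inv)
    have img: "\<tau> a \<in> {1..n} \<longleftrightarrow> a \<in> {1..n}" for a by (rule permutes_in_image[OF \<tau>])
    have set_eq: "inversions n (inv (\<tau> \<circ> w)) = insert (i, Suc i) (map_prod \<tau> \<tau> ` inversions n (inv w))"
    proof (intro equalityI subsetI)
      fix p assume p: "p \<in> inversions n (inv (\<tau> \<circ> w))"
      obtain a b where ab: "p = (a, b)" by (cases p)
      show "p \<in> insert (i, Suc i) (map_prod \<tau> \<tau> ` inversions n (inv w))"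
      proof (cases "p = (i, Suc i)")
        case False
        then have "(\<tau> a, \<tau> b) \<in> inversions n (inv w)"
          using p ab \<tau>_less[of a b] img by (auto simp: inversions_def inv simp del: atLeastAtMost_iff)
        then have "map_prod \<tau> \<tau> (\<tau> a, \<tau> b) \<in> map_prod \<tau> \<tau> ` inversions n (inv w)" by (rule imageI)
        then show ?thesis by (simp add: ab \<tau>\<tau>)
      qed auto
    next
      fix p assume "p \<in> insert (i, Suc i) (map_prod \<tau> \<tau> ` inversions n (inv w))"
      then consider "p = (i, Suc i)" | a b where "(a, b) \<in> inversions n (inv w)" "p = (\<tau> a, \<tau> b)" by auto
      then show "p \<in> inversions n (inv (\<tau> \<circ> w))"
      proof cases
        case 1
        have "inv (\<tau> \<circ> w) i = inv w (Suc i)" "inv (\<tau> \<circ> w) (Suc i) = inv w i"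
          unfolding inv by (simp_all add: \<tau>_def)
        then show ?thesis using 1 i wp by (simp add: inversions_def)
      next
        case 2
        then have "(a, b) \<noteq> (i, Suc i)" using wp by (auto simp: inversions_def)
        with 2 show ?thesis using \<tau>_less[of a b] img by (auto simp: inversions_def inv \<tau>\<tau> simp del: atLeastAtMost_iff)
      qed
    qed
    have notin: "(i, Suc i) \<notin> map_prod \<tau> \<tau> ` inversions n (inv w)"
    proof
      assume "(i, Suc i) \<in> map_prod \<tau> \<tau> ` inversions n (inv w)"
      then obtain a b where "(a, b) \<in> inversions n (inv w)" "i = \<tau> a" "Suc i = \<tau> b" by auto
      then have "(\<tau> i, \<tau> (Suc i)) \<in> inversions n (inv w)" by (simp add: \<tau>\<tau>)
      then show False by (simp add: \<tau>_def inversions_def)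
    qed
    have inj: "inj (map_prod \<tau> \<tau>)" using permutes_inj[OF \<tau>] by (simp add: prod.inj_map)
    show valid: "\<forall>(a, b)\<in>set (map (map_prod \<tau> \<tau>) (inv_list n (inv w))). a \<in> {1..n} \<and> b \<in> {1..n} \<and> a < b"
    proof -
      have "map_prod \<tau> \<tau> ` inversions n (inv w) \<subseteq> inversions n (inv (\<tau> \<circ> w))" using set_eq by auto
      then show ?thesis unfolding set_map inv_list(2) by (auto simp: inversions_def)
    qed
    have "\<kappa> \<circ> inv (\<tau> \<circ> w) = \<kappa> \<circ> inv w \<circ> inv \<tau>" by (simp add: inv \<tau>_inv comp_assoc)
    moreover have "theta_series s (inv_list n (inv (\<tau> \<circ> w))) (\<kappa> \<circ> inv w \<circ> inv \<tau>) k =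
      theta_series s ((i, Suc i) # map (map_prod \<tau> \<tau>) (inv_list n (inv w))) (\<kappa> \<circ> inv w \<circ> inv \<tau>) k"
    proof (rule theta_series_set_cong[OF _ inv_list(1) _ _ _ k])
      show "\<forall>(a, b)\<in>set (inv_list n (inv (\<tau> \<circ> w))). a \<in> {1..n} \<and> b \<in> {1..n} \<and> a < b"
        unfolding inv_list(2) by (auto simp: inversions_def)
      have "inj_on (map_prod \<tau> \<tau>) S" for S by (rule inj_on_subset[OF inj]) auto
      then show "distinct ((i, Suc i) # map (map_prod \<tau> \<tau>) (inv_list n (inv w)))"
        using notin by (simp add: distinct_map inv_list)
      show "set (inv_list n (inv (\<tau> \<circ> w))) = set ((i, Suc i) # map (map_prod \<tau> \<tau>) (inv_list n (inv w)))"
        by (simp add: inv_list set_eq)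
      show "\<kappa> \<circ> inv w \<circ> inv \<tau> \<in> idx n"
        by (intro idx_permute permutes_inv \<kappa> \<tau> wp)
    qed
    ultimately show "X (\<tau> \<circ> w) k = theta_series s ((i, Suc i) # map (map_prod \<tau> \<tau>) (inv_list n (inv w))) (\<kappa> \<circ> inv w \<circ> inv \<tau>) k"
      by (simp only: X_def)
  qed
  have Xrel: "X (\<tau> \<circ> w) (k(i := k i + 1)) - s * X (\<tau> \<circ> w) (k(Suc i := k (Suc i) + 1)) =
      s * X w (k(i := k (Suc i), Suc i := k i + 1)) - X w (k(i := k (Suc i) + 1, Suc i := k i))"
    if w: "w \<in> A" and k: "k \<in> idx n" for w k
  proof -
    have up: "k(i := k i + 1) \<in> idx n" "k(Suc i := k (Suc i) + 1) \<in> idx n" using k i by (auto intro!: idx_upd)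
    let ?ps = "map (map_prod \<tau> \<tau>) (inv_list n (inv w))"
    have "X (\<tau> \<circ> w) (k(i := k i + 1)) - s * X (\<tau> \<circ> w) (k(Suc i := k (Suc i) + 1)) =
      s * theta_series s ?ps (\<kappa> \<circ> inv w \<circ> inv \<tau>) (k(i := k i + 1)) - theta_series s ?ps (\<kappa> \<circ> inv w \<circ> inv \<tau>) (k(Suc i := k (Suc i) + 1))"
      unfolding Xt[OF w up(1)] Xt[OF w up(2)]
      by (rule theta_series_relation[OF valid[OF w k]]) (use i in auto)
    also have "\<dots> = s * X w (k(i := k i + 1) \<circ> \<tau>) - X w (k(Suc i := k (Suc i) + 1) \<circ> \<tau>)"
      by (simp only: theta_series_permute[OF \<tau>] X_def)
    also have "k(i := k i + 1) \<circ> \<tau> = k(i := k (Suc i), Suc i := k i + 1)"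
      by (auto simp: fun_eq_iff \<tau>_def Transposition.transpose_def)
    also have "k(Suc i := k (Suc i) + 1) \<circ> \<tau> = k(i := k (Suc i) + 1, Suc i := k i)"
      by (auto simp: fun_eq_iff \<tau>_def Transposition.transpose_def)
    finally show ?thesis .
  qed
  let ?l = "l(i := l (Suc i), Suc i := l i)"
  have "?l \<in> idx n" using l i by (auto intro!: idx_upd)
  have upd: "?l(i := ?l i + 1) = l(i := l (Suc i) + 1, Suc i := l i)"
    "?l(Suc i := ?l (Suc i) + 1) = l(i := l (Suc i), Suc i := l i + 1)"
    "?l(i := ?l (Suc i), Suc i := ?l i + 1) = l(Suc i := l (Suc i) + 1)"
    "?l(i := ?l (Suc i) + 1, Suc i := ?l i) = l(i := l i + 1)"
    by (auto simp: fun_eq_iff)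
  \<comment> \<open>The first relation is used at \<open>l\<close>, the second at \<open>l\<close>
    with the entries \<open>i\<close> and \<open>Suc i\<close> exchanged; together they give the
    exchange relation for the two summands.\<close>
  have combine: "(x1 + y1) - s * (x2 + y2) = s * (x3 + y3) - (x4 + y4)"
    if "y1 - s * y2 = s * x3 - x4" "y4 - s * y3 = s * x2 - x1" for x1 x2 x3 x4 y1 y2 y3 y4
  proof -
    have eqs: "y1 = s * x3 - x4 + s * y2" "y4 = s * x2 - x1 + s * y3"
      unfolding that[symmetric] by simp_all
    show ?thesis unfolding eqs by (simp add: algebra_simps)
  qed
  have "X w (l(i := l i + 1)) + X (\<tau> \<circ> w) (l(i := l i + 1)) - s * (X w (l(Suc i := l (Suc i) + 1)) + X (\<tau> \<circ> w) (l(Suc i := l (Suc i) + 1))) =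
     s * (X w (l(i := l (Suc i), Suc i := l i + 1)) + X (\<tau> \<circ> w) (l(i := l (Suc i), Suc i := l i + 1))) -
     (X w (l(i := l (Suc i) + 1, Suc i := l i)) + X (\<tau> \<circ> w) (l(i := l (Suc i) + 1, Suc i := l i)))"
    if w: "w \<in> A" for w
    by (rule combine[OF Xrel[OF w l] Xrel[OF w \<open>?l \<in> idx n\<close>, unfolded upd]])
  then show "sym_coeff s n \<kappa> (l(i := l i + 1)) - s * sym_coeff s n \<kappa> (l(Suc i := l (Suc i) + 1)) =
     s * sym_coeff s n \<kappa> (l(i := l (Suc i), Suc i := l i + 1)) - sym_coeff s n \<kappa> (l(i := l (Suc i) + 1, Suc i := l i))"
    unfolding sum_A sum_distrib_left sum_subtractf[symmetric] by (rule sum.cong[OF refl])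
qed

section \<open>Normalization at increasing exponents\<close>

definition stab_weight :: "complex \<Rightarrow> nat \<Rightarrow> (nat \<Rightarrow> int) \<Rightarrow> complex" where
  "stab_weight s n \<kappa> = (\<Sum>p | p permutes {1..n} \<and> \<kappa> \<circ> p = \<kappa>. s ^ card (inversions n p))"

lemma mono_permute_eq:
  assumes w: "w permutes {1..n}" and mono: "mono_on {1..n} (k \<circ> w)" "mono_on {1..n} k"
  shows "k \<circ> w = (k :: nat \<Rightarrow> int)"
proof -
  let ?xs = "[1..<Suc n]"
  have set_xs: "set ?xs = {1..n}" by auto
  have srt: "sorted (map h ?xs)" if "mono_on {1..n} h" for h :: "nat \<Rightarrow> int"
    unfolding sorted_map
    by (rule sorted_wrt_mono_rel[of _ "(\<le>)"]) (use that in \<open>auto simp: mono_on_def simp del: upt_Suc\<close>)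
  have "mset (map w ?xs) = mset ?xs"
  proof -
    have "mset (map w ?xs) = image_mset w (mset_set {1..n})" by (simp add: atLeastLessThanSuc_atLeastAtMost del: upt_Suc)
    also have "\<dots> = mset_set (w ` {1..n})" by (rule image_mset_mset_set) (use permutes_inj_on[OF w] in auto)
    also have "w ` {1..n} = {1..n}" by (rule permutes_image[OF w])
    finally show ?thesis by (simp add: atLeastLessThanSuc_atLeastAtMost del: upt_Suc)
  qed
  then have "mset (map (k \<circ> w) ?xs) = mset (map k ?xs)"
    by (metis map_map mset_map)
  then have "map (k \<circ> w) ?xs = map k ?xs"
    by (metis srt mono properties_for_sort sorted_sort_id)
  then have "(k \<circ> w) i = k i" if "i \<in> {1..n}" for i
    using that set_xs by (metis map_eq_conv)
  moreover have "(k \<circ> w) i = k i" if "i \<notin> {1..n}" for i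
    using w that by (simp add: permutes_def)
  ultimately show ?thesis by (metis ext)
qed

text \<open>At an inversion of \<open>inv w\<close> the entries of
  \<open>\<kappa> \<circ> inv w\<close> decrease while those of \<open>l\<close> increase, so
  \<open>theta_series_dominant\<close> leaves only \<open>l = \<kappa> \<circ> inv w\<close>; as
  \<open>l\<close> and \<open>\<kappa>\<close> are both increasing, they agree. What remains is the
  Poincare polynomial of the stabilizer of \<open>\<kappa>\<close>, the normalizing factor of
  Hall-Littlewood polynomials.\<close>

lemma sym_coeff_dominant:
  assumes "\<kappa> \<in> idx n" "l \<in> idx n" "mono_on {1..n} \<kappa>" "mono_on {1..n} l"
  shows "sym_coeff s n \<kappa> l = (if l = \<kappa> then stab_weight s n \<kappa> else 0)"
proof -
  have summand: "theta_series s (inv_list n (inv w)) (\<kappa> \<circ> inv w) l =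
      (if l = \<kappa> \<and> \<kappa> \<circ> inv w = \<kappa> then s ^ card (inversions n (inv w)) else 0)"
    if w: "w permutes {1..n}" for w
  proof -
    have iw: "inv w permutes {1..n}" by (rule permutes_inv[OF w])
    have "theta_series s (inv_list n (inv w)) (\<kappa> \<circ> inv w) l =
        (if l = \<kappa> \<circ> inv w then s ^ length (inv_list n (inv w)) else 0)"
    proof (rule theta_series_dominant)
      show "\<forall>(a, b)\<in>set (inv_list n (inv w)). a \<in> {1..n} \<and> b \<in> {1..n} \<and> a < b \<and> l a \<le> l b \<and> (\<kappa> \<circ> inv w) b \<le> (\<kappa> \<circ> inv w) a"
        unfolding inv_list(2)
      proof (clarify)
        fix a b assume "(a, b) \<in> inversions n (inv w)"
        then have ab: "a \<in> {1..n}" "b \<in> {1..n}" "a < b" "inv w b < inv w a" by (auto simp: inversions_def)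
        have "inv w a \<in> {1..n}" "inv w b \<in> {1..n}" using ab permutes_in_image[OF iw] by blast+
        then show "a \<in> {1..n} \<and> b \<in> {1..n} \<and> a < b \<and> l a \<le> l b \<and> (\<kappa> \<circ> inv w) b \<le> (\<kappa> \<circ> inv w) a"
          using ab assms(3,4) by (auto simp: mono_on_def simp del: atLeastAtMost_iff)
      qed
    qed (use assms iw in \<open>auto intro: idx_permute\<close>)
    also have "length (inv_list n (inv w)) = card (inversions n (inv w))" by (rule length_inv_list)
    also have "l = \<kappa> \<circ> inv w \<longleftrightarrow> l = \<kappa> \<and> \<kappa> \<circ> inv w = \<kappa>"
      using mono_permute_eq[OF iw, of \<kappa>] assms by auto
    finally show ?thesis .
  qed
  have "sym_coeff s n \<kappa> l = (\<Sum>w | w permutes {1..n}. if l = \<kappa> \<and> \<kappa> \<circ> inv w = \<kappa> then s ^ card (inversions n (inv w)) else 0)"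
    unfolding sym_coeff_def by (rule sum.cong) (use summand in auto)
  also have "\<dots> = (\<Sum>p | p permutes {1..n}. if l = \<kappa> \<and> \<kappa> \<circ> p = \<kappa> then s ^ card (inversions n p) else 0)"
    by (rule sum_permutations_inverse[symmetric])
  also have "\<dots> = (if l = \<kappa> then stab_weight s n \<kappa> else 0)"
    unfolding stab_weight_def
    by (simp add: sum.inter_filter[symmetric, OF finite_permutations] if_distrib)
  finally show ?thesis .
qed

text \<open>Sort the stabilizer by the image \<open>j\<close> of \<open>Suc n\<close>, which ranges
  over the last block of \<open>\<kappa>\<close>. Splitting off the cycle that carries
  \<open>Suc n\<close> to \<open>j\<close> leaves a permutation of \<open>{1..n}\<close> and
  accounts for \<open>Suc n - j\<close> inversions.\<close>

lemma stab_weight_Suc: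
  assumes mono: "mono_on {1..Suc n} \<kappa>"
  shows "stab_weight s (Suc n) \<kappa> = (\<Sum>j<card {j\<in>{1..Suc n}. \<kappa> j = \<kappa> (Suc n)}. s ^ j) * stab_weight s n \<kappa>"
proof -
  define J where "J = {j\<in>{1..Suc n}. \<kappa> j = \<kappa> (Suc n)}"
  define cyc where "cyc j i = (if i = Suc n then j else if j \<le> i \<and> i \<le> n then Suc i else i)" for j i
  define cyc' where "cyc' j i = (if i = j then Suc n else if j < i \<and> i \<le> Suc n then i - 1 else i)" for j i
  have J: "1 \<le> j" "j \<le> Suc n" "\<kappa> j = \<kappa> (Suc n)" if "j \<in> J" for j using that by (auto simp: J_def)
  have cc: "cyc j (cyc' j i) = i" "cyc' j (cyc j i) = i" if "1 \<le> j" "j \<le> Suc n" for i j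
    using that by (auto simp: cyc_def cyc'_def)
  have bij: "bij (cyc j)" "inv (cyc j) = cyc' j" if "1 \<le> j" "j \<le> Suc n" for j
    by (rule o_bij[of "cyc' j"]; use cc[OF that] in \<open>simp add: fun_eq_iff\<close>)
       (rule inv_equality; use cc[OF that] in simp)
  have cyc_perm: "cyc j permutes {1..Suc n}" if "1 \<le> j" "j \<le> Suc n" for j
    unfolding permutes_def using bij(1)[OF that] that by (intro conjI; simp add: bij_iff cyc_def)
  have cyc'_perm: "cyc' j permutes {1..Suc n}" if "1 \<le> j" "j \<le> Suc n" for j
    using permutes_inv[OF cyc_perm[OF that]] bij(2)[OF that] by simp
  have kcyc: "\<kappa> \<circ> cyc j = \<kappa>" if "j \<in> J" for j
  proof
    fix i
    have "\<kappa> (Suc i) = \<kappa> i" if i: "j \<le> i" "i \<le> n"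
    proof -
      have "\<kappa> j \<le> \<kappa> i" "\<kappa> i \<le> \<kappa> (Suc i)" "\<kappa> (Suc i) \<le> \<kappa> (Suc n)"
        by (rule monotone_onD[OF mono]; use i J[OF \<open>j \<in> J\<close>] in auto)+
      with J(3)[OF \<open>j \<in> J\<close>] show ?thesis by simp
    qed
    then show "(\<kappa> \<circ> cyc j) i = \<kappa> i" using J[OF that] by (auto simp: cyc_def)
  qed
  have kcyc': "\<kappa> \<circ> cyc' j = \<kappa>" if "j \<in> J" for j
  proof
    fix i
    have "(\<kappa> \<circ> cyc j) (cyc' j i) = \<kappa> (cyc' j i)" by (simp only: kcyc[OF that])
    then show "(\<kappa> \<circ> cyc' j) i = \<kappa> i" using cc(1)[OF J(1,2)[OF that]] by simp
  qed
  let ?P = "\<lambda>m. {p. p permutes {1..m} \<and> \<kappa> \<circ> p = \<kappa>}"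
  have sub: "p permutes {1..n} \<Longrightarrow> p permutes {1..Suc n}" for p
    by (rule permutes_subset) auto
  have card_inv: "card (inversions (Suc n) (cyc j \<circ> p)) = (Suc n - j) + card (inversions n p)"
    if j: "j \<in> J" and p: "p \<in> ?P n" for j p
  proof -
    have pp: "p permutes {1..n}" using p by simp
    have pSn: "p (Suc n) = Suc n" using pp by (simp add: permutes_def)
    have pin: "p a \<in> {1..n}" if "a \<in> {1..n}" for a using permutes_in_image[OF pp] that by blast
    have less: "cyc j (p b) < cyc j (p a) \<longleftrightarrow> p b < p a" if "a \<in> {1..n}" "b \<in> {1..n}" for a b
      using pin[OF that(1)] pin[OF that(2)] by (auto simp: cyc_def)
    let ?B = "{a\<in>{1..n}. j \<le> p a}"
    have "inversions (Suc n) (cyc j \<circ> p) = inversions n p \<union> (\<lambda>a. (a, Suc n)) ` ?B"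
    proof (intro equalityI subsetI)
      fix x assume x: "x \<in> inversions (Suc n) (cyc j \<circ> p)"
      obtain a b where ab: "x = (a, b)" by (cases x)
      have a: "a \<in> {1..n}" using x ab by (auto simp: inversions_def)
      show "x \<in> inversions n p \<union> (\<lambda>a. (a, Suc n)) ` ?B"
      proof (cases "b = Suc n")
        case True
        then have "cyc j (p a) > j" using x ab pSn by (auto simp: inversions_def cyc_def)
        then have "j \<le> p a" using pin[OF a] by (auto simp: cyc_def split: if_splits)
        then show ?thesis using True ab a by auto
      next
        case False
        then have "b \<in> {1..n}" using x ab by (auto simp: inversions_def)
        then show ?thesis using x ab a less[OF a] by (auto simp: inversions_def)
      qed
    next
      fix x assume "x \<in> inversions n p \<union> (\<lambda>a. (a, Suc n)) ` ?B"
      then consider a b where "x = (a, b)" "(a, b) \<in> inversions n p" | a where "x = (a, Suc n)" "a \<in> ?B"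
        by (cases x) auto
      then show "x \<in> inversions (Suc n) (cyc j \<circ> p)"
      proof cases
        case 1
        then show ?thesis using less[of a b] by (auto simp: inversions_def)
      next
        case 2
        then have "cyc j (p a) = Suc (p a)" using pin[of a] by (auto simp: cyc_def)
        then show ?thesis using 2 pSn by (auto simp: inversions_def cyc_def)
      qed
    qed
    moreover have "inversions n p \<inter> (\<lambda>a. (a, Suc n)) ` ?B = {}" by (auto simp: inversions_def)
    moreover have "card ((\<lambda>a. (a, Suc n)) ` ?B) = Suc n - j"
    proof -
      have "card ((\<lambda>a. (a, Suc n)) ` ?B) = card ?B" by (rule card_image) (auto intro: inj_onI)
      also have "\<dots> = card (p ` ?B)" by (rule card_image[symmetric]) (use permutes_inj_on[OF pp] in auto)
      also have "p ` ?B = {j..n}"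
      proof (intro equalityI subsetI)
        fix x assume "x \<in> {j..n}"
        then have x: "x \<in> {1..n}" "j \<le> x" using J[OF j] by auto
        then have "inv p x \<in> {1..n}" using permutes_in_image[OF permutes_inv[OF pp]] by blast
        moreover have "p (inv p x) = x" using permutes_inverses[OF pp] by simp
        ultimately show "x \<in> p ` ?B" using x by (metis (mono_tags, lifting) image_eqI mem_Collect_eq)
      qed (use pin in auto)
      finally show ?thesis by simp
    qed
    ultimately show ?thesis by (simp add: card_Un_disjoint)
  qed
  have "stab_weight s (Suc n) \<kappa> = (\<Sum>(j, p)\<in>J \<times> ?P n. s ^ card (inversions (Suc n) (cyc j \<circ> p)))"
    unfolding stab_weight_def
  proof (rule sum.reindex_bij_witness[of _ "\<lambda>(j, p). cyc j \<circ> p" "\<lambda>p. (p (Suc n), cyc' (p (Suc n)) \<circ> p)"], goal_cases)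
    case (1 p)
    then have "p (Suc n) \<in> {1..Suc n}" using permutes_in_image[of p "{1..Suc n}" "Suc n"] by simp
    then show ?case using cc(1)[of "p (Suc n)"] by (auto simp: fun_eq_iff)
  next
    case (2 p)
    let ?j = "p (Suc n)"
    have p: "p permutes {1..Suc n}" "\<kappa> \<circ> p = \<kappa>" using 2 by auto
    have j: "?j \<in> J" using p permutes_in_image[of p "{1..Suc n}" "Suc n"] by (auto simp: J_def dest: fun_cong[of _ _ "Suc n"])
    have perm: "cyc' ?j \<circ> p permutes {1..Suc n}"
      by (rule permutes_compose[OF p(1) cyc'_perm]) (use J[OF j] in auto)
    have "cyc' ?j \<circ> p permutes {1..n}"
    proof (rule permutes_superset[OF perm])
      fix x assume "x \<in> {1..Suc n} - {1..n}"
      then have "x = Suc n" by auto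
      then show "(cyc' ?j \<circ> p) x = x" by (simp add: cyc'_def)
    qed
    moreover have "\<kappa> \<circ> (cyc' ?j \<circ> p) = \<kappa>" using kcyc'[OF j] p(2) by (metis comp_assoc)
    ultimately show ?case using j by simp
  next
    case (3 x)
    obtain j p where x: "x = (j, p)" by (cases x)
    have p: "p permutes {1..n}" and j: "j \<in> J" using 3 x by auto
    have "p (Suc n) = Suc n" using p by (simp add: permutes_def)
    then have "(cyc j \<circ> p) (Suc n) = j" by (simp add: cyc_def)
    then show ?case using cc(2)[OF J(1,2)[OF j]] by (auto simp: x fun_eq_iff)
  next
    case (4 x)
    obtain j p where x: "x = (j, p)" by (cases x)
    have p: "p permutes {1..n}" "\<kappa> \<circ> p = \<kappa>" and j: "j \<in> J" using 4 x by auto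
    have "cyc j \<circ> p permutes {1..Suc n}" by (rule permutes_compose[OF sub[OF p(1)] cyc_perm[OF J(1,2)[OF j]]])
    moreover have "\<kappa> \<circ> (cyc j \<circ> p) = \<kappa>" using kcyc[OF j] p(2) by (metis comp_assoc)
    ultimately show ?case by (simp add: x)
  next
    case (5 p)
    then have "p (Suc n) \<in> {1..Suc n}" using permutes_in_image[of p "{1..Suc n}" "Suc n"] by simp
    then have "cyc (p (Suc n)) \<circ> (cyc' (p (Suc n)) \<circ> p) = p" using cc(1)[of "p (Suc n)"] by (auto simp: fun_eq_iff)
    then show ?case by simp
  qed
  also have "\<dots> = (\<Sum>(j, p)\<in>J \<times> ?P n. s ^ (Suc n - j) * s ^ card (inversions n p))"
    by (rule sum.cong) (auto simp: card_inv power_add)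
  also have "\<dots> = (\<Sum>j\<in>J. s ^ (Suc n - j)) * stab_weight s n \<kappa>"
    unfolding stab_weight_def sum_product by (rule sum.cartesian_product[symmetric])
  \<comment> \<open>As \<open>\<kappa>\<close> is increasing, the last block is an interval ending
    at \<open>Suc n\<close>, and the exponents run through
    \<open>0, ..., card J - 1\<close>.\<close>
  also have "(\<Sum>j\<in>J. s ^ (Suc n - j)) = (\<Sum>j<card J. s ^ j)"
  proof -
    define m where "m = Min J"
    have fin: "finite J" "J \<noteq> {}" by (auto simp: J_def)
    have mJ: "m \<in> J" unfolding m_def by (rule Min_in[OF fin])
    have "J = {m..Suc n}"
    proof (intro equalityI subsetI)
      fix j assume "j \<in> J" then show "j \<in> {m..Suc n}" using fin J by (auto simp: m_def)
    next
      fix j assume j: "j \<in> {m..Suc n}"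
      have "\<kappa> m \<le> \<kappa> j" "\<kappa> j \<le> \<kappa> (Suc n)"
        by (rule monotone_onD[OF mono]; use j J[OF mJ] in auto)+
      then show "j \<in> J" using J[OF mJ] j by (auto simp: J_def)
    qed
    then have c: "J = {m..Suc n}" "card J = Suc (Suc n) - m" by auto
    show ?thesis unfolding c(2)
      by (subst c(1), rule sum.reindex_bij_witness[of _ "\<lambda>j. Suc n - j" "\<lambda>j. Suc n - j"]) (use J[OF mJ] in auto)
  qed
  finally show ?thesis by (simp only: J_def)
qed

text \<open>\<open>S\<close> may exceed the set of values, since an absent value contributes
  \<open>q_factorial s 0 = 1\<close>; this keeps \<open>S\<close> fixed during the induction on
  \<open>n\<close>.\<close>

lemma stab_weight_prod:
  assumes "mono_on {1..n} \<kappa>" "finite S" "\<kappa> ` {1..n} \<subseteq> S"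
  shows "stab_weight s n \<kappa> = (\<Prod>x\<in>S. q_factorial s (card {i\<in>{1..n}. \<kappa> i = x}))"
  using assms(1,3)
proof (induction n)
  case 0
  have "{p. p permutes ({} :: nat set) \<and> \<kappa> \<circ> p = \<kappa>} = {id}" by (auto simp: permutes_empty)
  then show ?case by (simp add: stab_weight_def q_factorial_def inversions_def)
next
  case (Suc n)
  let ?x = "\<kappa> (Suc n)" and ?c = "\<lambda>n x. card {i\<in>{1..n}. \<kappa> i = x}"
  have mono': "mono_on {1..n} \<kappa>" by (rule monotone_on_subset[OF Suc.prems(1)]) auto
  have x: "?x \<in> S" using Suc.prems by auto
  have cs: "?c (Suc n) ?x = Suc (?c n ?x)"
  proof -
    have "{i\<in>{1..Suc n}. \<kappa> i = ?x} = insert (Suc n) {i\<in>{1..n}. \<kappa> i = ?x}" by auto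
    then show ?thesis by simp
  qed
  have co: "?c (Suc n) y = ?c n y" if "y \<noteq> ?x" for y
    by (rule arg_cong[of _ _ card]) (use that in \<open>auto simp: le_Suc_eq\<close>)
  have "stab_weight s (Suc n) \<kappa> = (\<Sum>j<?c (Suc n) ?x. s ^ j) * (\<Prod>x\<in>S. q_factorial s (?c n x))"
    using stab_weight_Suc[OF Suc.prems(1)] Suc.IH[OF mono'] Suc.prems(2) by (simp add: subset_iff image_iff Bex_def) (metis le_SucI)
  also have "(\<Prod>x\<in>S. q_factorial s (?c n x)) = q_factorial s (?c n ?x) * (\<Prod>x\<in>S - {?x}. q_factorial s (?c n x))"
    by (rule prod.remove[OF \<open>finite S\<close> x])
  also have "(\<Prod>x\<in>S - {?x}. q_factorial s (?c n x)) = (\<Prod>x\<in>S - {?x}. q_factorial s (?c (Suc n) x))"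
    by (rule prod.cong) (use co in auto)
  also have "(\<Sum>j<?c (Suc n) ?x. s ^ j) * (q_factorial s (?c n ?x) * (\<Prod>x\<in>S - {?x}. q_factorial s (?c (Suc n) x))) =
      q_factorial s (?c (Suc n) ?x) * (\<Prod>x\<in>S - {?x}. q_factorial s (?c (Suc n) x))"
    unfolding cs by (simp add: q_factorial_def)
  also have "\<dots> = (\<Prod>x\<in>S. q_factorial s (?c (Suc n) x))"
    by (rule prod.remove[OF \<open>finite S\<close> x, symmetric])
  finally show ?case .
qed

lemma q_factorial_nonzero:
  assumes "\<And>m::nat. m > 0 \<Longrightarrow> s ^ m \<noteq> 1"
  shows "q_factorial s n \<noteq> 0"
proof -
  have "(\<Sum>j<k. s ^ j) \<noteq> 0" if "k \<in> {1..n}" for k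
  proof
    assume "(\<Sum>j<k. s ^ j) = 0"
    then have "s ^ k - 1 = 0" by (simp add: power_diff_1_eq)
    with assms[of k] that show False by simp
  qed
  then show ?thesis by (simp add: q_factorial_def)
qed

lemma stab_weight_nonzero:
  assumes "\<And>m::nat. m > 0 \<Longrightarrow> s ^ m \<noteq> 1" "mono_on {1..n} \<kappa>"
  shows "stab_weight s n \<kappa> \<noteq> 0"
  using stab_weight_prod[OF assms(2) _ order_refl] q_factorial_nonzero[OF assms(1)] by simp

text \<open>The difference of both sides satisfies the exchange relation and vanishes at increasing
  exponents, where \<open>sym_coeff\<close> is diagonal, so \<open>exchange_rel_zero\<close>
  applies.\<close>

lemma exchange_expansion:
  assumes s: "\<And>m::nat. m > 0 \<Longrightarrow> s ^ m \<noteq> 1" and E: "exchange_rel s n E"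
    and \<Lambda>: "finite \<Lambda>" "\<And>\<kappa>. \<kappa> \<in> \<Lambda> \<Longrightarrow> \<kappa> \<in> idx n \<and> mono_on {1..n} \<kappa>"
      "\<And>\<kappa>. \<kappa> \<in> idx n \<Longrightarrow> mono_on {1..n} \<kappa> \<Longrightarrow> E \<kappa> \<noteq> 0 \<Longrightarrow> \<kappa> \<in> \<Lambda>"
    and l: "l \<in> idx n"
  shows "E l = (\<Sum>\<kappa>\<in>\<Lambda>. E \<kappa> / stab_weight s n \<kappa> * sym_coeff s n \<kappa> l)"
proof -
  define D where "D = (\<lambda>l. E l - (\<Sum>\<kappa>\<in>\<Lambda>. E \<kappa> / stab_weight s n \<kappa> * sym_coeff s n \<kappa> l))"
  have diff_rel: "(e1 - f1) - s * (e2 - f2) = s * (e3 - f3) - (e4 - f4)"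
    if "e1 - s * e2 = s * e3 - e4" "f1 - s * f2 = s * f3 - f4" for e1 e2 e3 e4 f1 f2 f3 f4
  proof -
    have "(e1 - f1) - s * (e2 - f2) = (e1 - s * e2) - (f1 - s * f2)" by (simp add: algebra_simps)
    then show ?thesis unfolding that by (simp add: algebra_simps)
  qed
  have "D l = 0"
  proof (rule exchange_rel_zero[OF _ _ l])
    show "exchange_rel s n D"
      unfolding exchange_rel_def
    proof (intro ballI)
      fix k i assume ki: "k \<in> idx n" "i \<in> {1..<n}"
      let ?S = "\<lambda>l. \<Sum>\<kappa>\<in>\<Lambda>. E \<kappa> / stab_weight s n \<kappa> * sym_coeff s n \<kappa> l"
      let ?k1 = "k(i := k i + 1)" and ?k2 = "k(Suc i := k (Suc i) + 1)"
        and ?k3 = "k(i := k (Suc i), Suc i := k i + 1)" and ?k4 = "k(i := k (Suc i) + 1, Suc i := k i)"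
      have "?S ?k1 - s * ?S ?k2 = s * ?S ?k3 - ?S ?k4"
        unfolding sum_distrib_left sum_subtractf[symmetric]
      proof (rule sum.cong[OF refl])
        fix \<kappa> assume "\<kappa> \<in> \<Lambda>"
        then have "sym_coeff s n \<kappa> ?k1 - s * sym_coeff s n \<kappa> ?k2 = s * sym_coeff s n \<kappa> ?k3 - sym_coeff s n \<kappa> ?k4"
          using sym_coeff_exchange[of \<kappa> n s] \<Lambda>(2) ki unfolding exchange_rel_def by blast
        from arg_cong[OF this, of "\<lambda>x. E \<kappa> / stab_weight s n \<kappa> * x"]
        show "E \<kappa> / stab_weight s n \<kappa> * sym_coeff s n \<kappa> ?k1 - s * (E \<kappa> / stab_weight s n \<kappa> * sym_coeff s n \<kappa> ?k2) =
          s * (E \<kappa> / stab_weight s n \<kappa> * sym_coeff s n \<kappa> ?k3) - E \<kappa> / stab_weight s n \<kappa> * sym_coeff s n \<kappa> ?k4"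
          by (simp add: algebra_simps)
      qed
      moreover have "E ?k1 - s * E ?k2 = s * E ?k3 - E ?k4"
        using E ki unfolding exchange_rel_def by blast
      ultimately show "D ?k1 - s * D ?k2 = s * D ?k3 - D ?k4"
        unfolding D_def by (rule diff_rel[rotated])
    qed
  next
    fix k assume k: "k \<in> idx n" "mono_on {1..n} k"
    have "(\<Sum>\<kappa>\<in>\<Lambda>. E \<kappa> / stab_weight s n \<kappa> * sym_coeff s n \<kappa> k) = (\<Sum>\<kappa>\<in>\<Lambda>. if \<kappa> = k then E k else 0)"
    proof (rule sum.cong[OF refl])
      fix \<kappa> assume "\<kappa> \<in> \<Lambda>"
      then show "E \<kappa> / stab_weight s n \<kappa> * sym_coeff s n \<kappa> k = (if \<kappa> = k then E k else 0)"
        using sym_coeff_dominant[of \<kappa> n k s] \<Lambda>(2)[of \<kappa>] k stab_weight_nonzero[OF s, of n \<kappa>] by auto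
    qed
    also have "\<dots> = E k" using \<Lambda>(1,3) k by auto
    finally show "D k = 0" by (simp add: D_def)
  qed
  then show ?thesis by (simp add: D_def)
qed

section \<open>The symmetrized rational functions\<close>

definition pairs :: "nat \<Rightarrow> (nat \<times> nat) set" where
  "pairs n = {(i, j). i \<in> {1..n} \<and> j \<in> {1..n} \<and> i < j}"

text \<open>At \<open>s = 1\<close> this is the Vandermonde product, from which the multiplicativity
  of \<open>inv_sign\<close> is obtained.\<close>

definition skew_prod :: "complex \<Rightarrow> nat \<Rightarrow> (nat \<Rightarrow> complex) \<Rightarrow> complex" where
  "skew_prod s n z = (\<Prod>(i, j)\<in>pairs n. z i - s * z j)"

definition inv_sign :: "nat \<Rightarrow> (nat \<Rightarrow> nat) \<Rightarrow> complex" where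
  "inv_sign n w = (-1) ^ card (inversions n (inv w))"

lemma finite_pairs [simp]: "finite (pairs n)"
  by (rule finite_subset[of _ "{1..n} \<times> {1..n}"]) (auto simp: pairs_def)

lemma inversions_subset_pairs: "inversions n p \<subseteq> pairs n"
  by (auto simp: inversions_def pairs_def)

text \<open>\<open>w\<close> permutes the unordered pairs; the pairs whose order has to be flipped
  after applying \<open>w\<close> are the inversions of \<open>inv w\<close>.\<close>

lemma prod_pairs_permute:
  fixes J :: "nat \<Rightarrow> nat \<Rightarrow> complex"
  assumes w: "w permutes {1..n}"
  shows "(\<Prod>(i, j)\<in>pairs n. J (w i) (w j)) =
         (\<Prod>(a, b)\<in>pairs n. if (a, b) \<in> inversions n (inv w) then J b a else J a b)"
proof (rule prod.reindex_bij_witness[of _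
      "\<lambda>(a, b). if inv w b < inv w a then (inv w b, inv w a) else (inv w a, inv w b)"
      "\<lambda>(i, j). if w i < w j then (w i, w j) else (w j, w i)"], goal_cases)
  have iw: "inv w (w a) = a" "w (inv w a) = a" for a using permutes_inverses[OF w] by auto
  have neq: "a \<noteq> b \<Longrightarrow> w a \<noteq> w b" "a \<noteq> b \<Longrightarrow> inv w a \<noteq> inv w b" for a b using iw by metis+
  have img: "w a \<in> {1..n} \<longleftrightarrow> a \<in> {1..n}" "inv w a \<in> {1..n} \<longleftrightarrow> a \<in> {1..n}" for a
    using permutes_in_image[OF w] permutes_in_image[OF permutes_inv[OF w]] by auto
  note [simp del] = atLeastAtMost_iff One_nat_def
  {
    case (1 x)
    then show ?case by (cases x) (auto simp: pairs_def iw)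
  next
    case (2 x)
    then show ?case using neq(1)[of "fst x" "snd x"] by (cases x) (auto simp: pairs_def img)
  next
    case (3 x)
    then show ?case by (cases x) (auto simp: pairs_def iw)
  next
    case (4 x)
    then show ?case using neq(2)[of "fst x" "snd x"] by (cases x) (auto simp: pairs_def img)
  next
    case (5 x)
    then show ?case by (cases x) (auto simp: pairs_def inversions_def iw img)
  }
qed

lemma inv_sign_square: "inv_sign n w * inv_sign n w = 1"
  by (simp add: inv_sign_def flip: power_mult_distrib)

text \<open>For an inverted pair
  \<open>z b - s * z a = - theta s (z a) (z b) * (z a - s * z b)\<close>; the signs collect to
  \<open>inv_sign\<close>.\<close>

lemma inv_sign_skew_prod:
  assumes w: "w permutes {1..n}" and nz: "\<And>a b. (a, b) \<in> pairs n \<Longrightarrow> z a \<noteq> s * z b"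
  shows "(\<Prod>(a, b)\<in>inversions n (inv w). theta s (z a) (z b)) = inv_sign n w * skew_prod s n (z \<circ> w) / skew_prod s n z"
proof -
  let ?I = "inversions n (inv w)"
  have D: "skew_prod s n z \<noteq> 0" using nz by (auto simp: skew_prod_def)
  have "skew_prod s n (z \<circ> w) = (\<Prod>(a, b)\<in>pairs n. if (a, b) \<in> ?I then z b - s * z a else z a - s * z b)"
    unfolding skew_prod_def using prod_pairs_permute[OF w, of "\<lambda>a b. z a - s * z b"] by simp
  also have "\<dots> = (\<Prod>(a, b)\<in>pairs n. (if (a, b) \<in> ?I then - theta s (z a) (z b) else 1) * (z a - s * z b))"
    by (rule prod.cong) (use nz in \<open>auto simp: theta_def\<close>)
  also have "\<dots> = (\<Prod>p\<in>pairs n. if p \<in> ?I then (case p of (a, b) \<Rightarrow> - theta s (z a) (z b)) else 1) * skew_prod s n z"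
    unfolding skew_prod_def by (subst prod.distrib[symmetric]) (auto intro!: prod.cong)
  also have "(\<Prod>p\<in>pairs n. if p \<in> ?I then (case p of (a, b) \<Rightarrow> - theta s (z a) (z b)) else 1) =
      (\<Prod>p\<in>?I. case p of (a, b) \<Rightarrow> - theta s (z a) (z b))"
    using inversions_subset_pairs[of n "inv w"] by (simp add: prod.If_cases Int_absorb1)
  also have "\<dots> = (\<Prod>p\<in>?I. -1) * (\<Prod>(a, b)\<in>?I. theta s (z a) (z b))"
    by (subst prod.distrib[symmetric]) (auto intro!: prod.cong)
  also have "(\<Prod>p\<in>?I. -1) = inv_sign n w" by (simp add: inv_sign_def)
  finally have "inv_sign n w * skew_prod s n (z \<circ> w) =
      (inv_sign n w * inv_sign n w) * (\<Prod>(a, b)\<in>?I. theta s (z a) (z b)) * skew_prod s n z"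
    by (simp only: mult.assoc)
  then show ?thesis using D by (simp add: inv_sign_square)
qed

lemma skew_prod_one_permute:
  assumes w: "w permutes {1..n}"
  shows "skew_prod 1 n (z \<circ> w) = inv_sign n w * skew_prod 1 n z"
proof -
  let ?I = "inversions n (inv w)"
  have "skew_prod 1 n (z \<circ> w) = (\<Prod>(a, b)\<in>pairs n. if (a, b) \<in> ?I then z b - z a else z a - z b)"
    unfolding skew_prod_def using prod_pairs_permute[OF w, of "\<lambda>a b. z a - z b"] by simp
  also have "\<dots> = (\<Prod>p\<in>pairs n. (if p \<in> ?I then -1 else 1) * (case p of (a, b) \<Rightarrow> z a - 1 * z b))"
    by (rule prod.cong) auto
  also have "\<dots> = (\<Prod>p\<in>pairs n. if p \<in> ?I then -1 else 1) * skew_prod 1 n z"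
    unfolding skew_prod_def by (rule prod.distrib)
  also have "(\<Prod>p\<in>pairs n. if p \<in> ?I then -1 else 1 :: complex) = inv_sign n w"
    using inversions_subset_pairs[of n "inv w"] by (simp add: prod.If_cases Int_absorb1 inv_sign_def)
  finally show ?thesis .
qed

text \<open>Permute the Vandermonde product in one step and in two steps, at the distinct points
  \<open>of_nat\<close> where it is nonzero.\<close>

lemma inv_sign_compose:
  assumes w: "w permutes {1..n}" and u: "u permutes {1..n}"
  shows "inv_sign n (w \<circ> u) = inv_sign n w * inv_sign n u"
proof -
  define z :: "nat \<Rightarrow> complex" where "z = of_nat"
  have nz: "skew_prod 1 n z \<noteq> 0"
    unfolding skew_prod_def by (subst prod_zero_iff, simp) (auto simp: z_def pairs_def)
  have "inv_sign n (w \<circ> u) * skew_prod 1 n z = skew_prod 1 n (z \<circ> (w \<circ> u))"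
    by (rule skew_prod_one_permute[symmetric, OF permutes_compose[OF u w]])
  also have "\<dots> = skew_prod 1 n ((z \<circ> w) \<circ> u)" by (simp only: comp_assoc)
  also have "\<dots> = inv_sign n u * (inv_sign n w * skew_prod 1 n z)"
    by (simp only: skew_prod_one_permute[OF u] skew_prod_one_permute[OF w])
  finally show ?thesis using nz by simp
qed

text \<open>The polynomial \<open>(x - s y) (x - y / s)\<close> is symmetric in \<open>x\<close> and
  \<open>y\<close>. This is why the theta factors for \<open>s\<close> and \<open>1 / s\<close> are
  inverse to each other.\<close>

lemma skew_prod_mult_permute:
  assumes w: "w permutes {1..n}" and s: "s \<noteq> 0"
  shows "skew_prod s n (z \<circ> w) * skew_prod (1 / s) n (z \<circ> w) = skew_prod s n z * skew_prod (1 / s) n z"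
proof -
  have eq: "skew_prod s n z * skew_prod (1 / s) n z = (\<Prod>(a, b)\<in>pairs n. (z a - s * z b) * (z a - 1 / s * z b))" for z
    unfolding skew_prod_def by (subst prod.distrib[symmetric]) (auto intro!: prod.cong)
  have sym: "(z b - s * z a) * (z b - 1 / s * z a) = (z a - s * z b) * (z a - 1 / s * z b)" for a b
    using s by (simp add: field_simps)
  have "skew_prod s n (z \<circ> w) * skew_prod (1 / s) n (z \<circ> w) =
      (\<Prod>(a, b)\<in>pairs n. if (a, b) \<in> inversions n (inv w) then (z b - s * z a) * (z b - 1 / s * z a)
        else (z a - s * z b) * (z a - 1 / s * z b))"
    unfolding eq o_apply by (rule prod_pairs_permute[OF w])
  then show ?thesis unfolding eq sym if_cancel .
qed

lemma sym_fun_rational: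
  assumes nz: "\<And>a b. (a, b) \<in> pairs n \<Longrightarrow> z a \<noteq> s * z b"
  shows "sym_fun s n \<kappa> z = (\<Sum>w | w permutes {1..n}. inv_sign n w * skew_prod s n (z \<circ> w) * zpow n \<kappa> (z \<circ> w)) / skew_prod s n z"
  unfolding sym_fun_def sum_divide_distrib
  by (rule sum.cong) (use nz in \<open>simp_all add: inv_sign_skew_prod\<close>)

text \<open>The common numerator of \<open>sym_fun\<close> changes only by the sign of
  \<open>w\<close>, so the remaining dependence on \<open>w\<close> comes from the
  denominator.\<close>

lemma sym_fun_permute:
  assumes w: "w permutes {1..n}"
    and nz: "\<And>i j. i \<in> {1..n} \<Longrightarrow> j \<in> {1..n} \<Longrightarrow> i \<noteq> j \<Longrightarrow> z i \<noteq> t * z j"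
  shows "sym_fun t n \<kappa> (z \<circ> w) = inv_sign n w * skew_prod t n z / skew_prod t n (z \<circ> w) * sym_fun t n \<kappa> z"
proof -
  have nz1: "z a \<noteq> t * z b" "(z \<circ> w) a \<noteq> t * (z \<circ> w) b" if "(a, b) \<in> pairs n" for a b
  proof -
    have ab: "a \<in> {1..n}" "b \<in> {1..n}" "a \<noteq> b" using that by (auto simp: pairs_def)
    then have "w a \<in> {1..n}" "w b \<in> {1..n}" using permutes_in_image[OF w] by blast+
    moreover have "w a \<noteq> w b" using permutes_inj[OF w] ab by (simp add: inj_eq)
    ultimately show "z a \<noteq> t * z b" "(z \<circ> w) a \<noteq> t * (z \<circ> w) b" using nz ab by auto
  qed
  let ?S = "\<Sum>u | u permutes {1..n}. inv_sign n u * skew_prod t n (z \<circ> u) * zpow n \<kappa> (z \<circ> u)"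
  have D: "skew_prod t n z \<noteq> 0" using nz1(1) by (auto simp: skew_prod_def)
  have "sym_fun t n \<kappa> (z \<circ> w) =
     (\<Sum>u | u permutes {1..n}. inv_sign n u * skew_prod t n (z \<circ> (w \<circ> u)) * zpow n \<kappa> (z \<circ> (w \<circ> u))) / skew_prod t n (z \<circ> w)"
    by (subst sym_fun_rational) (use nz1 in \<open>auto simp: comp_assoc\<close>)
  also have "(\<Sum>u | u permutes {1..n}. inv_sign n u * skew_prod t n (z \<circ> (w \<circ> u)) * zpow n \<kappa> (z \<circ> (w \<circ> u))) =
     (\<Sum>u | u permutes {1..n}. inv_sign n w * (inv_sign n (w \<circ> u) * skew_prod t n (z \<circ> (w \<circ> u)) * zpow n \<kappa> (z \<circ> (w \<circ> u))))"
  proof (rule sum.cong[OF refl])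
    fix u assume "u \<in> {u. u permutes {1..n}}"
    then have "inv_sign n u = inv_sign n w * inv_sign n (w \<circ> u)"
      using inv_sign_compose[OF w, of u] inv_sign_square[of n w] by (simp flip: mult.assoc)
    then show "inv_sign n u * skew_prod t n (z \<circ> (w \<circ> u)) * zpow n \<kappa> (z \<circ> (w \<circ> u)) =
      inv_sign n w * (inv_sign n (w \<circ> u) * skew_prod t n (z \<circ> (w \<circ> u)) * zpow n \<kappa> (z \<circ> (w \<circ> u)))"
      by (simp only: mult.assoc)
  qed
  also have "\<dots> = inv_sign n w * ?S"
    unfolding sum_distrib_left[symmetric] setum_permutations_compose_left[OF w, of "\<lambda>u. inv_sign n u * skew_prod t n (z \<circ> u) * zpow n \<kappa> (z \<circ> u)"] ..
  finally have *: "sym_fun t n \<kappa> (z \<circ> w) = inv_sign n w * ?S / skew_prod t n (z \<circ> w)" .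
  have e: "sym_fun t n \<kappa> z = ?S / skew_prod t n z" by (rule sym_fun_rational[OF nz1(1)])
  have alg: "a * S / W = a * d / W * (S / d)" if "d \<noteq> 0" for a S W d :: complex using that by simp
  show ?thesis unfolding * e by (rule alg[OF D])
qed

text \<open>The theta factors of a summand of the second series turn \<open>sym_fun (1 / s)\<close>
  at \<open>z\<close> into its value at \<open>z \<circ> w\<close>. Writing
  \<open>y = z \<circ> w\<close>, that summand has only the denominators
  \<open>y i - y j / s\<close> with \<open>i < j\<close>, so its poles are directed by the order
  \<open>w\<close>.\<close>

lemma sym_fun_product:
  assumes s: "s \<noteq> 0"
    and nz: "\<And>i j. i \<in> {1..n} \<Longrightarrow> j \<in> {1..n} \<Longrightarrow> i \<noteq> j \<Longrightarrow> z i \<noteq> s * z j"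
  shows "sym_fun (1 / s) n \<kappa> z * sym_fun s n \<mu> z =
         (\<Sum>w | w permutes {1..n}. zpow n \<mu> (z \<circ> w) * sym_fun (1 / s) n \<kappa> (z \<circ> w))"
proof -
  have nz': "z i \<noteq> 1 / s * z j" if "i \<in> {1..n}" "j \<in> {1..n}" "i \<noteq> j" for i j
    using nz[OF that(2,1)] that s by (auto simp: field_simps)
  have pn: "z a \<noteq> s * z b" if "(a, b) \<in> pairs n" for a b using nz that by (auto simp: pairs_def)
  have D: "skew_prod r n (z \<circ> w) \<noteq> 0" if w: "w permutes {1..n}" and r: "r = s \<or> r = 1 / s" for r w
  proof -
    have "(z \<circ> w) a \<noteq> r * (z \<circ> w) b" if "(a, b) \<in> pairs n" for a b
    proof -
      have ab: "a \<in> {1..n}" "b \<in> {1..n}" "a \<noteq> b" using that by (auto simp: pairs_def)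
      then have "w a \<in> {1..n}" "w b \<in> {1..n}" using permutes_in_image[OF w] by blast+
      moreover have "w a \<noteq> w b" using permutes_inj[OF w] ab by (simp add: inj_eq)
      ultimately show ?thesis using nz nz' r by auto
    qed
    then show ?thesis by (auto simp: skew_prod_def)
  qed
  have "sym_fun (1 / s) n \<kappa> z * sym_fun s n \<mu> z =
    (\<Sum>w | w permutes {1..n}. sym_fun (1 / s) n \<kappa> z * ((inv_sign n w * skew_prod s n (z \<circ> w) / skew_prod s n z) * zpow n \<mu> (z \<circ> w)))"
    unfolding sym_fun_def[of s] sum_distrib_left
    by (rule sum.cong) (use pn in \<open>simp_all add: inv_sign_skew_prod\<close>)
  also have "\<dots> = (\<Sum>w | w permutes {1..n}. zpow n \<mu> (z \<circ> w) * sym_fun (1 / s) n \<kappa> (z \<circ> w))"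
  proof (rule sum.cong[OF refl])
    fix w assume "w \<in> {w. w permutes {1..n}}"
    then have w: "w permutes {1..n}" by simp
    have "skew_prod s n (z \<circ> w) / skew_prod s n z = skew_prod (1 / s) n z / skew_prod (1 / s) n (z \<circ> w)"
      using skew_prod_mult_permute[OF w s, of z] D[OF w] D[OF permutes_id, of s] D[OF permutes_id, of "1 / s"]
      by (simp add: field_simps)
    then have "inv_sign n w * skew_prod s n (z \<circ> w) / skew_prod s n z =
       inv_sign n w * skew_prod (1 / s) n z / skew_prod (1 / s) n (z \<circ> w)"
      by (metis times_divide_eq_right)
    then show "sym_fun (1 / s) n \<kappa> z * ((inv_sign n w * skew_prod s n (z \<circ> w) / skew_prod s n z) * zpow n \<mu> (z \<circ> w)) =
       zpow n \<mu> (z \<circ> w) * sym_fun (1 / s) n \<kappa> (z \<circ> w)"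
      using sym_fun_permute[OF w nz', where \<kappa> = \<kappa>] by simp
  qed
  finally show ?thesis .
qed

section \<open>Iterated integrals of rational functions\<close>

definition num_betw :: "(nat \<Rightarrow> nat) \<Rightarrow> nat \<Rightarrow> nat \<Rightarrow> nat \<Rightarrow> nat" where
  "num_betw pos k a b = card {i\<in>{1..k}. pos a < pos i \<and> pos i < pos b}"

text \<open>
  The variables \<open>z\<^sub>1, \<dots>, z\<^sub>k\<close> have been integrated over, and \<open>pos\<close> is a second ordering of the variables,
  in which all poles point downwards.  A pole \<open>z\<^sub>a = t\<^sup>m z\<^sub>b\<close> arises by pinching along a chain of
  integrated variables that lie between \<open>a\<close> and \<open>b\<close>, which bounds \<open>m\<close>; in particular \<open>m \<le> k + 1\<close>.
\<close>

inductive rat :: "complex \<Rightarrow> nat \<Rightarrow> (nat \<Rightarrow> nat) \<Rightarrow> nat \<Rightarrow> ((nat \<Rightarrow> complex) \<Rightarrow> complex) \<Rightarrow> bool"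
  for t n pos k where
  const: "rat t n pos k (\<lambda>z. c)"
| monom: "rat t n pos k f \<Longrightarrow> i \<in> {k<..n} \<Longrightarrow> rat t n pos k (\<lambda>z. f z * z i powi p)"
| edge: "\<lbrakk>rat t n pos k f; a \<in> {k<..n}; b \<in> {k<..n}; pos a < pos b; 1 \<le> m; m \<le> Suc (num_betw pos k a b)\<rbrakk>
     \<Longrightarrow> rat t n pos k (\<lambda>z. f z / (z a - t ^ m * z b))"
| add: "rat t n pos k f \<Longrightarrow> rat t n pos k g \<Longrightarrow> rat t n pos k (\<lambda>z. f z + g z)"

lemma rat_scale: "rat t n pos k f \<Longrightarrow> rat t n pos k (\<lambda>z. c * f z)"
proof (induction rule: rat.induct)
  case (monom f i p)
  from rat.monom[OF this(3,2), of p] show ?case by (simp add: mult.assoc)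
next
  case (edge f a b m)
  from rat.edge[OF edge(7,2-6)] show ?case by simp
next
  case (add f g)
  from rat.add[OF add(3,4)] show ?case by (simp add: distrib_left)
qed (rule rat.const)

text \<open>Only winding numbers around possible poles are prescribed, so that separating contours
  and circles both qualify. A pole \<open>z k = t ^ m * z j\<close> with
  \<open>pos k < pos j\<close> is enclosed, a pole \<open>z j = t ^ m * z k\<close> with
  \<open>pos j < pos k\<close> is excluded. Chains through the \<open>k - 1\<close> variables
  integrated before give \<open>m \<le> k\<close>.\<close>

definition adapted :: "complex \<Rightarrow> nat \<Rightarrow> (nat \<Rightarrow> nat) \<Rightarrow> nat \<Rightarrow> (real \<Rightarrow> complex) \<Rightarrow> (nat \<Rightarrow> complex) \<Rightarrow> bool" where
  "adapted t n pos k \<gamma> z \<longleftrightarrow>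
     valid_path \<gamma> \<and> pathfinish \<gamma> = pathstart \<gamma> \<and> 0 \<notin> path_image \<gamma> \<and> winding_number \<gamma> 0 = 1 \<and>
     (\<forall>j\<in>{k<..n}. z j \<noteq> 0 \<and> (\<forall>m\<in>{1..k}.
        (pos k < pos j \<longrightarrow> t ^ m * z j \<notin> path_image \<gamma> \<and> winding_number \<gamma> (t ^ m * z j) = 1) \<and>
        (pos j < pos k \<longrightarrow> z j / t ^ m \<notin> path_image \<gamma> \<and> winding_number \<gamma> (z j / t ^ m) = 0)))"

text \<open>All poles are enclosed, so the integral is determined at infinity, where two or more
  factors decay at least like \<open>1 / x^2\<close>.\<close>

lemma has_contour_integral_prod_inverse:
  assumes \<gamma>: "valid_path \<gamma>" "pathfinish \<gamma> = pathstart \<gamma>"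
    and "us \<noteq> []" "\<And>u. u \<in> set us \<Longrightarrow> u \<notin> path_image \<gamma> \<and> winding_number \<gamma> u = 1"
  shows "((\<lambda>x. \<Prod>u\<leftarrow>us. 1 / (x - u)) has_contour_integral (if length us = 1 then 2 * of_real pi * \<i> else 0)) \<gamma>"
  using assms(3,4)
proof (induction "length us" arbitrary: us rule: less_induct)
  case less
  obtain u0 rest where us: "us = u0 # rest" using less.prems by (cases us) auto
  have u0: "u0 \<notin> path_image \<gamma>" "winding_number \<gamma> u0 = 1" using less.prems us by auto
  show ?case
  proof (cases "rest = []")
    case True
    have "((\<lambda>w. 1 / (w - u0)) has_contour_integral 2 * of_real pi * \<i> * winding_number \<gamma> u0) \<gamma>"
      using has_contour_integral_winding_number[of \<gamma> u0] \<gamma> u0 by simp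
    then show ?thesis using u0 True us by simp
  next
    case rest: False
    show ?thesis
    proof (cases "\<forall>u\<in>set rest. u = u0")
      case True
      \<comment> \<open>If all poles coincide, the integrand is a power with exponent at most -2 and
        has a primitive.\<close>
      then have us_rep: "us = replicate (length us) u0"
        using us by (metis length_Cons replicate_Suc replicate_length_same)
      define N where "N = length us"
      have N: "N \<ge> 2" using us rest by (cases rest) (auto simp: N_def)
      have "((\<lambda>x. (x - u0) powi (- int N)) has_contour_integral 0) \<gamma>"
      proof -
        have "((\<lambda>x. (x - u0) powi (- int N)) has_contour_integral
           ((pathfinish \<gamma> - u0) powi (1 - int N) / of_int (1 - int N) - (pathstart \<gamma> - u0) powi (1 - int N) / of_int (1 - int N))) \<gamma>"
        proof (rule contour_integral_primitive[of "- {u0}"])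
          fix x assume "x \<in> - {u0}"
          then have "((\<lambda>w. (w - u0) powi (1 - int N)) has_field_derivative of_int (1 - int N) * (x - u0) powi (1 - int N - 1) * 1) (at x within - {u0})"
            by (intro DERIV_power_int) (auto intro!: derivative_eq_intros)
          then have "((\<lambda>w. (w - u0) powi (1 - int N) / of_int (1 - int N)) has_field_derivative of_int (1 - int N) * (x - u0) powi (1 - int N - 1) * 1 / of_int (1 - int N)) (at x within - {u0})"
            by (rule DERIV_cdivide)
          moreover have "(of_int (1 - int N) :: complex) \<noteq> 0" unfolding of_int_eq_0_iff using N by linarith
          ultimately show "((\<lambda>w. (w - u0) powi (1 - int N) / of_int (1 - int N)) has_field_derivative (x - u0) powi (- int N)) (at x within - {u0})"
            by simp
        qed (use \<gamma> u0 in auto)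
        with \<gamma> show ?thesis by simp
      qed
      moreover have "(\<Prod>u\<leftarrow>us. 1 / (x - u)) = (x - u0) powi (- int N)" for x
        by (subst us_rep) (simp add: N_def power_int_minus prod_list_replicate power_one_over power_inverse divide_inverse)
      ultimately show ?thesis using N by (simp add: N_def)
    next
      case False
      then obtain u1 where u1: "u1 \<in> set rest" "u1 \<noteq> u0" by auto
      then obtain xs ys where rest_eq: "rest = xs @ u1 # ys" by (meson split_list)
      have u1': "u1 \<notin> path_image \<gamma>" using less.prems u1 us by auto
      let ?h = "\<lambda>us x. \<Prod>u\<leftarrow>us. 1 / (x - u)"
      let ?c = "(if length (u0 # xs @ ys) = 1 then 2 * of_real pi * \<i> else 0) :: complex"
      have "(?h (u0 # xs @ ys) has_contour_integral ?c) \<gamma>"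
        by (rule less.hyps) (use less.prems us rest_eq in auto)
      moreover have "(?h (u1 # xs @ ys) has_contour_integral (if length (u1 # xs @ ys) = 1 then 2 * of_real pi * \<i> else 0)) \<gamma>"
        by (rule less.hyps) (use less.prems us rest_eq in auto)
      \<comment> \<open>By induction two lists of the same length have the same integral, so the
        difference given by partial fractions integrates to 0.\<close>
      ultimately have "((\<lambda>x. 1 / (u0 - u1) * (?h (u0 # xs @ ys) x - ?h (u1 # xs @ ys) x)) has_contour_integral 1 / (u0 - u1) * (?c - ?c)) \<gamma>"
        by (intro has_contour_integral_lmul has_contour_integral_diff) auto
      then have "(?h us has_contour_integral 1 / (u0 - u1) * (?c - ?c)) \<gamma>"
      proof (rule has_contour_integral_eq)
        fix x assume "x \<in> path_image \<gamma>"
        then have "x \<noteq> u0" "x \<noteq> u1" using u0 u1' by auto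
        then have frac: "1 / (u0 - u1) * (1 / (x - u0) - 1 / (x - u1)) = 1 / (x - u0) * (1 / (x - u1))"
          using u1 by (simp add: divide_simps)
        have "1 / (u0 - u1) * (?h (u0 # xs @ ys) x - ?h (u1 # xs @ ys) x) =
           (1 / (u0 - u1) * (1 / (x - u0) - 1 / (x - u1))) * ?h (xs @ ys) x"
          by (simp add: algebra_simps)
        also have "\<dots> = ?h us x" unfolding frac us rest_eq by simp
        finally show "1 / (u0 - u1) * (?h (u0 # xs @ ys) x - ?h (u1 # xs @ ys) x) = ?h us x" .
      qed
      then show ?thesis using rest us by simp
    qed
  qed
qed

text \<open>A chain from \<open>a\<close> to \<open>b\<close> through the newly integrated variable
  consists of two chains with disjoint sets of intermediate variables, and of \<open>Suc k\<close>
  itself.\<close>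

lemma num_betw_compose:
  assumes "pos a < pos (Suc k)" "pos (Suc k) < pos b"
  shows "Suc (num_betw pos k a (Suc k)) + num_betw pos k (Suc k) b \<le> num_betw pos (Suc k) a b"
proof -
  let ?A = "{i\<in>{1..k}. pos a < pos i \<and> pos i < pos (Suc k)}" and ?B = "{i\<in>{1..k}. pos (Suc k) < pos i \<and> pos i < pos b}"
  have "card (insert (Suc k) (?A \<union> ?B)) \<le> num_betw pos (Suc k) a b"
    unfolding num_betw_def by (rule card_mono) (use assms in auto)
  moreover have "card (insert (Suc k) (?A \<union> ?B)) = Suc (card (?A \<union> ?B))" by (rule card_insert_disjoint) auto
  moreover have "card (?A \<union> ?B) = card ?A + card ?B" by (rule card_Un_disjoint) auto
  ultimately show ?thesis by (simp add: num_betw_def)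
qed

lemma num_betw_mono: "num_betw pos k a b \<le> num_betw pos (Suc k) a b"
  unfolding num_betw_def by (rule card_mono) auto

lemma num_betw_le: "num_betw pos k a b \<le> k"
  unfolding num_betw_def by (rule order_trans[OF card_mono[of "{1..k}"]]) auto

text \<open>An entry \<open>(b, m)\<close> stands for the enclosed pole \<open>t ^ m * z b\<close>
  in the variable of index \<open>Suc k\<close>; an entry \<open>(a, m)\<close> of
  \<open>out_poles\<close> stands for the excluded pole \<open>z a / t ^ m\<close>.\<close>

definition in_poles :: "nat \<Rightarrow> (nat \<Rightarrow> nat) \<Rightarrow> nat \<Rightarrow> (nat \<times> nat) list \<Rightarrow> bool" where
  "in_poles n pos k us \<longleftrightarrow> (\<forall>(b, m)\<in>set us. b \<in> {Suc k<..n} \<and> pos (Suc k) < pos b \<and> 1 \<le> m \<and> m \<le> Suc (num_betw pos k (Suc k) b))"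

definition out_poles :: "nat \<Rightarrow> (nat \<Rightarrow> nat) \<Rightarrow> nat \<Rightarrow> (nat \<times> nat) list \<Rightarrow> bool" where
  "out_poles n pos k vs \<longleftrightarrow> (\<forall>(a, m)\<in>set vs. a \<in> {Suc k<..n} \<and> pos a < pos (Suc k) \<and> 1 \<le> m \<and> m \<le> Suc (num_betw pos k a (Suc k)))"

definition pole_term :: "complex \<Rightarrow> int \<Rightarrow> (nat \<times> nat) list \<Rightarrow> (nat \<times> nat) list \<Rightarrow> (nat \<Rightarrow> complex) \<Rightarrow> complex \<Rightarrow> complex" where
  "pole_term t p us vs z x = x powi p * (\<Prod>(b, m)\<leftarrow>us. 1 / (x - t ^ m * z b)) * (\<Prod>(a, m)\<leftarrow>vs. 1 / (z a / t ^ m - x))"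

text \<open>The same \<open>h\<close> serves for every adapted contour; this independence is what
  later allows one system of contours to be traded for another.\<close>

definition integrates :: "complex \<Rightarrow> nat \<Rightarrow> (nat \<Rightarrow> nat) \<Rightarrow> nat \<Rightarrow> ((nat \<Rightarrow> complex) \<Rightarrow> complex \<Rightarrow> complex) \<Rightarrow> bool" where
  "integrates t n pos k F \<longleftrightarrow> (\<exists>h. rat t n pos (Suc k) h \<and>
     (\<forall>\<gamma> z. adapted t n pos (Suc k) \<gamma> z \<longrightarrow> (F z has_contour_integral h z) \<gamma>))"

lemma integrates_cong:
  assumes "integrates t n pos k F"
    and "\<And>\<gamma> z x. adapted t n pos (Suc k) \<gamma> z \<Longrightarrow> x \<in> path_image \<gamma> \<Longrightarrow> F z x = G z x"
  shows "integrates t n pos k G"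
proof -
  obtain h where h: "rat t n pos (Suc k) h"
    "\<And>\<gamma> z. adapted t n pos (Suc k) \<gamma> z \<Longrightarrow> (F z has_contour_integral h z) \<gamma>"
    using assms(1) unfolding integrates_def by blast
  have "(G z has_contour_integral h z) \<gamma>" if "adapted t n pos (Suc k) \<gamma> z" for \<gamma> z
    by (rule has_contour_integral_eq[OF h(2)[OF that] assms(2)[OF that]])
  with h(1) show ?thesis unfolding integrates_def by blast
qed

lemma integrates_add:
  assumes "integrates t n pos k F" "integrates t n pos k G"
  shows "integrates t n pos k (\<lambda>z x. F z x + G z x)"
proof -
  obtain h where h: "rat t n pos (Suc k) h"
    "\<And>\<gamma> z. adapted t n pos (Suc k) \<gamma> z \<Longrightarrow> (F z has_contour_integral h z) \<gamma>"
    using assms(1) unfolding integrates_def by blast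
  obtain h' where h': "rat t n pos (Suc k) h'"
    "\<And>\<gamma> z. adapted t n pos (Suc k) \<gamma> z \<Longrightarrow> (G z has_contour_integral h' z) \<gamma>"
    using assms(2) unfolding integrates_def by blast
  show ?thesis unfolding integrates_def
    by (rule exI[of _ "\<lambda>z. h z + h' z"]) (simp add: h h' rat.add has_contour_integral_add)
qed

lemma integrates_scale:
  assumes "integrates t n pos k F" and g: "\<And>h. rat t n pos (Suc k) h \<Longrightarrow> rat t n pos (Suc k) (\<lambda>z. g z * h z)"
  shows "integrates t n pos k (\<lambda>z x. g z * F z x)"
proof -
  obtain h where h: "rat t n pos (Suc k) h"
    "\<And>\<gamma> z. adapted t n pos (Suc k) \<gamma> z \<Longrightarrow> (F z has_contour_integral h z) \<gamma>"
    using assms(1) unfolding integrates_def by blast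
  show ?thesis unfolding integrates_def
    by (rule exI[of _ "\<lambda>z. g z * h z"]) (simp add: h g has_contour_integral_lmul)
qed

lemma integrates_const:
  assumes "\<And>\<gamma> z. adapted t n pos (Suc k) \<gamma> z \<Longrightarrow> (F z has_contour_integral c) \<gamma>"
  shows "integrates t n pos k F"
  unfolding integrates_def by (rule exI[of _ "\<lambda>_. c"]) (auto intro: rat.const assms)

lemma integrates_powi: "integrates t n pos k (pole_term t p [] [])"
proof (cases "p = -1")
  case True
  show ?thesis
  proof (rule integrates_const)
    fix \<gamma> z assume "adapted t n pos (Suc k) \<gamma> z"
    then have "((\<lambda>w. 1 / (w - 0)) has_contour_integral 2 * of_real pi * \<i> * winding_number \<gamma> 0) \<gamma>"
      "winding_number \<gamma> 0 = 1"
      using has_contour_integral_winding_number[of \<gamma> 0] by (simp_all add: adapted_def)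
    moreover have "pole_term t p [] [] z = (\<lambda>w. 1 / (w - 0))"
      by (simp add: pole_term_def fun_eq_iff True power_int_minus divide_inverse)
    ultimately show "(pole_term t p [] [] z has_contour_integral 2 * of_real pi * \<i>) \<gamma>"
      by simp
  qed
next
  case False
  show ?thesis
  proof (rule integrates_const)
    fix \<gamma> z assume "adapted t n pos (Suc k) \<gamma> z"
    then have "((\<lambda>w. w powi p) has_contour_integral 0) \<gamma>"
      by (intro has_contour_integral_powi False) (auto simp: adapted_def)
    moreover have "pole_term t p [] [] z = (\<lambda>w. w powi p)" by (simp add: pole_term_def fun_eq_iff)
    ultimately show "(pole_term t p [] [] z has_contour_integral 0) \<gamma>" by simp
  qed
qed

lemma adapted_in_pole:
  assumes "adapted t n pos (Suc k) \<gamma> z" "in_poles n pos k us" "(b, m) \<in> set us"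
  shows "z b \<noteq> 0" "t ^ m * z b \<notin> path_image \<gamma>" "winding_number \<gamma> (t ^ m * z b) = 1"
proof -
  have b: "b \<in> {Suc k<..n}" "pos (Suc k) < pos b" "1 \<le> m" "m \<le> Suc (num_betw pos k (Suc k) b)"
    using assms(2,3) unfolding in_poles_def by auto
  have "m \<in> {1..Suc k}" using b num_betw_le[of pos k "Suc k" b] by auto
  with b assms(1) show "z b \<noteq> 0" "t ^ m * z b \<notin> path_image \<gamma>" "winding_number \<gamma> (t ^ m * z b) = 1"
    unfolding adapted_def by blast+
qed

lemma adapted_out_pole:
  assumes "adapted t n pos (Suc k) \<gamma> z" "out_poles n pos k vs" "(a, m) \<in> set vs"
  shows "z a \<noteq> 0" "z a / t ^ m \<notin> path_image \<gamma>" "winding_number \<gamma> (z a / t ^ m) = 0"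
proof -
  have a: "a \<in> {Suc k<..n}" "pos a < pos (Suc k)" "1 \<le> m" "m \<le> Suc (num_betw pos k a (Suc k))"
    using assms(2,3) unfolding out_poles_def by auto
  have "m \<in> {1..Suc k}" using a num_betw_le[of pos k a "Suc k"] by auto
  with a assms(1) show "z a \<noteq> 0" "z a / t ^ m \<notin> path_image \<gamma>" "winding_number \<gamma> (z a / t ^ m) = 0"
    unfolding adapted_def by blast+
qed

lemma rat_times_var:
  "rat t n pos k f \<Longrightarrow> i \<in> {k<..n} \<Longrightarrow> rat t n pos k (\<lambda>z. c * z i * f z)"
  "rat t n pos k f \<Longrightarrow> i \<in> {k<..n} \<Longrightarrow> rat t n pos k (\<lambda>z. c / z i * f z)"
  using rat_scale[OF rat.monom[of t n pos k f i 1], of c] rat_scale[OF rat.monom[of t n pos k f i "-1"], of c]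
  by (simp_all add: mult_ac power_int_minus divide_inverse)

lemma powi_Suc_eq: "(x :: complex) \<noteq> 0 \<Longrightarrow> x powi (p + 1) = x * x powi p"
  by (simp add: power_int_add)

text \<open>With only enclosed poles and exponent 0 the integral is a constant. For a pole
  \<open>u\<close> the power of \<open>x\<close> is raised by \<open>x = (x - u) + u\<close> and
  lowered by partial fractions of \<open>1 / (x (x - u))\<close>, each time with a remainder that
  has one pole less.\<close>

lemma integrates_in:
  assumes t: "t \<noteq> 0"
  shows "in_poles n pos k us \<Longrightarrow> integrates t n pos k (pole_term t p us [])"
proof (induction us arbitrary: p)
  case Nil
  show ?case by (rule integrates_powi)
next
  case (Cons u us)
  obtain b m where u: "u = (b, m)" by (cases u)
  have us: "in_poles n pos k us" and b: "b \<in> {Suc k<..n}" using Cons.prems u by (auto simp: in_poles_def)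
  have facts: "x \<noteq> t ^ m * z b" "x \<noteq> 0" "z b \<noteq> 0" "t ^ m \<noteq> 0"
    if "adapted t n pos (Suc k) \<gamma> z" "x \<in> path_image \<gamma>" for \<gamma> z x
    using adapted_in_pole[OF that(1) Cons.prems, of b m] that u t by (auto simp: adapted_def)
  have zero: "integrates t n pos k (pole_term t 0 (u # us) [])"
  proof (rule integrates_const)
    fix \<gamma> z assume ad: "adapted t n pos (Suc k) \<gamma> z"
    let ?ws = "map (\<lambda>(b, m). t ^ m * z b) (u # us)"
    have "((\<lambda>x. \<Prod>w\<leftarrow>?ws. 1 / (x - w)) has_contour_integral (if length ?ws = 1 then 2 * of_real pi * \<i> else 0)) \<gamma>"
    proof (rule has_contour_integral_prod_inverse)
      fix w assume "w \<in> set ?ws"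
      then obtain p where p: "p \<in> set (u # us)" "w = (\<lambda>(b, m). t ^ m * z b) p" unfolding set_map by blast
      obtain b m where "p = (b, m)" by (cases p)
      with p have "(b, m) \<in> set (u # us)" "w = t ^ m * z b" by auto
      then show "w \<notin> path_image \<gamma> \<and> winding_number \<gamma> w = 1" using adapted_in_pole[OF ad Cons.prems, of b m] by simp
    qed (use ad in \<open>auto simp: adapted_def\<close>)
    moreover have "(\<Prod>w\<leftarrow>?ws. 1 / (x - w)) = pole_term t 0 (u # us) [] z x" for x
      by (simp add: pole_term_def o_def case_prod_unfold)
    ultimately show "(pole_term t 0 (u # us) [] z has_contour_integral (if length (u # us) = 1 then 2 * of_real pi * \<i> else 0)) \<gamma>"
      by (simp add: fun_eq_iff[symmetric])
  qed
  have up: "integrates t n pos k (pole_term t (int r) (u # us) [])" for r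
  proof (induction r)
    case 0
    then show ?case using zero by simp
  next
    case (Suc r)
    have "integrates t n pos k (\<lambda>z x. pole_term t (int r) us [] z x + t ^ m * z b * pole_term t (int r) (u # us) [] z x)"
      by (intro integrates_add Cons.IH[OF us] integrates_scale[OF Suc] rat_times_var(1)) (use b in auto)
    then show ?case
    proof (rule integrates_cong)
      fix \<gamma> z x assume "adapted t n pos (Suc k) \<gamma> z" "x \<in> path_image \<gamma>"
      note f = facts[OF this]
      have "x powi (int (Suc r)) = x * x powi int r" using powi_Suc_eq[OF f(2), of "int r"] by (simp add: add.commute)
      then show "pole_term t (int r) us [] z x + t ^ m * z b * pole_term t (int r) (u # us) [] z x = pole_term t (int (Suc r)) (u # us) [] z x"
        using f by (simp add: pole_term_def u field_simps del: power_int_of_nat of_nat_Suc)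
    qed
  qed
  have down: "integrates t n pos k (pole_term t (- int r) (u # us) [])" for r
  proof (induction r)
    case 0
    then show ?case using zero by simp
  next
    case (Suc r)
    have "integrates t n pos k (\<lambda>z x. 1 / t ^ m / z b * (pole_term t (- int r) (u # us) [] z x + (-1) * pole_term t (- int (Suc r)) us [] z x))"
      by (intro integrates_scale integrates_add Cons.IH[OF us] Suc rat_times_var(2) rat_scale) (use b in auto)
    then show ?case
    proof (rule integrates_cong)
      fix \<gamma> z x assume "adapted t n pos (Suc k) \<gamma> z" "x \<in> path_image \<gamma>"
      note f = facts[OF this]
      have "x powi (- int r) = x * x powi (- int (Suc r))" using powi_Suc_eq[OF f(2), of "- int (Suc r)"] by simp
      then show "1 / t ^ m / z b * (pole_term t (- int r) (u # us) [] z x + (-1) * pole_term t (- int (Suc r)) us [] z x) = pole_term t (- int (Suc r)) (u # us) [] z x"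
        using f by (simp add: pole_term_def u field_simps del: power_int_of_nat of_nat_Suc power_int_minus)
    qed
  qed
  show ?case using up[of "nat p"] down[of "nat (- p)"] by (cases "p \<ge> 0") auto
qed

text \<open>With only excluded poles and a nonnegative power of \<open>x\<close> nothing is
  enclosed, so Cauchy's theorem gives 0; negative powers reduce to this case and to shorter lists by
  splitting off the pole at 0.\<close>

lemma integrates_out:
  assumes t: "t \<noteq> 0"
  shows "out_poles n pos k vs \<Longrightarrow> integrates t n pos k (pole_term t p [] vs)"
proof (induction vs arbitrary: p)
  case Nil
  show ?case by (rule integrates_powi)
next
  case (Cons v vs)
  obtain a m where v: "v = (a, m)" by (cases v)
  have vs: "out_poles n pos k vs" and a: "a \<in> {Suc k<..n}" using Cons.prems v by (auto simp: out_poles_def)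
  have facts: "x \<noteq> z a / t ^ m" "x \<noteq> 0" "z a \<noteq> 0" "t ^ m \<noteq> 0"
    if "adapted t n pos (Suc k) \<gamma> z" "x \<in> path_image \<gamma>" for \<gamma> z x
    using adapted_out_pole[OF that(1) Cons.prems, of a m] that v t by (auto simp: adapted_def)
  have up: "integrates t n pos k (pole_term t (int r) [] (v # vs))" for r
  proof (rule integrates_const)
    fix \<gamma> z assume ad: "adapted t n pos (Suc k) \<gamma> z"
    let ?W = "set (map (\<lambda>(a, m). z a / t ^ m) (v # vs))"
    have hol: "pole_term t (int r) [] qs z holomorphic_on (- ?W)" if "set qs \<subseteq> set (v # vs)" for qs
      using that
    proof (induction qs)
      case Nil
      then show ?case by (auto simp: pole_term_def[abs_def] intro!: holomorphic_intros)
    next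
      case (Cons q qs)
      have "(\<lambda>x. pole_term t (int r) [] qs z x * (1 / (z (fst q) / t ^ snd q - x))) holomorphic_on (- ?W)"
        using Cons by (intro holomorphic_intros) (auto simp: case_prod_unfold)
      then show ?case by (simp add: pole_term_def[abs_def] case_prod_unfold mult_ac)
    qed
    have W: "w \<notin> path_image \<gamma> \<and> winding_number \<gamma> w = 0" if "w \<in> ?W" for w
    proof -
      from that obtain p where p: "p \<in> set (v # vs)" "w = (\<lambda>(a, m). z a / t ^ m) p" unfolding set_map by blast
      obtain a m where "p = (a, m)" by (cases p)
      with p have "(a, m) \<in> set (v # vs)" "w = z a / t ^ m" by auto
      then show ?thesis using adapted_out_pole[OF ad Cons.prems, of a m] by simp
    qed
    show "(pole_term t (int r) [] (v # vs) z has_contour_integral 0) \<gamma>"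
    proof (rule Cauchy_theorem_global[OF _ hol])
      show "open (- ?W)" by (intro open_Compl finite_imp_closed) auto
      show "path_image \<gamma> \<subseteq> - ?W" using W by blast
      show "\<And>w. w \<notin> - ?W \<Longrightarrow> winding_number \<gamma> w = 0" using W by blast
    qed (use ad in \<open>auto simp: adapted_def\<close>)
  qed
  have down: "integrates t n pos k (pole_term t (- int r) [] (v # vs))" for r
  proof (induction r)
    case 0
    then show ?case using up[of 0] by simp
  next
    case (Suc r)
    have "integrates t n pos k (\<lambda>z x. t ^ m / z a * (pole_term t (- int r) [] (v # vs) z x + pole_term t (- int (Suc r)) [] vs z x))"
      by (intro integrates_scale integrates_add Cons.IH[OF vs] Suc rat_times_var(2)) (use a in auto)
    then show ?case
    proof (rule integrates_cong)
      fix \<gamma> z x assume "adapted t n pos (Suc k) \<gamma> z" "x \<in> path_image \<gamma>"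
      note f = facts[OF this]
      have "x powi (- int r) = x * x powi (- int (Suc r))" using powi_Suc_eq[OF f(2), of "- int (Suc r)"] by simp
      moreover have "z a - x * t ^ m \<noteq> 0" using f by (auto simp: field_simps)
      ultimately show "t ^ m / z a * (pole_term t (- int r) [] (v # vs) z x + pole_term t (- int (Suc r)) [] vs z x) = pole_term t (- int (Suc r)) [] (v # vs) z x"
        using f by (simp add: pole_term_def v field_simps del: power_int_of_nat of_nat_Suc power_int_minus)
    qed
  qed
  show ?case using up[of "nat p"] down[of "nat (- p)"] by (cases "p \<ge> 0") auto
qed

text \<open>Partial fractions for an enclosed pole \<open>u\<close> and an excluded pole
  \<open>v\<close> produce the factor \<open>1 / (v - u)\<close>, singular where the two pinch the
  contour. For \<open>u = t ^ m * z b\<close> and \<open>v = z a / t ^ m'\<close> this is an edge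
  from \<open>a\<close> to \<open>b\<close> with exponent \<open>m + m'\<close>.\<close>

lemma integrates_pole_term:
  assumes t: "t \<noteq> 0"
  shows "in_poles n pos k us \<Longrightarrow> out_poles n pos k vs \<Longrightarrow> integrates t n pos k (pole_term t p us vs)"
proof (induction "length us + length vs" arbitrary: us vs rule: less_induct)
  case less
  show ?case
  proof (cases "us = [] \<or> vs = []")
    case True
    then show ?thesis using integrates_in[OF t] integrates_out[OF t] less.prems by auto
  next
    case False
    obtain b m us' where us: "us = (b, m) # us'" using False by (cases us) auto
    obtain a m' vs' where vs: "vs = (a, m') # vs'" using False by (cases vs) auto
    have prems: "in_poles n pos k us'" "out_poles n pos k vs'" using less.prems us vs by (auto simp: in_poles_def out_poles_def)
    have b: "b \<in> {Suc k<..n}" "pos (Suc k) < pos b" "1 \<le> m" "m \<le> Suc (num_betw pos k (Suc k) b)"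
      using less.prems(1) us by (auto simp: in_poles_def)
    have a: "a \<in> {Suc k<..n}" "pos a < pos (Suc k)" "1 \<le> m'" "m' \<le> Suc (num_betw pos k a (Suc k))"
      using less.prems(2) vs by (auto simp: out_poles_def)
    let ?g = "\<lambda>z. t ^ m' / (z a - t ^ (m + m') * z b)"
    have rat_g: "rat t n pos (Suc k) (\<lambda>z. ?g z * h z)" if "rat t n pos (Suc k) h" for h
    proof -
      have "rat t n pos (Suc k) (\<lambda>z. t ^ m' * h z / (z a - t ^ (m + m') * z b))"
        by (rule rat.edge[OF rat_scale[OF that]]) (use a b num_betw_compose[of pos a k b] in auto)
      then show ?thesis by simp
    qed
    have "integrates t n pos k (\<lambda>z x. ?g z * (pole_term t p us vs' z x + pole_term t p us' vs z x))"
      by (intro integrates_scale integrates_add less.hyps rat_g) (use less.prems prems us vs in auto)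
    then show ?thesis
    proof (rule integrates_cong)
      fix \<gamma> z x assume ad: "adapted t n pos (Suc k) \<gamma> z" and x: "x \<in> path_image \<gamma>"
      let ?u = "t ^ m * z b" and ?v = "z a / t ^ m'"
      have u: "?u \<notin> path_image \<gamma>" "winding_number \<gamma> ?u = 1" using adapted_in_pole[OF ad less.prems(1), of b m] us by auto
      have v: "?v \<notin> path_image \<gamma>" "winding_number \<gamma> ?v = 0" using adapted_out_pole[OF ad less.prems(2), of a m'] vs by auto
      \<comment> \<open>\<open>?u\<close> and \<open>?v\<close> are distinct because their winding
        numbers are 1 and 0.\<close>
      have ne: "x - ?u \<noteq> 0" "?v - x \<noteq> 0" "?v - ?u \<noteq> 0" using u v x by (auto simp del: eq_divide_eq_1)
      have g: "?g z = 1 / (?v - ?u)" using t by (simp add: field_simps power_add)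
      have frac: "1 / (?v - ?u) * (1 / (x - ?u) + 1 / (?v - x)) = 1 / (x - ?u) * (1 / (?v - x))"
      proof -
        have *: "1 / (v - u) * (1 / (x - u) + 1 / (v - x)) = 1 / (x - u) * (1 / (v - x))"
          if "x - u \<noteq> 0" "v - x \<noteq> 0" "v - u \<noteq> 0" for u v :: complex
          using that by (simp add: divide_simps)
        show ?thesis by (rule *[OF ne])
      qed
      let ?r = "x powi p * (\<Prod>(b, m)\<leftarrow>us'. 1 / (x - t ^ m * z b)) * (\<Prod>(a, m)\<leftarrow>vs'. 1 / (z a / t ^ m - x))"
      have "?g z * (pole_term t p us vs' z x + pole_term t p us' vs z x) = (1 / (?v - ?u) * (1 / (x - ?u) + 1 / (?v - x))) * ?r"
        unfolding g us vs pole_term_def by (simp add: algebra_simps)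
      also have "\<dots> = pole_term t p us vs z x"
        unfolding frac us vs pole_term_def by simp
      finally show "?g z * (pole_term t p us vs' z x + pole_term t p us' vs z x) = pole_term t p us vs z x" .
    qed
  qed
qed

text \<open>The induction over \<open>rat\<close> moves every factor that contains the variable
  \<open>Suc k\<close> into \<open>pole_term\<close> and pulls the others out of the integral;
  therefore the pole lists and the power are general.\<close>

lemma integrates_rat_pole_term:
  assumes t: "t \<noteq> 0" and "rat t n pos k f"
    and "in_poles n pos k us" "out_poles n pos k vs"
  shows "integrates t n pos k (\<lambda>z x. f (z(Suc k := x)) * pole_term t p us vs z x)"
  using assms(2-)
proof (induction arbitrary: us vs p rule: rat.induct)
  case (const c)
  then show ?case by (intro integrates_scale integrates_pole_term[OF t] rat_scale)
next
  case (monom f i q)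
  show ?case
  proof (cases "i = Suc k")
    case True
    have "integrates t n pos k (\<lambda>z x. f (z(Suc k := x)) * pole_term t (p + q) us vs z x)"
      by (rule monom.IH[OF monom.prems])
    then show ?thesis
    proof (rule integrates_cong)
      fix \<gamma> z x assume "adapted t n pos (Suc k) \<gamma> z" "x \<in> path_image \<gamma>"
      then have "x \<noteq> 0" by (auto simp: adapted_def)
      then have "x powi (p + q) = x powi p * x powi q" by (simp add: power_int_add)
      then show "f (z(Suc k := x)) * pole_term t (p + q) us vs z x =
        f (z(Suc k := x)) * (z(Suc k := x)) i powi q * pole_term t p us vs z x"
        by (simp only: True pole_term_def fun_upd_same mult_ac)
    qed
  next
    case False
    have "integrates t n pos k (\<lambda>z x. z i powi q * (f (z(Suc k := x)) * pole_term t p us vs z x))"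
    proof (rule integrates_scale[OF monom.IH[OF monom.prems]])
      fix h assume "rat t n pos (Suc k) h"
      then have "rat t n pos (Suc k) (\<lambda>z. h z * z i powi q)" by (rule rat.monom) (use False monom.hyps in auto)
      then show "rat t n pos (Suc k) (\<lambda>z. z i powi q * h z)" by (simp add: mult.commute)
    qed
    then show ?thesis by (rule integrates_cong) (use False in \<open>simp add: fun_upd_def\<close>)
  qed
next
  case (edge f a b m)
  consider "a = Suc k" | "b = Suc k" | "a \<noteq> Suc k" "b \<noteq> Suc k" by blast
  then show ?case
  proof cases
    case 1
    then have b: "b \<noteq> Suc k" using edge.hyps by auto
    have "integrates t n pos k (\<lambda>z x. f (z(Suc k := x)) * pole_term t p ((b, m) # us) vs z x)"
      by (rule edge.IH[OF _ edge.prems(2)]) (use edge.hyps edge.prems 1 b in \<open>auto simp: in_poles_def\<close>)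
    then show ?thesis by (rule integrates_cong) (use 1 b in \<open>simp add: pole_term_def fun_upd_def\<close>)
  next
    case 2
    then have a: "a \<noteq> Suc k" using edge.hyps by auto
    \<comment> \<open>Seen from its end \<open>b\<close>, the edge is the excluded pole
      \<open>z a / t ^ m\<close>, up to the constant \<open>t ^ m\<close>.\<close>
    have "integrates t n pos k (\<lambda>z x. 1 / t ^ m * (f (z(Suc k := x)) * pole_term t p us ((a, m) # vs) z x))"
      by (rule integrates_scale[OF edge.IH[OF edge.prems(1)] rat_scale]) (use edge.hyps edge.prems 2 a in \<open>auto simp: out_poles_def\<close>)
    moreover have "1 / t ^ m * (1 / (z a / t ^ m - x)) = 1 / (z a - t ^ m * x)" for z :: "nat \<Rightarrow> complex" and x
      using t by (simp add: divide_simps)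
    then have "1 / t ^ m * (f (z(Suc k := x)) * pole_term t p us ((a, m) # vs) z x) =
        f (z(Suc k := x)) / ((z(Suc k := x)) a - t ^ m * (z(Suc k := x)) b) * pole_term t p us vs z x" for z x
    proof -
      have "1 / t ^ m * (f (z(Suc k := x)) * pole_term t p us ((a, m) # vs) z x) =
        (1 / t ^ m * (1 / (z a / t ^ m - x))) * (f (z(Suc k := x)) * pole_term t p us vs z x)"
        by (simp add: pole_term_def mult_ac)
      also have "\<dots> = 1 / (z a - t ^ m * x) * (f (z(Suc k := x)) * pole_term t p us vs z x)"
        by (simp only: \<open>\<And>z x. 1 / t ^ m * (1 / (z a / t ^ m - x)) = 1 / (z a - t ^ m * x)\<close>)
      finally show ?thesis using 2 a by simp
    qed
    ultimately show ?thesis by (simp only:)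
  next
    case 3
    have "integrates t n pos k (\<lambda>z x. 1 / (z a - t ^ m * z b) * (f (z(Suc k := x)) * pole_term t p us vs z x))"
    proof (rule integrates_scale[OF edge.IH[OF edge.prems]])
      fix h assume "rat t n pos (Suc k) h"
      then have "rat t n pos (Suc k) (\<lambda>z. h z / (z a - t ^ m * z b))"
        by (rule rat.edge) (use 3 edge.hyps num_betw_mono[of pos k a b] in auto)
      then show "rat t n pos (Suc k) (\<lambda>z. 1 / (z a - t ^ m * z b) * h z)" by simp
    qed
    then show ?thesis by (rule integrates_cong) (use 3 in \<open>simp add: fun_upd_def\<close>)
  qed
next
  case (add f g)
  from integrates_add[OF add.IH(1)[OF add.prems, of p] add.IH(2)[OF add.prems, of p]]
  show ?case by (simp add: distrib_right)
qed

lemma rat_integral: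
  assumes "t \<noteq> 0" "rat t n pos k f"
  shows "\<exists>h. rat t n pos (Suc k) h \<and> (\<forall>\<gamma> z. adapted t n pos (Suc k) \<gamma> z \<longrightarrow>
    ((\<lambda>x. f (z(Suc k := x)) / x) has_contour_integral h z) \<gamma>)"
proof -
  have "integrates t n pos k (\<lambda>z x. f (z(Suc k := x)) * pole_term t (-1) [] [] z x)"
    by (rule integrates_rat_pole_term[OF assms]) (auto simp: in_poles_def out_poles_def)
  moreover have "(\<lambda>z x. f (z(Suc k := x)) * pole_term t (-1) [] [] z x) = (\<lambda>z x. f (z(Suc k := x)) / x)"
    by (simp add: fun_eq_iff pole_term_def power_int_minus divide_inverse)
  ultimately have "integrates t n pos k (\<lambda>z x. f (z(Suc k := x)) / x)" by simp
  then show ?thesis unfolding integrates_def .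
qed

section \<open>Iterated integrals along systems of contours\<close>

definition adapted_system :: "complex \<Rightarrow> nat \<Rightarrow> (nat \<Rightarrow> nat) \<Rightarrow> (nat \<Rightarrow> (nat \<Rightarrow> complex) \<Rightarrow> real \<Rightarrow> complex) \<Rightarrow> bool" where
  "adapted_system t n pos C \<longleftrightarrow>
     (\<forall>k\<in>{1..n}. \<forall>z z'. (\<forall>j\<in>{k<..n}. z j = z' j) \<longrightarrow> C k z = C k z') \<and>
     (\<forall>k\<in>{1..n}. \<forall>z. (\<forall>j\<in>{k<..n}. z j \<in> path_image (C j z)) \<longrightarrow> adapted t n pos k (C k z) z)"

text \<open>The functions \<open>H k\<close> are fixed before any contour is chosen, so they compute
  the iterated integrals along all adapted systems at once.\<close>

lemma rat_integral_sequence: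
  assumes "t \<noteq> 0" "rat t n pos 0 f"
  shows "\<exists>H. H 0 = f \<and> (\<forall>k. rat t n pos k (H k)) \<and>
    (\<forall>k \<gamma> z. adapted t n pos (Suc k) \<gamma> z \<longrightarrow> ((\<lambda>x. H k (z(Suc k := x)) / x) has_contour_integral H (Suc k) z) \<gamma>)"
proof -
  have "\<exists>H. \<forall>k. (rat t n pos k (H k) \<and> (k = 0 \<longrightarrow> H k = f)) \<and>
    (\<forall>\<gamma> z. adapted t n pos (Suc k) \<gamma> z \<longrightarrow> ((\<lambda>x. H k (z(Suc k := x)) / x) has_contour_integral H (Suc k) z) \<gamma>)"
  proof (rule dependent_nat_choice)
    show "\<exists>x. rat t n pos 0 x \<and> (0 = 0 \<longrightarrow> x = f)" using assms(2) by auto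
    fix g k assume "rat t n pos k g \<and> (k = 0 \<longrightarrow> g = f)"
    then show "\<exists>h. (rat t n pos (Suc k) h \<and> (Suc k = 0 \<longrightarrow> h = f)) \<and>
       (\<forall>\<gamma> z. adapted t n pos (Suc k) \<gamma> z \<longrightarrow> ((\<lambda>x. g (z(Suc k := x)) / x) has_contour_integral h z) \<gamma>)"
      using rat_integral[OF assms(1), of n pos k g] by simp
  qed
  then obtain H where H: "\<forall>k. (rat t n pos k (H k) \<and> (k = 0 \<longrightarrow> H k = f)) \<and>
    (\<forall>\<gamma> z. adapted t n pos (Suc k) \<gamma> z \<longrightarrow> ((\<lambda>x. H k (z(Suc k := x)) / x) has_contour_integral H (Suc k) z) \<gamma>)"
    by blast
  show ?thesis by (rule exI[of _ H]) (use H in simp)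
qed

text \<open>Agreement of \<open>F\<close> with the sum is demanded only on the contours, since the
  decomposition of the integrand is available only off its poles. Each summand has its own ordering
  \<open>pos i\<close>.\<close>

lemma iterated_integral_sum_sequence:
  assumes "finite I"
    and C: "\<And>i. i \<in> I \<Longrightarrow> adapted_system t n (pos i) C"
    and dep: "\<forall>k\<in>{1..n}. \<forall>z z'. (\<forall>j\<in>{k<..n}. z j = z' j) \<longrightarrow> C k z = C k z'"
    and F: "\<And>z. \<forall>j\<in>{1..n}. z j \<in> path_image (C j z) \<Longrightarrow> F z = (\<Sum>i\<in>I. H i 0 z)"
    and H: "\<And>i k \<gamma> z. i \<in> I \<Longrightarrow> adapted t n (pos i) (Suc k) \<gamma> z \<Longrightarrow>
       ((\<lambda>x. H i k (z(Suc k := x)) / x) has_contour_integral H i (Suc k) z) \<gamma>"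
    and "m \<le> n" "\<forall>j\<in>{m<..n}. z j \<in> path_image (C j z)"
  shows "iterated_integral C F m z = (\<Sum>i\<in>I. H i m z)"
  using assms(6,7)
proof (induction m arbitrary: z)
  case 0
  then have "\<forall>j\<in>{1..n}. z j \<in> path_image (C j z)" by auto
  then show ?case using F by simp
next
  case (Suc m)
  have "((\<lambda>x. \<Sum>i\<in>I. H i m (z(Suc m := x)) / x) has_contour_integral (\<Sum>i\<in>I. H i (Suc m) z)) (C (Suc m) z)"
  proof (rule has_contour_integral_sum[OF \<open>finite I\<close> H])
    fix i assume "i \<in> I"
    then show "adapted t n (pos i) (Suc m) (C (Suc m) z) z"
      using C[OF \<open>i \<in> I\<close>] Suc.prems unfolding adapted_system_def by auto
  qed
  moreover have "iterated_integral C F m (z(Suc m := x)) / x = (\<Sum>i\<in>I. H i m (z(Suc m := x)) / x)"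
    if x: "x \<in> path_image (C (Suc m) z)" for x
  proof -
    let ?z = "z(Suc m := x)"
    \<comment> \<open>The contours of the outer variables do not depend on the variable just
      inserted.\<close>
    have Ceq: "C j ?z = C j z" if "j \<in> {m<..n}" for j
      by (rule dep[rule_format]) (use that in auto)
    have "?z j \<in> path_image (C j ?z)" if j: "j \<in> {m<..n}" for j
      using Suc.prems x j by (cases "j = Suc m") (auto simp: Ceq)
    then have "\<forall>j\<in>{m<..n}. ?z j \<in> path_image (C j ?z)" by blast
    moreover have "m \<le> n" using Suc.prems by simp
    ultimately have "iterated_integral C F m ?z = (\<Sum>i\<in>I. H i m ?z)" by (intro Suc.IH)
    then show ?thesis by (simp only: sum_divide_distrib)
  qed
  ultimately have "((\<lambda>x. iterated_integral C F m (z(Suc m := x)) / x) has_contour_integral (\<Sum>i\<in>I. H i (Suc m) z)) (C (Suc m) z)"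
    by (auto elim: has_contour_integral_eq)
  then show ?case by (simp add: contour_integral_unique)
qed

text \<open>
  Any two adapted systems of contours give the same value, so each summand may be integrated over
  circles of its own.
\<close>

lemma iterated_integral_sum:
  assumes t: "t \<noteq> 0" and I: "finite I"
    and C: "\<And>i. i \<in> I \<Longrightarrow> adapted_system t n (pos i) C"
    and dep: "\<forall>k\<in>{1..n}. \<forall>z z'. (\<forall>j\<in>{k<..n}. z j = z' j) \<longrightarrow> C k z = C k z'"
    and C': "\<And>i. i \<in> I \<Longrightarrow> adapted_system t n (pos i) (C' i)"
    and F: "\<And>z. \<forall>j\<in>{1..n}. z j \<in> path_image (C j z) \<Longrightarrow> F z = (\<Sum>i\<in>I. f i z)"
    and f: "\<And>i. i \<in> I \<Longrightarrow> rat t n (pos i) 0 (f i)"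
  shows "iterated_integral C F n z = (\<Sum>i\<in>I. iterated_integral (C' i) (f i) n z)"
proof -
  have "\<forall>i. \<exists>H. i \<in> I \<longrightarrow> H 0 = f i \<and> (\<forall>k. rat t n (pos i) k (H k)) \<and>
    (\<forall>k \<gamma> z. adapted t n (pos i) (Suc k) \<gamma> z \<longrightarrow> ((\<lambda>x. H k (z(Suc k := x)) / x) has_contour_integral H (Suc k) z) \<gamma>)"
  proof (intro allI)
    fix i
    show "\<exists>H. i \<in> I \<longrightarrow> H 0 = f i \<and> (\<forall>k. rat t n (pos i) k (H k)) \<and>
      (\<forall>k \<gamma> z. adapted t n (pos i) (Suc k) \<gamma> z \<longrightarrow> ((\<lambda>x. H k (z(Suc k := x)) / x) has_contour_integral H (Suc k) z) \<gamma>)"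
    proof (cases "i \<in> I")
      case True
      show ?thesis using rat_integral_sequence[OF t f[OF True]] by simp
    qed auto
  qed
  from choice[OF this] obtain H where H0: "\<forall>i. i \<in> I \<longrightarrow> H i 0 = f i \<and> (\<forall>k. rat t n (pos i) k (H i k)) \<and>
      (\<forall>k \<gamma> z. adapted t n (pos i) (Suc k) \<gamma> z \<longrightarrow> ((\<lambda>x. H i k (z(Suc k := x)) / x) has_contour_integral H i (Suc k) z) \<gamma>)"
    by blast
  have H: "\<And>i. i \<in> I \<Longrightarrow> H i 0 = f i" "\<And>i k. i \<in> I \<Longrightarrow> rat t n (pos i) k (H i k)"
    "\<And>i k \<gamma> z. i \<in> I \<Longrightarrow> adapted t n (pos i) (Suc k) \<gamma> z \<Longrightarrow> ((\<lambda>x. H i k (z(Suc k := x)) / x) has_contour_integral H i (Suc k) z) \<gamma>"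
    using H0 by simp_all
  have "iterated_integral C F n z = (\<Sum>i\<in>I. H i n z)"
    by (rule iterated_integral_sum_sequence[where pos = pos and t = t, OF I C dep _ H(3)]) (use F H(1) in auto)
  moreover have "iterated_integral (C' i) (f i) n z = H i n z" if i: "i \<in> I" for i
  proof -
    have "iterated_integral (C' i) (f i) n z = (\<Sum>j\<in>{i}. H j n z)"
    proof (rule iterated_integral_sum_sequence[where pos = pos and t = t])
      show "adapted_system t n (pos j) (C' i)" if "j \<in> {i}" for j using that C'[OF i] by simp
      show "\<forall>k\<in>{1..n}. \<forall>z z'. (\<forall>j\<in>{k<..n}. z j = z' j) \<longrightarrow> C' i k z = C' i k z'"
        using C'[OF i] unfolding adapted_system_def by blast
      show "f i z = (\<Sum>j\<in>{i}. H j 0 z)" for z using H(1)[OF i] by simp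
      show "((\<lambda>x. H j k (z(Suc k := x)) / x) has_contour_integral H j (Suc k) z) \<gamma>"
        if "j \<in> {i}" "adapted t n (pos j) (Suc k) \<gamma> z" for j k \<gamma> z
        by (rule H(3)) (use that i in auto)
    qed auto
    then show ?thesis by simp
  qed
  ultimately show ?thesis by simp
qed

section \<open>Admissible contours\<close>

lemma contour_winding_inside:
  assumes "contour \<gamma>" "z \<in> inside (path_image \<gamma>)"
  shows "winding_number \<gamma> z = 1" "z \<notin> path_image \<gamma>"
proof -
  have s: "simple_path \<gamma>" "0 \<in> inside (path_image \<gamma>)" "winding_number \<gamma> 0 = 1"
    using assms(1) by (auto simp: contour_def)
  show "winding_number \<gamma> z = 1"
    by (rule simple_closed_path_winding_number_inside[OF s(1)]) (use s assms(2) in fastforce)+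
  show "z \<notin> path_image \<gamma>" using assms(2) by (simp add: inside_def)
qed

lemma contour_winding_outside:
  assumes "contour \<gamma>" "z \<in> outside (path_image \<gamma>)"
  shows "winding_number \<gamma> z = 0" "z \<notin> path_image \<gamma>"
  using assms winding_number_zero_in_outside[of \<gamma> z]
  by (auto simp: contour_def valid_path_imp_path outside_def)

text \<open>All points \<open>z j / q^(2*m)\<close> are enclosed and all
  \<open>q^(2*m) * z j\<close> are excluded, whatever the ordering; with \<open>t = 1 / q^2\<close>
  these are both kinds of points that \<open>adapted\<close> may ask for.\<close>

lemma nested_adapted_system:
  assumes "nested_contours q n C" "q \<noteq> 0"
  shows "adapted_system (1 / q^2) n pos C"
  unfolding adapted_system_def
proof (intro conjI ballI allI impI)
  show "C k z = C k z'" if "k \<in> {1..n}" "\<forall>j\<in>{k<..n}. z j = z' j" for k z z'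
    using assms(1) that unfolding nested_contours_def by blast
next
  fix k z assume k: "k \<in> {1..n}" and z: "\<forall>j\<in>{k<..n}. z j \<in> path_image (C j z)"
  have con: "contour (C l z)" if "l \<in> {1..n}" "\<forall>j\<in>{l<..n}. z j \<in> path_image (C j z)" for l
    using assms(1) that unfolding nested_contours_def by blast
  have c: "contour (C k z)" by (rule con[OF k z])
  have zero: "0 \<in> inside (path_image (C k z))" using c by (simp add: contour_def)
  have nz: "z j \<noteq> 0" if j: "j \<in> {k<..n}" for j
  proof
    assume "z j = 0"
    moreover have "contour (C j z)" using con[of j] z j k by auto
    ultimately have "z j \<notin> path_image (C j z)" by (auto simp: contour_def inside_def)
    then show False using z j by blast
  qed
  have io: "z j / q^(2*m) \<in> inside (path_image (C k z))" "q^(2*m) * z j \<in> outside (path_image (C k z))"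
    if "j \<in> {k<..n}" "m \<in> {1..k}" for j m
    using assms(1) k z that unfolding nested_contours_def by blast+
  have pw: "(1 / q^2) ^ m * x = x / q^(2*m)" "x / (1 / q^2) ^ m = q^(2*m) * x" for m x
    using assms(2) by (simp_all add: power_mult power_one_over)
  show "adapted (1 / q^2) n pos k (C k z) z"
    unfolding adapted_def pw
    using c nz contour_winding_inside[OF c zero] contour_winding_inside[OF c io(1)] contour_winding_outside[OF c io(2)]
    by (auto simp: contour_def)
qed

text \<open>The condition on the points of \<open>C j\<close> extends to its interior. Multiplying
  the complement of the interior of \<open>C i\<close> by \<open>q^2\<close> gives a connected
  unbounded set that avoids \<open>C j\<close>, so it cannot meet the bounded interior of
  \<open>C j\<close>.\<close>

lemma fixed_contours_step:
  assumes fc: "fixed_contours q n C" and q: "q \<noteq> 0"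
    and ij: "i \<in> {1..n}" "j \<in> {1..n}" "i \<noteq> j"
    and x: "x \<in> path_image (C j) \<union> inside (path_image (C j))"
  shows "x / q^2 \<in> inside (path_image (C i))"
proof (cases "x \<in> path_image (C j)")
  case True
  then show ?thesis using fc ij unfolding fixed_contours_def by blast
next
  case False
  then have xj: "x \<in> inside (path_image (C j))" using x by blast
  have Ci: "simple_path (C i)" "pathfinish (C i) = pathstart (C i)"
    using fc ij by (auto simp: fixed_contours_def contour_def)
  note J = Jordan_inside_outside[OF Ci]
  let ?I = "inside (path_image (C i))" and ?O = "outside (path_image (C i))"
  \<comment> \<open>By the Jordan curve theorem the complement of the interior is the closure of the
    exterior, hence connected.\<close>
  have "closure ?O = ?O \<union> path_image (C i)" using J by (metis closure_Un_frontier)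
  also have "\<dots> = - ?I" using J by (auto simp: inside_def)
  finally have co: "connected (- ?I)" using connected_imp_connected_closure[of ?O] J by metis
  define U where "U = (\<lambda>y. q^2 * y) ` (- ?I)"
  have "connected U"
    unfolding U_def by (rule connected_continuous_image[OF _ co]) (intro continuous_intros)
  have unb: "\<not> bounded U"
  proof
    assume "bounded U"
    then have "bounded ((\<lambda>y. 1 / q^2 * y) ` U)"
      by (rule bounded_linear_image) (rule bounded_linear_mult_right)
    moreover have "(\<lambda>y. 1 / q^2 * y) ` U = - ?I" using q by (simp add: U_def image_image)
    ultimately have "bounded (- ?I)" by simp
    moreover have "?O \<subseteq> - ?I" using J by blast
    ultimately have "bounded ?O" by (rule bounded_subset)
    then show False using J by blast
  qed
  have dis: "U \<subseteq> - path_image (C j)"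
  proof
    fix u assume "u \<in> U"
    then obtain y where y: "u = q^2 * y" "y \<notin> ?I" by (auto simp: U_def)
    have "u / q^2 = y" using y q by simp
    moreover have "u \<in> path_image (C j) \<Longrightarrow> u / q^2 \<in> ?I"
      using fc ij unfolding fixed_contours_def by blast
    ultimately show "u \<in> - path_image (C j)" using y by auto
  qed
  show ?thesis
  proof (rule ccontr)
    assume "x / q^2 \<notin> ?I"
    then have "q^2 * (x / q^2) \<in> U" unfolding U_def by blast
    then have "x \<in> U" using q by simp
    then have "U \<subseteq> connected_component_set (- path_image (C j)) x"
      by (rule connected_component_maximal) (use \<open>connected U\<close> dis in auto)
    moreover have "bounded (connected_component_set (- path_image (C j)) x)"
      using xj by (simp add: inside_def)
    ultimately show False using unb bounded_subset by blast
  qed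
qed

text \<open>Walk back and forth between the two contours, dividing by \<open>q^2\<close> at each
  step. An odd number of steps leads from \<open>C j\<close> to \<open>C i\<close>; for an even
  number a detour through a third contour corrects the parity.\<close>

lemma fixed_contours_walk:
  assumes fc: "fixed_contours q n C" and q: "q \<noteq> 0"
    and ij: "i \<in> {1..n}" "j \<in> {1..n}" "i \<noteq> j"
    and m: "m \<ge> 1" "odd m \<or> (\<exists>l\<in>{1..n}. l \<noteq> i \<and> l \<noteq> j)"
    and x: "x \<in> path_image (C j) \<union> inside (path_image (C j))"
  shows "x / q^(2*m) \<in> inside (path_image (C i))"
proof -
  let ?I = "\<lambda>i. inside (path_image (C i))"
  note step = fixed_contours_step[OF fc q]
  have odd: "x / q^(2*(2*r+1)) \<in> ?I i"
    if "i \<in> {1..n}" "j \<in> {1..n}" "i \<noteq> j" "x \<in> path_image (C j) \<union> ?I j" for r x i j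
  proof (induction r)
    case 0
    show ?case using step[OF that] by simp
  next
    case (Suc r)
    have "x / q^(2*(2*r+1)) / q^2 \<in> ?I j" by (rule step) (use that Suc in auto)
    then have "x / q^(2*(2*r+1)) / q^2 / q^2 \<in> ?I i" by (intro step[OF that(1-3)]) auto
    moreover have "x / q^(2*(2*r+1)) / q^2 / q^2 = x / q^(2*(2*Suc r+1))"
    proof -
      have "q^(2*(2*Suc r+1)) = q^(2*(2*r+1)) * q^2 * q^2"
        unfolding power_add[symmetric] by (rule arg_cong[of _ _ "\<lambda>m. q ^ m"]) simp
      then show ?thesis by (simp only: divide_divide_eq_left)
    qed
    ultimately show ?case by (simp only:)
  qed
  show ?thesis
  proof (cases "odd m")
    case True
    then obtain r where "m = 2 * r + 1" by (auto elim: oddE)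
    then show ?thesis using odd[OF ij x, of r] by simp
  next
    case False
    then obtain l where l: "l \<in> {1..n}" "l \<noteq> i" "l \<noteq> j" using m by auto
    obtain r where r: "m = 2 * r + 1 + 1" using False m by (metis Suc_eq_plus1 dvd_add_triv_right_iff evenE even_Suc le_add_diff_inverse2 oddE plus_1_eq_Suc)
    have "x / q^2 \<in> ?I l" by (rule step) (use l ij x in auto)
    then have "x / q^2 / q^(2*(2*r+1)) \<in> ?I i" by (intro odd[OF ij(1) l(1)]) (use l in auto)
    moreover have "x / q^2 / q^(2*(2*r+1)) = x / q^(2*m)"
    proof -
      have "q^(2*m) = q^2 * q^(2*(2*r+1))"
        unfolding power_add[symmetric] r by (rule arg_cong[of _ _ "\<lambda>m. q ^ m"]) simp
      then show ?thesis by (simp only: divide_divide_eq_left)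
    qed
    ultimately show ?thesis by (simp only:)
  qed
qed

lemma fixed_contours_nested:
  assumes fc: "fixed_contours q n C" and q: "q \<noteq> 0"
  shows "nested_contours q n (\<lambda>k z. C k)"
  unfolding nested_contours_def
proof (intro conjI ballI allI impI)
  fix k z j m assume k: "k \<in> {1..n}" and z: "\<forall>j\<in>{k<..n}. z j \<in> path_image (C j)"
  show "contour (C k)" using fc k by (simp add: fixed_contours_def)
  assume j: "j \<in> {k<..n}" and m: "m \<in> {1..k}"
  have zj: "z j \<in> path_image (C j)" using z j by blast
  have ij: "j \<in> {1..n}" "k \<noteq> j" using j k by auto
  have m': "m \<ge> 1" "odd m \<or> (\<exists>l\<in>{1..n}. l \<noteq> k \<and> l \<noteq> j)" "odd m \<or> (\<exists>l\<in>{1..n}. l \<noteq> j \<and> l \<noteq> k)"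
  proof -
    \<comment> \<open>An even \<open>m \<le> k\<close> forces \<open>1 < k < j\<close>, so index 1
      supplies the third contour.\<close>
    have "1 \<in> {1..n} \<and> 1 \<noteq> k \<and> 1 \<noteq> j" if "even m" using that m j k by (auto elim!: evenE)
    then show "m \<ge> 1" "odd m \<or> (\<exists>l\<in>{1..n}. l \<noteq> k \<and> l \<noteq> j)" "odd m \<or> (\<exists>l\<in>{1..n}. l \<noteq> j \<and> l \<noteq> k)"
      using m by auto
  qed
  show "z j / q^(2*m) \<in> inside (path_image (C k))"
    by (rule fixed_contours_walk[OF fc q k ij m'(1,2)]) (use zj in blast)
  \<comment> \<open>Otherwise the walk from \<open>C k\<close> to \<open>C j\<close> would put
    \<open>z j\<close> strictly inside its own contour.\<close>
  show "q^(2*m) * z j \<in> outside (path_image (C k))"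
  proof (rule ccontr)
    assume "q^(2*m) * z j \<notin> outside (path_image (C k))"
    then have "q^(2*m) * z j \<in> path_image (C k) \<union> inside (path_image (C k))"
      by (auto simp: inside_def outside_def)
    then have "q^(2*m) * z j / q^(2*m) \<in> inside (path_image (C j))"
      by (intro fixed_contours_walk[OF fc q ij(1) k _ m'(1,3)]) (use ij in auto)
    then have "z j \<in> inside (path_image (C j))" using q by simp
    then show False using zj by (simp add: inside_def)
  qed
qed auto

lemma separating_contours_nested:
  "separating_contours q n C \<Longrightarrow> q \<noteq> 0 \<Longrightarrow> nested_contours q n C"
  unfolding separating_contours_def using fixed_contours_nested by blast

text \<open>The radius is governed by the position \<open>pos k\<close> instead of the index, and
  consecutive radii differ by a factor exceeding every \<open>norm t ^ m\<close> that occurs, so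
  each possible pole falls on its prescribed side.\<close>

lemma circles_adapted_system:
  assumes pos: "\<And>j. j \<in> {1..n} \<Longrightarrow> pos j \<le> n"
    and R: "R > 1" "\<And>m. m \<in> {1..n} \<Longrightarrow> norm t ^ m < R" and t: "t \<noteq> 0"
  shows "adapted_system t n pos (\<lambda>k z. circlepath 0 (R ^ (n - pos k)))"
  unfolding adapted_system_def
proof (intro conjI ballI allI impI refl)
  fix k z assume k: "k \<in> {1..n}" and z: "\<forall>j\<in>{k<..n}. z j \<in> path_image (circlepath 0 (R ^ (n - pos j)))"
  let ?r = "\<lambda>j. R ^ (n - pos j)"
  have r: "?r j > 0" for j using R by simp
  have zn: "norm (z j) = ?r j" if "j \<in> {k<..n}" for j
    using z that r[of j] by (auto simp: less_imp_le)
  have step: "R * ?r j \<le> ?r i" if "pos i < pos j" "j \<in> {1..n}" for i j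
  proof -
    have "R * ?r j = R ^ Suc (n - pos j)" by simp
    also have "\<dots> \<le> ?r i" by (rule power_increasing) (use that pos[OF that(2)] R in auto)
    finally show ?thesis .
  qed
  show "adapted t n pos k (circlepath 0 (?r k)) z"
    unfolding adapted_def
  proof (intro conjI ballI impI)
    have "?r k \<noteq> 0" using R by simp
    then show "0 \<notin> path_image (circlepath 0 (?r k))" using r[of k] by (auto simp: less_imp_le simp del: zero_less_power)
    show "winding_number (circlepath 0 (?r k)) 0 = 1" by (rule winding_number_circlepath_centre[OF r])
    fix j assume j: "j \<in> {k<..n}"
    show "z j \<noteq> 0" using zn[OF j] R(1) by auto
    fix m assume m: "m \<in> {1..k}"
    have Rm: "norm t ^ m < R" using R(2)[of m] m k by auto
    {
      assume "pos k < pos j"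
      have "norm (t ^ m * z j) = norm t ^ m * ?r j" using zn[OF j] by (simp add: norm_mult norm_power)
      also have "\<dots> < R * ?r j" using Rm r by (rule mult_strict_right_mono)
      also have "\<dots> \<le> ?r k" using step[OF \<open>pos k < pos j\<close>] j k by auto
      finally have lt: "norm (t ^ m * z j) < ?r k" .
      then show "t ^ m * z j \<notin> path_image (circlepath 0 (?r k))" by auto
      show "winding_number (circlepath 0 (?r k)) (t ^ m * z j) = 1"
        by (rule winding_number_circlepath) (use lt in simp)
    }
    {
      assume "pos j < pos k"
      have "norm t ^ m * ?r k < R * ?r k" using Rm r by (rule mult_strict_right_mono)
      also have "\<dots> \<le> ?r j" using step[OF \<open>pos j < pos k\<close> k] .
      finally have "?r k < norm (z j / t ^ m)"
        using zn[OF j] t by (simp add: norm_divide norm_power field_simps)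
      then have out: "z j / t ^ m \<notin> cball 0 (?r k)" by simp
      then show "z j / t ^ m \<notin> path_image (circlepath 0 (?r k))" using less_imp_le[OF r[of k]] by auto
      show "winding_number (circlepath 0 (?r k)) (z j / t ^ m) = 0"
        by (rule winding_number_zero_outside[of _ "cball 0 (?r k)"]) (use out r[of k] in \<open>auto simp: less_imp_le\<close>)
    }
  qed auto
qed

section \<open>The permuted summands as directed rational functions\<close>

definition sym_num :: "complex \<Rightarrow> nat \<Rightarrow> (nat \<Rightarrow> int) \<Rightarrow> (nat \<Rightarrow> complex) \<Rightarrow> complex" where
  "sym_num s n \<kappa> z = (\<Sum>w | w permutes {1..n}. inv_sign n w * skew_prod s n (z \<circ> w) * zpow n \<kappa> (z \<circ> w))"

lemma rat_sum: "finite I \<Longrightarrow> (\<And>i. i \<in> I \<Longrightarrow> rat t n pos k (f i)) \<Longrightarrow> rat t n pos k (\<lambda>z. \<Sum>i\<in>I. f i z)"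
proof (induction I rule: finite_induct)
  case empty
  then show ?case using rat.const[of t n pos k 0] by simp
qed (auto intro: rat.add)

lemma rat_times_power_prod:
  assumes "rat t n pos 0 f" "finite S" "\<And>i. i \<in> S \<Longrightarrow> v i \<in> {1..n}"
  shows "rat t n pos 0 (\<lambda>z. f z * (\<Prod>i\<in>S. z (v i) powi p i))"
  using assms(2,3)
proof (induction S rule: finite_induct)
  case empty
  then show ?case using assms(1) by simp
next
  case (insert x S)
  have "rat t n pos 0 (\<lambda>z. (f z * (\<Prod>i\<in>S. z (v i) powi p i)) * z (v x) powi p x)"
    by (rule rat.monom) (use insert insert.prems[of x] in \<open>auto simp: Suc_le_eq\<close>)
  then show ?case using insert by (simp add: mult_ac)
qed

lemma rat_times_diff_prod:
  assumes "rat t n pos 0 f" "finite S" "\<And>p. p \<in> S \<Longrightarrow> v (fst p) \<in> {1..n} \<and> v (snd p) \<in> {1..n}"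
  shows "rat t n pos 0 (\<lambda>z. f z * (\<Prod>p\<in>S. z (v (fst p)) - t * z (v (snd p))))"
  using assms(2,3)
proof (induction S rule: finite_induct)
  case empty
  then show ?case using assms(1) by simp
next
  case (insert x S)
  let ?h = "\<lambda>z. f z * (\<Prod>p\<in>S. z (v (fst p)) - t * z (v (snd p)))"
  have h: "rat t n pos 0 ?h" using insert by auto
  have "rat t n pos 0 (\<lambda>z. 1 * z (v (fst x)) * ?h z + (- t) * z (v (snd x)) * ?h z)"
    by (intro rat.add rat_times_var(1) h) (use insert.prems[of x] in \<open>auto simp: Suc_le_eq\<close>)
  then show ?case using insert by (simp add: algebra_simps)
qed

lemma rat_divide_diff_prod:
  assumes "rat t n pos 0 f" "finite S"
    "\<And>p. p \<in> S \<Longrightarrow> v (fst p) \<in> {1..n} \<and> v (snd p) \<in> {1..n} \<and> pos (v (fst p)) < pos (v (snd p))"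
  shows "rat t n pos 0 (\<lambda>z. f z / (\<Prod>p\<in>S. z (v (fst p)) - t * z (v (snd p))))"
  using assms(2,3)
proof (induction S rule: finite_induct)
  case empty
  then show ?case using assms(1) by simp
next
  case (insert x S)
  have "rat t n pos 0 (\<lambda>z. (f z / (\<Prod>p\<in>S. z (v (fst p)) - t * z (v (snd p)))) / (z (v (fst x)) - t ^ 1 * z (v (snd x))))"
    by (rule rat.edge) (use insert insert.prems[of x] in \<open>auto simp: Suc_le_eq\<close>)
  then show ?case using insert by (simp add: mult.commute)
qed

text \<open>The ordering is \<open>inv w\<close> because \<open>inv w (w i) = i\<close>: in each
  denominator \<open>z (w i) - t * z (w j)\<close> with \<open>i < j\<close> the first variable
  comes earlier.\<close>

lemma rat_sym:
  assumes w: "w permutes {1..n}"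
  shows "rat t n (inv w) 0 (\<lambda>z. zpow n \<mu> (z \<circ> w) * (sym_num t n \<kappa> (z \<circ> w) / skew_prod t n (z \<circ> w)))"
proof -
  have img: "v i \<in> {1..n}" if "v permutes {1..n}" "i \<in> {1..n}" for v i using permutes_in_image that by metis
  have pm: "(fst p) \<in> {1..n} \<and> (snd p) \<in> {1..n} \<and> fst p < snd p" if "p \<in> pairs n" for p
    using that by (auto simp: pairs_def)
  have sk: "skew_prod t n (z \<circ> v) = (\<Prod>p\<in>pairs n. z (v (fst p)) - t * z (v (snd p)))" for z v
    by (simp add: skew_prod_def case_prod_unfold)
  have term1: "rat t n (inv w) 0 (\<lambda>z. inv_sign n u * skew_prod t n (z \<circ> (w \<circ> u)) * zpow n \<kappa> (z \<circ> (w \<circ> u)))"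
    if u: "u permutes {1..n}" for u
  proof -
    have wu: "w \<circ> u permutes {1..n}" by (rule permutes_compose[OF u w])
    have im: "w (u i) \<in> {1..n}" if "i \<in> {1..n}" for i using img[OF wu that] by simp
    show ?thesis
      unfolding sk unfolding zpow_def o_apply
      by (intro rat_times_power_prod rat_times_diff_prod rat.const finite_pairs finite_atLeastAtMost conjI im)
         (use pm in auto)
  qed
  have num: "rat t n (inv w) 0 (\<lambda>z. sym_num t n \<kappa> (z \<circ> w))"
    unfolding sym_num_def comp_assoc by (intro rat_sum term1) (auto intro: finite_permutations)
  have im: "w i \<in> {1..n}" if "i \<in> {1..n}" for i using img[OF w that] .
  have "rat t n (inv w) 0 (\<lambda>z. sym_num t n \<kappa> (z \<circ> w) * (\<Prod>i\<in>{1..n}. z (w i) powi (- \<mu> i)) /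
      (\<Prod>p\<in>pairs n. z (w (fst p)) - t * z (w (snd p))))"
    by (intro rat_divide_diff_prod rat_times_power_prod num finite_pairs finite_atLeastAtMost conjI im)
       (use pm permutes_inverses[OF w] in auto)
  then show ?thesis by (simp add: sk zpow_def mult_ac)
qed

text \<open>Being adapted to every ordering keeps the contours off both kinds of poles: for
  \<open>i < j\<close> the identity ordering excludes \<open>t * z j\<close> from the contour of
  \<open>z i\<close>, and the reversed ordering excludes \<open>z j / t\<close>.\<close>

lemma adapted_system_generic:
  assumes C: "\<And>pos. adapted_system t n pos C" and t: "t \<noteq> 0"
    and z: "\<forall>j\<in>{1..n}. z j \<in> path_image (C j z)"
    and ij: "i \<in> {1..n}" "j \<in> {1..n}" "i \<noteq> j"
  shows "z i \<noteq> 1 / t * z j"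
proof -
  have *: "z i \<noteq> t * z j \<and> z i \<noteq> z j / t" if "i < j" "i \<in> {1..n}" "j \<in> {1..n}" for i j
  proof -
    have ad: "adapted t n pos i (C i z) z" for pos
      using C[of pos] z that unfolding adapted_system_def by auto
    have "t ^ 1 * z j \<notin> path_image (C i z)"
      using ad[of id] that unfolding adapted_def by (metis One_nat_def atLeastAtMost_iff greaterThanAtMost_iff id_apply le_refl)
    moreover have "z j / t ^ 1 \<notin> path_image (C i z)"
    proof -
      have "n - j < n - i" using that by auto
      then show ?thesis using ad[of "\<lambda>i. n - i"] that unfolding adapted_def by (metis One_nat_def atLeastAtMost_iff greaterThanAtMost_iff le_refl)
    qed
    moreover have "z i \<in> path_image (C i z)" using z that by blast
    ultimately show ?thesis by auto
  qed
  show ?thesis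
  proof (cases "i < j")
    case True
    then show ?thesis using *[OF True ij(1,2)] by auto
  next
    case False
    then have "z j \<noteq> t * z i" using *[of j i] ij by auto
    then show ?thesis using t by (auto simp: field_simps)
  qed
qed

lemma sym_coeff_times_has_sum:
  assumes "\<rho> \<ge> 1" "\<rho> \<ge> norm t" "y \<in> region n \<rho>" "\<kappa> \<in> idx n" "\<mu> \<in> idx n"
  shows "((\<lambda>k. sym_coeff t n \<kappa> (\<lambda>i. k i - \<mu> i) * zpow n k y) has_sum zpow n \<mu> y * sym_fun t n \<kappa> y) (idx n)"
proof -
  have yt: "y \<in> torus n" using assms(3) by (simp add: region_def)
  have "((\<lambda>k. zpow n \<mu> y * (sym_coeff t n \<kappa> k * zpow n k y)) has_sum zpow n \<mu> y * sym_fun t n \<kappa> y) (idx n)"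
    by (intro has_sum_cmult_right sym_coeff_has_sum[OF assms(1-4)])
  also have "?this \<longleftrightarrow> ?thesis"
  proof (rule has_sum_reindex_bij_witness[of _ "\<lambda>k i. k i - \<mu> i" "\<lambda>k i. k i + \<mu> i"], goal_cases)
    case (5 k)
    then show ?case by (simp add: zpow_add[OF yt])
  qed (use assms(5) in \<open>auto simp: idx_def\<close>)
  finally show ?thesis .
qed

text \<open>For each \<open>w\<close>, circles of radii \<open>R ^ (n - inv w k)\<close> put
  \<open>z \<circ> w\<close> into the region of expansion, where the constant term of
  \<open>zpow n \<mu> * sym_fun t n \<kappa>\<close> is the coefficient at \<open>- \<mu>\<close>.
  Renaming variables does not change a constant term, so all permutations give the same value and
  their number is \<open>fact n\<close>.\<close>

lemma integral_sym_product:
  assumes s: "s \<noteq> 0" and X: "finite X" and \<kappa>: "\<And>x. x \<in> X \<Longrightarrow> \<kappa> x \<in> idx n" and \<mu>: "\<And>x. x \<in> X \<Longrightarrow> \<mu> x \<in> idx n"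
    and C: "\<And>pos. adapted_system (1 / s) n pos C"
  shows "iterated_integral C (\<lambda>z. \<Sum>x\<in>X. g x * (sym_fun (1 / s) n (\<kappa> x) z * sym_fun s n (\<mu> x) z)) n z0 =
    (2 * of_real pi * \<i>) ^ n * fact n * (\<Sum>x\<in>X. g x * sym_coeff (1 / s) n (\<kappa> x) (\<lambda>i. - \<mu> x i))"
proof -
  define t where "t = 1 / s"
  have t: "t \<noteq> 0" "1 / t = s" using s by (auto simp: t_def)
  \<comment> \<open>\<open>R\<close> has to exceed 1 and all \<open>norm t ^ m\<close> with
    \<open>m \<le> n\<close> for the circles to be adapted, and \<open>norm t\<close> for the
    expansion to converge.\<close>
  define R where "R = (1 + norm t) ^ n + 2 + norm t"
  have p: "(1 + norm t) ^ n \<ge> 0" by simp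
  have R: "R > 1" "R > norm t" unfolding R_def using p norm_ge_zero[of t] by linarith+
  have Rm: "norm t ^ m < R" if "m \<in> {1..n}" for m
  proof -
    have "norm t ^ m \<le> (1 + norm t) ^ m" by (rule power_mono) auto
    also have "\<dots> \<le> (1 + norm t) ^ n" by (rule power_increasing) (use that in auto)
    also have "\<dots> < R" by (simp add: R_def add_pos_nonneg)
    finally show ?thesis .
  qed
  let ?f = "\<lambda>w z. \<Sum>x\<in>X. g x * (zpow n (\<mu> x) (z \<circ> w) * (sym_num t n (\<kappa> x) (z \<circ> w) / skew_prod t n (z \<circ> w)))"
  let ?F = "\<lambda>z. \<Sum>x\<in>X. g x * (sym_fun t n (\<kappa> x) z * sym_fun s n (\<mu> x) z)"
  let ?C = "\<lambda>w k (z :: nat \<Rightarrow> complex). circlepath 0 (R ^ (n - inv w k))"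
  let ?v = "(2 * of_real pi * \<i>) ^ n * (\<Sum>x\<in>X. g x * sym_coeff t n (\<kappa> x) (\<lambda>i. - \<mu> x i))"
  have "iterated_integral C ?F n z0 = (\<Sum>w | w permutes {1..n}. iterated_integral (?C w) (?f w) n z0)"
  proof (rule iterated_integral_sum[where pos = inv, OF t(1)])
    show "finite {w. w permutes {1..n}}" by (rule finite_permutations) auto
    show "adapted_system t n (inv w) C" for w using C by (simp add: t_def)
    show "\<forall>k\<in>{1..n}. \<forall>z z'. (\<forall>j\<in>{k<..n}. z j = z' j) \<longrightarrow> C k z = C k z'"
      using C[of id] unfolding adapted_system_def by blast
    show "adapted_system t n (inv w) (?C w)" if "w \<in> {w. w permutes {1..n}}" for w
    proof (rule circles_adapted_system[OF _ R(1) Rm t(1)])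
      fix j assume "j \<in> {1..n}"
      then have "inv w j \<in> {1..n}" using permutes_in_image[OF permutes_inv[of w "{1..n}"], of j] that by simp
      then show "inv w j \<le> n" by simp
    qed
    show "rat t n (inv w) 0 (?f w)" if "w \<in> {w. w permutes {1..n}}" for w
      by (intro rat_sum X rat_scale rat_sym) (use that in simp)
    fix z assume z: "\<forall>j\<in>{1..n}. z j \<in> path_image (C j z)"
    have nz: "z i \<noteq> s * z j" if "i \<in> {1..n}" "j \<in> {1..n}" "i \<noteq> j" for i j
      using adapted_system_generic[of t n C z i j] C t z that by (simp add: t_def)
    have "sym_fun t n (\<kappa> x) z * sym_fun s n (\<mu> x) z =
       (\<Sum>w | w permutes {1..n}. zpow n (\<mu> x) (z \<circ> w) * (sym_num t n (\<kappa> x) (z \<circ> w) / skew_prod t n (z \<circ> w)))" for x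
      unfolding t_def
    proof (rule trans[OF sym_fun_product[OF s nz] sum.cong[OF refl]])
      fix w assume "w \<in> {w. w permutes {1..n}}"
      then have w: "w permutes {1..n}" by simp
      have "sym_fun (1 / s) n (\<kappa> x) (z \<circ> w) = sym_num (1 / s) n (\<kappa> x) (z \<circ> w) / skew_prod (1 / s) n (z \<circ> w)"
        unfolding sym_num_def
      proof (rule sym_fun_rational)
        fix a b assume "(a, b) \<in> pairs n"
        then have ab: "a \<in> {1..n}" "b \<in> {1..n}" "a \<noteq> b" by (auto simp: pairs_def)
        then have "w a \<in> {1..n}" "w b \<in> {1..n}" using permutes_in_image[OF w] by blast+
        moreover have "w b \<noteq> w a" using permutes_inj[OF w] ab by (simp add: inj_eq)
        ultimately have "z (w b) \<noteq> s * z (w a)" by (intro nz)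
        then show "(z \<circ> w) a \<noteq> 1 / s * (z \<circ> w) b" using s by (auto simp: field_simps)
      qed
      then show "zpow n (\<mu> x) (z \<circ> w) * sym_fun (1 / s) n (\<kappa> x) (z \<circ> w) =
        zpow n (\<mu> x) (z \<circ> w) * (sym_num (1 / s) n (\<kappa> x) (z \<circ> w) / skew_prod (1 / s) n (z \<circ> w))" by simp
    qed
    then show "?F z = (\<Sum>w | w permutes {1..n}. ?f w z)"
      by (simp only: sum_distrib_left) (rule sum.swap)
  qed
  also have "\<dots> = (\<Sum>w | w permutes {1..n}. ?v)"
  proof (rule sum.cong[OF refl])
    fix w assume "w \<in> {w. w permutes {1..n}}"
    then have w: "w permutes {1..n}" by simp
    let ?a = "\<lambda>k. \<Sum>x\<in>X. g x * sym_coeff t n (\<kappa> x) (\<lambda>i. (k \<circ> w) i - \<mu> x i)"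
    have "iterated_integral (?C w) (?f w) n z0 = (2 * of_real pi * \<i>) ^ n * ?a (\<lambda>_. 0)"
    proof (rule iterated_integral_circles)
      show "R ^ (n - inv w i) > 0" for i using R by simp
      fix z :: "nat \<Rightarrow> complex" assume z: "\<And>i. i \<in> {1..n} \<Longrightarrow> norm (z i) = R ^ (n - inv w i)"
      define y where "y = z \<circ> w"
      have y: "norm (y i) = R ^ (n - i)" if "i \<in> {1..n}" for i
      proof -
        have "w i \<in> {1..n}" using permutes_in_image[OF w] that by blast
        then show ?thesis using z[of "w i"] permutes_inverses[OF w] by (simp add: y_def)
      qed
      have Rnz: "R ^ m \<noteq> 0" for m using R(1) by simp
      have yt: "y \<in> torus n" unfolding torus_def
      proof (intro CollectI ballI notI)
        fix i assume "i \<in> {1..n}" "y i = 0"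
        with y[of i] Rnz[of "n - i"] show False by simp
      qed
      have yr: "y \<in> region n (max 1 (norm t))"
        unfolding region_def
      proof (safe intro!: yt)
        fix i assume i: "i \<in> {1..<n}"
        have "n - i = Suc (n - Suc i)" using i by auto
        then have "norm (y i) = R * norm (y (Suc i))" using y[of i] y[of "Suc i"] i by simp
        moreover have "norm (y (Suc i)) > 0" using yt i by (auto simp: torus_def)
        ultimately show "max 1 (norm t) * norm (y (Suc i)) < norm (y i)" using R by simp
      qed
      have nz: "y a \<noteq> t * y b" if "(a, b) \<in> pairs n" for a b
      proof -
        have ab: "a \<in> {1..n}" "b \<in> {1..n}" "a < b" using that by (auto simp: pairs_def)
        have "norm (t * y b) \<le> max 1 (norm t) * norm (y b)" by (simp add: norm_mult mult_right_mono)
        also have "\<dots> < norm (y a)" by (rule region_less[OF yr _ ab]) simp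
        finally show ?thesis by auto
      qed
      have sf: "sym_fun t n \<kappa>' y = sym_num t n \<kappa>' y / skew_prod t n y" for \<kappa>'
        unfolding sym_num_def by (rule sym_fun_rational[OF nz])
      have fy: "?f w z = (\<Sum>x\<in>X. g x * (zpow n (\<mu> x) y * sym_fun t n (\<kappa> x) y))"
        by (simp only: sf y_def[symmetric])
      have "((\<lambda>k. \<Sum>x\<in>X. g x * (sym_coeff t n (\<kappa> x) (\<lambda>i. k i - \<mu> x i) * zpow n k y)) has_sum ?f w z) (idx n)"
        unfolding fy by (intro has_sum_sum has_sum_cmult_right sym_coeff_times_has_sum[OF _ _ yr] \<kappa> \<mu>) auto
      then have hs: "((\<lambda>k. (\<Sum>x\<in>X. g x * sym_coeff t n (\<kappa> x) (\<lambda>i. k i - \<mu> x i)) * zpow n k y) has_sum ?f w z) (idx n)"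
        by (simp add: sum_distrib_right mult.assoc)
      have "((\<lambda>k. ?a k * zpow n k z) has_sum ?f w z) (idx n) \<longleftrightarrow>
         ((\<lambda>k. (\<Sum>x\<in>X. g x * sym_coeff t n (\<kappa> x) (\<lambda>i. k i - \<mu> x i)) * zpow n k y) has_sum ?f w z) (idx n)"
      proof (rule has_sum_reindex_bij_witness[of _ "\<lambda>k. k \<circ> inv w" "\<lambda>k. k \<circ> w"])
        fix k
        show "(\<Sum>x\<in>X. g x * sym_coeff t n (\<kappa> x) (\<lambda>i. (k \<circ> w) i - \<mu> x i)) * zpow n (k \<circ> w) y = ?a k * zpow n k z"
          using zpow_permute[OF w, of "k \<circ> w" z] permutes_inv_o[OF w] by (simp add: y_def comp_assoc del: o_apply)
      qed (use idx_permute[OF _ permutes_inv[OF w]] idx_permute[OF _ w] permutes_inv_o[OF w] in \<open>auto simp: comp_assoc\<close>)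
      with hs show "((\<lambda>k. ?a k * zpow n k z) has_sum ?f w z) (idx n)" by blast
    qed
    then show "iterated_integral (?C w) (?f w) n z0 = ?v" by simp
  qed
  also have "\<dots> = fact n * ?v" by (simp add: card_permutations[OF refl])
  finally show ?thesis by (simp add: t_def mult_ac)
qed

section \<open>The integrand\<close>

text \<open>The combinatorial part indexes exponents by the places \<open>1..n\<close>, while
  \<open>current_term\<close> uses lists indexed from 0; \<open>to_list\<close> and
  \<open>of_list\<close> translate.\<close>

definition to_list :: "nat \<Rightarrow> (nat \<Rightarrow> int) \<Rightarrow> int list" where
  "to_list n k = map k [1..<Suc n]"

definition of_list :: "int list \<Rightarrow> nat \<Rightarrow> int" where
  "of_list ks i = (if i \<in> {1..length ks} then ks ! (i - 1) else 0)"

lemma length_to_list [simp]: "length (to_list n k) = n"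
  by (simp add: to_list_def)

lemma to_list_nth: "i < n \<Longrightarrow> to_list n k ! i = k (Suc i)"
  by (simp add: to_list_def del: upt_Suc)

lemma to_list_of_list: "length ks = n \<Longrightarrow> to_list n (of_list ks) = ks"
  by (rule nth_equalityI) (auto simp: to_list_nth of_list_def)

lemma of_list_to_list: "k \<in> idx n \<Longrightarrow> of_list (to_list n k) = k"
  by (auto simp: fun_eq_iff of_list_def idx_def to_list_nth)

lemma of_list_idx: "length ks = n \<Longrightarrow> of_list ks \<in> idx n"
  by (auto simp: idx_def of_list_def)

section \<open>Holomorphy in several variables\<close>

lemma continuous_on_coord: "continuous_on S (\<lambda>z :: nat \<Rightarrow> complex. z i)"
  by (rule continuous_on_subset[OF continuous_on_product_coordinates]) auto

lemma holomorphic_in_const: "holomorphic_in n S (\<lambda>z. c)"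
  by (auto simp: holomorphic_in_def)

lemma holomorphic_in_coord: "holomorphic_in n S (\<lambda>z. z j)"
proof -
  have "(\<lambda>w. (z(i := w)) j) holomorphic_on A" for z :: "nat \<Rightarrow> complex" and i A
    by (cases "i = j") auto
  then show ?thesis by (auto simp: holomorphic_in_def intro: continuous_on_coord simp del: fun_upd_apply)
qed

lemma holomorphic_in_add: "holomorphic_in n S f \<Longrightarrow> holomorphic_in n S g \<Longrightarrow> holomorphic_in n S (\<lambda>z. f z + g z)"
  by (auto simp: holomorphic_in_def intro!: continuous_intros holomorphic_intros)

lemma holomorphic_in_diff: "holomorphic_in n S f \<Longrightarrow> holomorphic_in n S g \<Longrightarrow> holomorphic_in n S (\<lambda>z. f z - g z)"
  by (auto simp: holomorphic_in_def intro!: continuous_intros holomorphic_intros)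

lemma holomorphic_in_mult: "holomorphic_in n S f \<Longrightarrow> holomorphic_in n S g \<Longrightarrow> holomorphic_in n S (\<lambda>z. f z * g z)"
  by (auto simp: holomorphic_in_def intro!: continuous_intros holomorphic_intros)

lemma holomorphic_in_divide:
  "holomorphic_in n S f \<Longrightarrow> holomorphic_in n S g \<Longrightarrow> (\<And>z. z \<in> S \<Longrightarrow> g z \<noteq> 0) \<Longrightarrow> holomorphic_in n S (\<lambda>z. f z / g z)"
  by (auto simp: holomorphic_in_def intro!: continuous_intros holomorphic_intros)

lemma holomorphic_in_powi:
  "holomorphic_in n S f \<Longrightarrow> (\<And>z. z \<in> S \<Longrightarrow> f z \<noteq> 0) \<Longrightarrow> holomorphic_in n S (\<lambda>z. f z powi p)"
  by (auto simp: holomorphic_in_def intro!: continuous_on_power_int holomorphic_on_power_int)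

lemma holomorphic_in_sum:
  "(\<And>i. i \<in> I \<Longrightarrow> holomorphic_in n S (f i)) \<Longrightarrow> holomorphic_in n S (\<lambda>z. \<Sum>i\<in>I. f i z)"
  by (induction I rule: infinite_finite_induct) (auto intro: holomorphic_in_const holomorphic_in_add)

lemma holomorphic_in_prod:
  "(\<And>i. i \<in> I \<Longrightarrow> holomorphic_in n S (f i)) \<Longrightarrow> holomorphic_in n S (\<lambda>z. \<Prod>i\<in>I. f i z)"
  by (induction I rule: infinite_finite_induct) (auto intro: holomorphic_in_const holomorphic_in_mult)

lemma holomorphic_in_cong:
  assumes "holomorphic_in n S f" "\<And>z. z \<in> S \<Longrightarrow> f z = g z"
  shows "holomorphic_in n S g"
proof -
  have "continuous_on S g" using assms continuous_on_cong[of S S f g] by (auto simp: holomorphic_in_def)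
  moreover have "(\<lambda>w. g (z(i := w))) holomorphic_on {w. z(i := w) \<in> S}" if "z \<in> S" "i \<in> {1..n}" for z i
    by (rule holomorphic_transform[of "\<lambda>w. f (z(i := w))"]) (use assms that in \<open>auto simp: holomorphic_in_def\<close>)
  ultimately show ?thesis by (auto simp: holomorphic_in_def)
qed

lemma holomorphic_in_skew_prod: "holomorphic_in n S (\<lambda>z. skew_prod s m (z \<circ> w))"
  unfolding skew_prod_def case_prod_unfold o_apply
  by (intro holomorphic_in_prod holomorphic_in_diff holomorphic_in_mult holomorphic_in_const holomorphic_in_coord)

lemma holomorphic_in_sym_num:
  assumes "S \<subseteq> torus n"
  shows "holomorphic_in n S (sym_num s n \<kappa>)"
proof -
  have "holomorphic_in n S (\<lambda>z. \<Sum>w | w permutes {1..n}. inv_sign n w * skew_prod s n (z \<circ> w) * zpow n \<kappa> (z \<circ> w))"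
  proof (intro holomorphic_in_sum holomorphic_in_mult holomorphic_in_const holomorphic_in_skew_prod)
    fix w assume w: "w \<in> {w. w permutes {1..n}}"
    show "holomorphic_in n S (\<lambda>z. zpow n \<kappa> (z \<circ> w))"
      unfolding zpow_def o_apply
    proof (intro holomorphic_in_prod holomorphic_in_powi holomorphic_in_coord)
      fix i z assume "i \<in> {1..n}" "z \<in> S"
      then have "w i \<in> {1..n}" using permutes_in_image[of w "{1..n}" i] w by blast
      then show "z (w i) \<noteq> 0" using assms \<open>z \<in> S\<close> by (auto simp: torus_def)
    qed
  qed
  then show ?thesis unfolding sym_num_def[abs_def] .
qed

lemma pole_prod:
  "(\<Prod>j\<in>{1..n}. \<Prod>i\<in>{1..<j}. (z i - q^2 * z j) * (z i - z j / q^2)) = skew_prod (q^2) n z * skew_prod (1 / q^2) n z"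
proof -
  have "(\<Prod>j\<in>{1..n}. \<Prod>i\<in>{1..<j}. (z i - q^2 * z j) * (z i - z j / q^2)) =
    (\<Prod>(j, i)\<in>(SIGMA j:{1..n}. {1..<j}). (z i - q^2 * z j) * (z i - z j / q^2))"
    by (rule prod.Sigma) auto
  also have "\<dots> = (\<Prod>(i, j)\<in>pairs n. (z i - q^2 * z j) * (z i - z j / q^2))"
    by (rule prod.reindex_bij_witness[of _ prod.swap prod.swap]) (auto simp: pairs_def)
  also have "\<dots> = skew_prod (q^2) n z * skew_prod (1 / q^2) n z"
    unfolding skew_prod_def prod.distrib[symmetric] by (rule prod.cong) auto
  finally show ?thesis .
qed

text \<open>Off the poles a product of two symmetrized functions is a quotient by
  \<open>skew_prod (q^2) n z * skew_prod (1 / q^2) n z\<close>, which is exactly the product that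
  clears the poles in \<open>is_integrand\<close>. So the common numerator can serve as
  \<open>G\<close>.\<close>

lemma is_integrand_sym:
  assumes q: "q \<noteq> 0" and X: "finite X" and \<kappa>: "\<And>x. x \<in> X \<Longrightarrow> \<kappa> x \<in> idx n" and \<mu>: "\<And>x. x \<in> X \<Longrightarrow> \<mu> x \<in> idx n"
    and c: "\<And>k l. k \<in> idx n \<Longrightarrow> l \<in> idx n \<Longrightarrow>
      L (tens (foldr (fop V) (to_list n k) v) (foldr (eop W) (to_list n l) w)) =
      (\<Sum>x\<in>X. g x * (sym_coeff (1 / q^2) n (\<kappa> x) k * sym_coeff (q^2) n (\<mu> x) l))"
  shows "is_integrand q V W tens L v w n
    (\<lambda>z. \<Sum>x\<in>X. g x * (sym_fun (1 / q^2) n (\<kappa> x) z * sym_fun (q^2) n (\<mu> x) z))"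
proof -
  define F where "F = (\<lambda>z. \<Sum>x\<in>X. g x * (sym_fun (1 / q^2) n (\<kappa> x) z * sym_fun (q^2) n (\<mu> x) z))"
  define N where "N = (\<lambda>z. \<Sum>x\<in>X. g x * (sym_num (1 / q^2) n (\<kappa> x) z * sym_num (q^2) n (\<mu> x) z))"
  let ?P = "\<lambda>z. skew_prod (q^2) n z * skew_prod (1 / q^2) n z"
  let ?S = "pole_complement q n"
  have pc: "z a \<noteq> q^2 * z b" "z a \<noteq> 1 / q^2 * z b" if "z \<in> ?S" "(a, b) \<in> pairs n" for z a b
    using that by (auto simp: pole_complement_def pairs_def)
  have Pnz: "skew_prod (q^2) n z \<noteq> 0" "skew_prod (1 / q^2) n z \<noteq> 0" if "z \<in> ?S" for z
    using pc[OF that] by (auto simp: skew_prod_def)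
  have Ft: "F z = N z / ?P z" if z: "z \<in> ?S" for z
  proof -
    have "sym_fun r n \<kappa>' z = sym_num r n \<kappa>' z / skew_prod r n z" if "r = q^2 \<or> r = 1 / q^2" for r \<kappa>'
      unfolding sym_num_def by (rule sym_fun_rational) (use pc[OF z] that in auto)
    then have "F z = (\<Sum>x\<in>X. g x * (sym_num (1 / q^2) n (\<kappa> x) z * sym_num (q^2) n (\<mu> x) z) / ?P z)"
      unfolding F_def by (intro sum.cong refl) (simp add: mult.commute)
    then show ?thesis by (simp add: N_def sum_divide_distrib)
  qed
  have sub: "?S \<subseteq> torus n" by (auto simp: pole_complement_def)
  have Nhol: "holomorphic_in n S N" if "S \<subseteq> torus n" for S
    unfolding N_def by (intro holomorphic_in_sum holomorphic_in_mult holomorphic_in_const holomorphic_in_sym_num that)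
  have Phol: "holomorphic_in n ?S ?P"
    using holomorphic_in_mult[OF holomorphic_in_skew_prod[of n ?S "q^2" n id] holomorphic_in_skew_prod[of n ?S "1 / q^2" n id]] by simp
  have hol: "holomorphic_in n ?S F"
    by (rule holomorphic_in_cong[OF holomorphic_in_divide[OF Nhol[OF sub] Phol]]) (use Ft Pnz in auto)
  \<comment> \<open>Large enough for the expansions with \<open>q^2\<close> and with
    \<open>1 / q^2\<close> to converge on the same region.\<close>
  define \<rho> where "\<rho> = max 1 (max (norm (q^2)) (norm (1 / q^2)))"
  have \<rho>: "\<rho> \<ge> 1" "\<rho> \<ge> norm (q^2)" "\<rho> \<ge> norm (1 / q^2)" by (simp_all add: \<rho>_def)
  have hs: "(current_term V W tens L v w n z has_sum F z) ({ks. length ks = n} \<times> {ls. length ls = n})"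
    if z: "z \<in> region n \<rho>" for z
  proof -
    have zt: "z \<in> torus n" using z by (simp add: region_def)
    have "((\<lambda>p. \<Sum>x\<in>X. g x * (case p of (k, l) \<Rightarrow> (sym_coeff (1 / q^2) n (\<kappa> x) k * zpow n k z) * (sym_coeff (q^2) n (\<mu> x) l * zpow n l z))) has_sum F z)
       (idx n \<times> idx n)"
      unfolding F_def
      by (intro has_sum_sum has_sum_cmult_right has_sum_times_complex sym_coeff_has_sum[OF \<rho>(1) _ z] \<rho> \<kappa> \<mu>)
    also have "?this \<longleftrightarrow> ?thesis"
    proof (rule has_sum_reindex_bij_witness[of _ "\<lambda>(ks, ls). (of_list ks, of_list ls)" "\<lambda>(k, l). (to_list n k, to_list n l)"], goal_cases)
      case (5 p)
      obtain k l where p: "p = (k, l)" by (cases p)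
      have kl: "k \<in> idx n" "l \<in> idx n" using 5 p by auto
      have "(\<Prod>i<n. z (Suc i) powi (- to_list n k ! i - to_list n l ! i)) = zpow n k z * zpow n l z"
      proof -
        have "(\<Prod>i<n. z (Suc i) powi (- to_list n k ! i - to_list n l ! i)) = (\<Prod>i<n. z (Suc i) powi (- k (Suc i)) * z (Suc i) powi (- l (Suc i)))"
        proof (rule prod.cong[OF refl])
          fix i assume "i \<in> {..<n}"
          then have "z (Suc i) \<noteq> 0" "i < n" using zt by (auto simp: torus_def)
          then show "z (Suc i) powi (- to_list n k ! i - to_list n l ! i) = z (Suc i) powi (- k (Suc i)) * z (Suc i) powi (- l (Suc i))"
            using power_int_add[of "z (Suc i)" "- k (Suc i)" "- l (Suc i)"] by (simp add: to_list_nth)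
        qed
        also have "\<dots> = (\<Prod>i\<in>{1..n}. z i powi (- k i) * z i powi (- l i))"
          by (rule prod.reindex_bij_witness[of _ "\<lambda>i. i - 1" Suc]) auto
        finally show ?thesis by (simp add: zpow_def prod.distrib)
      qed
      then show ?case
        unfolding p using c[OF kl] by (simp add: current_term_def sum_distrib_left sum_distrib_right mult_ac)
    qed (auto simp: to_list_of_list of_list_to_list of_list_idx)
    finally show ?thesis .
  qed
  show ?thesis
    unfolding is_integrand_def F_def[symmetric]
  proof (intro conjI)
    show "\<exists>\<rho>>0. \<forall>z\<in>torus n. (\<forall>i\<in>{1..<n}. norm (z i) > \<rho> * norm (z (Suc i))) \<longrightarrow>
        (current_term V W tens L v w n z has_sum F z) ({ks. length ks = n} \<times> {ls. length ls = n})"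
      by (rule exI[of _ \<rho>]) (use hs \<rho>(1) in \<open>auto simp: region_def\<close>)
    show "holomorphic_in n ?S F" by (rule hol)
    show "\<exists>G. holomorphic_in n (torus n) G \<and>
        (\<forall>z\<in>?S. G z = F z * (\<Prod>j\<in>{1..n}. \<Prod>i\<in>{1..<j}. (z i - q^2 * z j) * (z i - z j / q^2)))"
      unfolding pole_prod by (rule exI[of _ N]) (use Nhol Ft Pnz in auto)
  qed
qed

text \<open>
  The coefficients of both tensor factors are expanded in the symmetrized series; then
  \<open>integral_sym_product\<close> leaves the coefficients on the diagonal \<open>k = -\<mu>\<close>.
\<close>

lemma integrand_exists:
  assumes q: "q \<noteq> 0" "\<And>m::nat. m > 0 \<Longrightarrow> q ^ m \<noteq> 1"
    and c_def: "\<And>k l. c k l = L (tens (foldr (fop V) (to_list n k) v) (foldr (eop W) (to_list n l) w))"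
    and f: "\<And>l. exchange_rel (1 / q^2) n (\<lambda>k. c k l)" and e: "\<And>k. exchange_rel (q^2) n (c k)"
    and finK: "finite K" "\<And>\<kappa>. \<kappa> \<in> K \<Longrightarrow> \<kappa> \<in> idx n \<and> mono_on {1..n} \<kappa>"
      "\<And>\<kappa> l. \<kappa> \<in> idx n \<Longrightarrow> l \<in> idx n \<Longrightarrow> mono_on {1..n} \<kappa> \<Longrightarrow> c \<kappa> l \<noteq> 0 \<Longrightarrow> \<kappa> \<in> K"
    and finM: "finite M" "\<And>\<mu>. \<mu> \<in> M \<Longrightarrow> \<mu> \<in> idx n \<and> mono_on {1..n} \<mu>"
      "\<And>\<mu> k. \<mu> \<in> idx n \<Longrightarrow> k \<in> idx n \<Longrightarrow> mono_on {1..n} \<mu> \<Longrightarrow> c k \<mu> \<noteq> 0 \<Longrightarrow> \<mu> \<in> M"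
  shows "\<exists>F. is_integrand q V W tens L v w n F \<and>
    (\<forall>C z0. separating_contours q n C \<longrightarrow> iterated_integral C F n z0 =
       (2 * of_real pi * \<i>) ^ n * fact n * (\<Sum>\<mu>\<in>M. c (\<lambda>i. - \<mu> i) \<mu> / stab_weight (q^2) n \<mu>))"
proof -
  have s1: "(q^2) ^ m \<noteq> 1" if "m > 0" for m :: nat
    using q(2)[of "2 * m"] that by (simp add: power_mult)
  have t1: "(1 / q^2) ^ m \<noteq> 1" if "m > 0" for m :: nat
    using s1[OF that] by (simp add: power_one_over)
  let ?s = "q^2" and ?t = "1 / q^2"
  define g where "g = (\<lambda>(\<kappa>, \<mu>). c \<kappa> \<mu> / stab_weight ?t n \<kappa> / stab_weight ?s n \<mu>)"
  have ce: "c k l = (\<Sum>\<mu>\<in>M. c k \<mu> / stab_weight ?s n \<mu> * sym_coeff ?s n \<mu> l)" if "k \<in> idx n" "l \<in> idx n" for k l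
    by (rule exchange_expansion[OF s1 e finM(1,2) finM(3)[OF _ that(1)] that(2)])
  have cf: "c k l = (\<Sum>\<kappa>\<in>K. c \<kappa> l / stab_weight ?t n \<kappa> * sym_coeff ?t n \<kappa> k)" if "k \<in> idx n" "l \<in> idx n" for k l
    by (rule exchange_expansion[OF t1 f finK(1,2) finK(3)[OF _ that(2)] that(1)])
  have cc: "c k l = (\<Sum>x\<in>K \<times> M. g x * (sym_coeff ?t n (fst x) k * sym_coeff ?s n (snd x) l))" if "k \<in> idx n" "l \<in> idx n" for k l
  proof -
    have "c k l = (\<Sum>\<mu>\<in>M. \<Sum>\<kappa>\<in>K. g (\<kappa>, \<mu>) * (sym_coeff ?t n \<kappa> k * sym_coeff ?s n \<mu> l))"
      unfolding ce[OF that]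
    proof (rule sum.cong[OF refl])
      fix \<mu> assume "\<mu> \<in> M"
      then show "c k \<mu> / stab_weight ?s n \<mu> * sym_coeff ?s n \<mu> l = (\<Sum>\<kappa>\<in>K. g (\<kappa>, \<mu>) * (sym_coeff ?t n \<kappa> k * sym_coeff ?s n \<mu> l))"
      proof -
        have "\<mu> \<in> idx n" using finM(2)[OF \<open>\<mu> \<in> M\<close>] by simp
        have "c k \<mu> / stab_weight ?s n \<mu> * sym_coeff ?s n \<mu> l =
           (\<Sum>\<kappa>\<in>K. c \<kappa> \<mu> / stab_weight ?t n \<kappa> * sym_coeff ?t n \<kappa> k) / stab_weight ?s n \<mu> * sym_coeff ?s n \<mu> l"
          by (simp only: cf[OF that(1) \<open>\<mu> \<in> idx n\<close>, symmetric])
        also have "\<dots> = (\<Sum>\<kappa>\<in>K. g (\<kappa>, \<mu>) * (sym_coeff ?t n \<kappa> k * sym_coeff ?s n \<mu> l))"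
          unfolding sum_divide_distrib sum_distrib_right by (rule sum.cong) (simp_all add: g_def)
        finally show ?thesis .
      qed
    qed
    also have "\<dots> = (\<Sum>\<kappa>\<in>K. \<Sum>\<mu>\<in>M. g (\<kappa>, \<mu>) * (sym_coeff ?t n \<kappa> k * sym_coeff ?s n \<mu> l))" by (rule sum.swap)
    finally show ?thesis by (simp add: sum.cartesian_product case_prod_unfold)
  qed
  define F where "F = (\<lambda>z. \<Sum>x\<in>K \<times> M. g x * (sym_fun ?t n (fst x) z * sym_fun ?s n (snd x) z))"
  have "is_integrand q V W tens L v w n F"
    unfolding F_def
  proof (rule is_integrand_sym[OF q(1)])
    show "finite (K \<times> M)" using finK(1) finM(1) by simp
    show "fst x \<in> idx n" "snd x \<in> idx n" if "x \<in> K \<times> M" for x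
      using that finK(2)[of "fst x"] finM(2)[of "snd x"] by auto
  qed (simp only: cc c_def[symmetric])
  moreover have "iterated_integral C F n z0 = (2 * of_real pi * \<i>) ^ n * fact n * (\<Sum>\<mu>\<in>M. c (\<lambda>i. - \<mu> i) \<mu> / stab_weight ?s n \<mu>)"
    if C: "separating_contours q n C" for C z0
  proof -
    have "iterated_integral C F n z0 = (2 * of_real pi * \<i>) ^ n * fact n * (\<Sum>x\<in>K \<times> M. g x * sym_coeff ?t n (fst x) (\<lambda>i. - snd x i))"
      unfolding F_def
    proof (rule integral_sym_product)
      show "q^2 \<noteq> 0" using q(1) by simp
      show "finite (K \<times> M)" using finK(1) finM(1) by simp
      show "fst x \<in> idx n" "snd x \<in> idx n" if "x \<in> K \<times> M" for x
        using that finK(2)[of "fst x"] finM(2)[of "snd x"] by auto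
    qed (rule nested_adapted_system[OF separating_contours_nested[OF C q(1)] q(1)])
    also have "(\<Sum>x\<in>K \<times> M. g x * sym_coeff ?t n (fst x) (\<lambda>i. - snd x i)) =
        (\<Sum>\<kappa>\<in>K. \<Sum>\<mu>\<in>M. g (\<kappa>, \<mu>) * sym_coeff ?t n \<kappa> (\<lambda>i. - \<mu> i))"
      by (simp add: sum.cartesian_product case_prod_unfold)
    also have "\<dots> = (\<Sum>\<mu>\<in>M. \<Sum>\<kappa>\<in>K. g (\<kappa>, \<mu>) * sym_coeff ?t n \<kappa> (\<lambda>i. - \<mu> i))" by (rule sum.swap)
    \<comment> \<open>The sum over \<open>K\<close> is the expansion in the first index, evaluated
      at \<open>- \<mu>\<close> and read backwards.\<close>
    also have "\<dots> = (\<Sum>\<mu>\<in>M. c (\<lambda>i. - \<mu> i) \<mu> / stab_weight ?s n \<mu>)"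
    proof (rule sum.cong[OF refl])
      fix \<mu> assume "\<mu> \<in> M"
      then have "\<mu> \<in> idx n" "(\<lambda>i. - \<mu> i) \<in> idx n" using finM(2) by (auto simp: idx_def)
      then have "c (\<lambda>i. - \<mu> i) \<mu> / stab_weight ?s n \<mu> =
         (\<Sum>\<kappa>\<in>K. c \<kappa> \<mu> / stab_weight ?t n \<kappa> * sym_coeff ?t n \<kappa> (\<lambda>i. - \<mu> i)) / stab_weight ?s n \<mu>"
        by (simp only: cf[symmetric])
      also have "\<dots> = (\<Sum>\<kappa>\<in>K. g (\<kappa>, \<mu>) * sym_coeff ?t n \<kappa> (\<lambda>i. - \<mu> i))"
        unfolding sum_divide_distrib by (rule sum.cong) (simp_all add: g_def)
      finally show "(\<Sum>\<kappa>\<in>K. g (\<kappa>, \<mu>) * sym_coeff ?t n \<kappa> (\<lambda>i. - \<mu> i)) = c (\<lambda>i. - \<mu> i) \<mu> / stab_weight ?s n \<mu>" ..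
    qed
    finally show ?thesis .
  qed
  ultimately show ?thesis by blast
qed

section \<open>Operators on tensor products\<close>

lemma vector_space_complex: "vector_space ((*) :: complex \<Rightarrow> complex \<Rightarrow> complex)"
  by unfold_locales (auto simp: algebra_simps)

lemma linearD:
  assumes "Vector_Spaces.linear s1 s2 f"
  shows "vector_space s1" "vector_space s2" "f (x + y) = f x + f y" "f (s1 c x) = s2 c (f x)" "f 0 = 0"
    "f (sum g A) = (\<Sum>a\<in>A. f (g a))"
proof -
  interpret Vector_Spaces.linear s1 s2 f by (rule assms)
  show "vector_space s1" "vector_space s2" "f (x + y) = f x + f y" "f (s1 c x) = s2 c (f x)" "f 0 = 0"
    "f (sum g A) = (\<Sum>a\<in>A. f (g a))"
    by (simp_all add: vs1.vector_space_axioms vs2.vector_space_axioms add scale zero sum)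
qed

lemma linearI':
  assumes "vector_space s1" "vector_space s2" "\<And>x y. f (x + y) = f x + f y" "\<And>c x. f (s1 c x) = s2 c (f x)"
  shows "Vector_Spaces.linear s1 s2 f"
  using assms by (simp add: Vector_Spaces.linear_iff)

lemma linear_comp:
  "Vector_Spaces.linear s1 s2 f \<Longrightarrow> Vector_Spaces.linear s2 s3 g \<Longrightarrow> Vector_Spaces.linear s1 s3 (\<lambda>x. g (f x))"
  by (simp add: Vector_Spaces.linear_iff)

lemma linear_ext:
  assumes "Vector_Spaces.linear s1 s2 f" "Vector_Spaces.linear s1 s2 g"
    and "x \<in> module.span s1 B" "\<And>b. b \<in> B \<Longrightarrow> f b = g b"
  shows "f x = g x"
proof -
  interpret vector_space_pair s1 s2
    using linearD(1,2)[OF assms(1)] by (simp add: vector_space_pair_def)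
  show ?thesis by (rule linear_eq_on[OF assms])
qed

lemma functional_separates:
  fixes s :: "complex \<Rightarrow> 'a::ab_group_add \<Rightarrow> 'a"
  assumes "vector_space s" "x \<notin> module.span s S"
  shows "\<exists>L. Vector_Spaces.linear s (*) L \<and> (\<forall>y\<in>module.span s S. L y = 0) \<and> L x = (1 :: complex)"
proof -
  interpret vs: vector_space_pair s "(*) :: complex \<Rightarrow> complex \<Rightarrow> complex"
    using assms(1) vector_space_complex by (simp add: vector_space_pair_def)
  obtain B where B: "B \<subseteq> vs.vs1.span S" "vs.vs1.independent B" "vs.vs1.span S \<subseteq> vs.vs1.span B"
    using vs.vs1.maximal_independent_subset[of "vs.vs1.span S"] by blast
  have "vs.vs1.span B \<subseteq> vs.vs1.span S" using B(1) by (metis vs.vs1.span_mono vs.vs1.span_span)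
  then have x: "x \<notin> vs.vs1.span B" using assms(2) by blast
  then have "vs.vs1.independent (insert x B)" by (rule vs.vs1.independent_insertI[OF _ B(2)])
  then obtain L where L: "Vector_Spaces.linear s (*) L" "\<forall>y\<in>insert x B. L y = (if y = x then 1 else 0)"
    using vs.linear_independent_extend[of "insert x B" "\<lambda>y. if y = x then 1 else 0"] by blast
  have "L y = 0" if "y \<in> vs.vs1.span S" for y
  proof (rule linear_ext[OF L(1), of "\<lambda>_. 0" y B])
    show "Vector_Spaces.linear s (*) (\<lambda>_. 0)" by (rule linearI') (use assms(1) vector_space_complex in auto)
    show "y \<in> vs.vs1.span B" using that B(3) by blast
    fix b assume "b \<in> B"
    moreover have "x \<notin> B" using x vs.vs1.span_base by blast
    ultimately show "L b = 0" using L(2) by auto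
  qed
  then show ?thesis using L by (intro exI[of _ L]) auto
qed

lemma functionals_eq:
  fixes s :: "complex \<Rightarrow> 'a::ab_group_add \<Rightarrow> 'a"
  assumes vs: "vector_space s" and eq: "\<And>L. Vector_Spaces.linear s (*) L \<Longrightarrow> L x = (L y :: complex)"
  shows "x = y"
proof (rule ccontr)
  assume "x \<noteq> y"
  interpret vector_space s by (rule vs)
  have "x - y \<notin> span {}" using \<open>x \<noteq> y\<close> by simp
  from functional_separates[OF vs this] obtain L where L: "Vector_Spaces.linear s (*) L" "L (x - y) = (1 :: complex)"
    by blast
  have "L x = L ((x - y) + y)" by simp
  also have "\<dots> = 1 + L y" using linearD(3)[OF L(1), of "x - y" y] L(2) by simp
  finally show False using eq[OF L(1)] by simp
qed

lemma bilinear_mapD: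
  assumes "bilinear_map sV sW sT B"
  shows "Vector_Spaces.linear sW sT (B v)" "Vector_Spaces.linear sV sT (\<lambda>v. B v w)"
  using assms by (auto simp: bilinear_map_def)

text \<open>A functional that vanishes on all pure tensors represents the zero form, so it is 0 by
  uniqueness; a vector outside the span would be separated by such a functional.\<close>

lemma tensor_span:
  fixes sT :: "complex \<Rightarrow> 't \<Rightarrow> 't::ab_group_add"
  assumes T: "tensor_product sV sW sT tens" and vs: "vector_space sV" "vector_space sW"
  shows "x \<in> module.span sT {tens v w | v w. True}"
proof (rule ccontr)
  assume "\<not> ?thesis"
  have vT: "vector_space sT" using T by (simp add: tensor_product_def)
  from functional_separates[OF vT \<open>\<not> ?thesis\<close>] obtain L where L: "Vector_Spaces.linear sT (*) L"
    "\<forall>y\<in>module.span sT {tens v w | v w. True}. L y = 0" "L x = (1 :: complex)" by blast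
  interpret vector_space sT by (rule vT)
  have 0: "Vector_Spaces.linear s (*) (\<lambda>_. 0 :: complex)" if "vector_space s" for s :: "complex \<Rightarrow> 'b::ab_group_add \<Rightarrow> 'b"
    using that vector_space_complex by (intro linearI') auto
  have "bilinear_map sV sW (*) (\<lambda>_ _. 0 :: complex)"
    unfolding bilinear_map_def by (intro conjI allI) (use 0 vs vector_space_complex in \<open>auto intro!: linearI'\<close>)
  then have "\<exists>!L. Vector_Spaces.linear sT (*) L \<and> (\<forall>v w. L (tens v w) = (0 :: complex))"
    using T unfolding tensor_product_def by blast
  moreover have "Vector_Spaces.linear sT (*) L \<and> (\<forall>v w. L (tens v w) = 0)"
    using L span_base[of "tens _ _" "{tens v w | v w. True}"] by blast
  moreover have "Vector_Spaces.linear sT (*) (\<lambda>_. 0 :: complex) \<and> (\<forall>v w. (\<lambda>_. 0 :: complex) (tens v w) = 0)"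
    using vT vector_space_complex by (auto intro!: linearI')
  ultimately have "L = (\<lambda>_. 0)" by blast
  then show False using L(3) by simp
qed

text \<open>The universal property provides scalar-valued maps only. So the operator is defined on a
  basis of pure tensors, and its values at the other pure tensors are checked by applying all linear
  functionals.\<close>

lemma tensor_map_exists:
  fixes sT :: "complex \<Rightarrow> 't \<Rightarrow> 't::ab_group_add"
  assumes T: "tensor_product sV sW sT tens"
    and A: "Vector_Spaces.linear sV sV A" and B: "Vector_Spaces.linear sW sW B"
  shows "\<exists>!X. Vector_Spaces.linear sT sT X \<and> (\<forall>v w. X (tens v w) = tens (A v) (B w))"
proof -
  have vs: "vector_space sV" "vector_space sW" using linearD(1) A B by blast+
  have vT: "vector_space sT" and bil: "bilinear_map sV sW sT tens" using T by (auto simp: tensor_product_def)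
  interpret vT: vector_space_pair sT sT using vT by (simp add: vector_space_pair_def)
  let ?S = "{tens v w | v w. True}"
  obtain Bs where Bs: "Bs \<subseteq> ?S" "vT.vs1.independent Bs" "?S \<subseteq> vT.vs1.span Bs"
    using vT.vs1.maximal_independent_subset[of ?S] by blast
  have span: "x \<in> vT.vs1.span Bs" for x
    using tensor_span[OF T vs, of x] vT.vs1.span_minimal[OF Bs(3) vT.vs1.subspace_span] by blast
  have "\<forall>b\<in>Bs. \<exists>y. \<exists>v w. b = tens v w \<and> y = tens (A v) (B w)" using Bs(1) by blast
  from bchoice[OF this] obtain \<phi> where \<phi>: "\<forall>b\<in>Bs. \<exists>v w. b = tens v w \<and> \<phi> b = tens (A v) (B w)" by blast
  obtain X where X: "Vector_Spaces.linear sT sT X" "\<forall>b\<in>Bs. X b = \<phi> b"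
    using vT.linear_independent_extend[OF Bs(2), of \<phi>] by blast
  have val: "X (tens v w) = tens (A v) (B w)" for v w
  proof (rule functionals_eq[OF vT])
    fix L assume L: "Vector_Spaces.linear sT (*) (L :: 't \<Rightarrow> complex)"
    have "bilinear_map sV sW (*) (\<lambda>v w. L (tens (A v) (B w)))"
      unfolding bilinear_map_def
    proof (intro conjI allI)
      show "Vector_Spaces.linear sW (*) (\<lambda>w. L (tens (A v) (B w)))" for v
        by (rule linear_comp[OF B linear_comp[OF bilinear_mapD(1)[OF bil] L]])
      show "Vector_Spaces.linear sV (*) (\<lambda>v. L (tens (A v) (B w)))" for w
        by (rule linear_comp[OF A linear_comp[OF bilinear_mapD(2)[OF bil] L]])
    qed
    then obtain L' where L': "Vector_Spaces.linear sT (*) L'" "\<And>v w. L' (tens v w) = L (tens (A v) (B w))"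
      using T unfolding tensor_product_def by blast
    have "L (X (tens v w)) = L' (tens v w)"
    proof (rule linear_ext[OF linear_comp[OF X(1) L] L'(1) span])
      fix b assume "b \<in> Bs"
      then obtain v w where "b = tens v w" "\<phi> b = tens (A v) (B w)" using \<phi> by blast
      then show "L (X b) = L' b" using X(2) \<open>b \<in> Bs\<close> L'(2) by simp
    qed
    then show "L (X (tens v w)) = L (tens (A v) (B w))" by (simp add: L'(2))
  qed
  show ?thesis
  proof (rule ex1I[of _ X])
    fix Y assume Y: "Vector_Spaces.linear sT sT Y \<and> (\<forall>v w. Y (tens v w) = tens (A v) (B w))"
    have "Y x = X x" for x
      by (rule linear_ext[OF _ X(1) tensor_span[OF T vs]]) (use Y val in auto)
    then show "Y = X" by (simp add: fun_eq_iff)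
  qed (use X val in blast)
qed

lemma tensor_map:
  assumes "tensor_product sV sW sT tens" "Vector_Spaces.linear sV sV A" "Vector_Spaces.linear sW sW B"
  shows "Vector_Spaces.linear sT sT (tensor_map sT tens A B)" "tensor_map sT tens A B (tens v w) = tens (A v) (B w)"
  using theI'[OF tensor_map_exists[OF assms]] unfolding tensor_map_def by auto

section \<open>q-exponentials of locally nilpotent operators\<close>

lemma linear_funpow: "Vector_Spaces.linear s s A \<Longrightarrow> Vector_Spaces.linear s s (A ^^ k)"
proof (induction k)
  case 0
  then show ?case using linearD(1) by (auto intro!: linearI')
next
  case (Suc k)
  then show ?case using linear_comp[of s s "A ^^ k" s A] by (simp add: o_def)
qed

lemma funpow_eq_zero:
  assumes A: "Vector_Spaces.linear s s A" and "(A ^^ K) t = 0" "k \<ge> K"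
  shows "(A ^^ k) t = 0"
proof -
  have "A ^^ k = A ^^ (k - K) \<circ> A ^^ K" using assms(3) by (simp add: funpow_add[symmetric])
  then show ?thesis using assms(2) linearD(5)[OF linear_funpow[OF A]] by simp
qed

text \<open>Any \<open>K\<close> at or beyond the nilpotency order gives the same sum, so several
  vectors can share one range of summation.\<close>

lemma q_exp_eq:
  assumes A: "Vector_Spaces.linear s s A" and z: "(A ^^ K) t = 0"
  shows "q_exp s p A t = (\<Sum>k<K. s (1 / q_factorial p k) ((A ^^ k) t))"
proof -
  interpret vector_space s using linearD(1)[OF A] .
  have "{k. (A ^^ k) t \<noteq> 0} \<subseteq> {..<K}"
  proof
    fix k assume "k \<in> {k. (A ^^ k) t \<noteq> 0}"
    then show "k \<in> {..<K}" using funpow_eq_zero[OF A z, of k] by (cases "K \<le> k") auto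
  qed
  then show ?thesis
    unfolding q_exp_def by (intro sum.mono_neutral_left) auto
qed

lemma q_exp_linear:
  assumes A: "Vector_Spaces.linear s s A" and nil: "\<And>t. \<exists>k. (A ^^ k) t = 0"
  shows "Vector_Spaces.linear s s (q_exp s p A)"
proof -
  have vs: "vector_space s" using linearD(1)[OF A] .
  interpret vector_space s by (rule vs)
  note lin = linearD[OF linear_funpow[OF A]]
  show ?thesis
  proof (rule linearI'[OF vs vs])
    fix x y
    obtain K1 K2 where "(A ^^ K1) x = 0" "(A ^^ K2) y = 0" using nil by blast
    then have K: "(A ^^ max K1 K2) x = 0" "(A ^^ max K1 K2) y = 0" by (auto intro: funpow_eq_zero[OF A])
    then have "(A ^^ max K1 K2) (x + y) = 0" by (simp only: lin(3)) simp
    then show "q_exp s p A (x + y) = q_exp s p A x + q_exp s p A y"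
      unfolding q_exp_eq[OF A K(1)] q_exp_eq[OF A K(2)] by (simp add: q_exp_eq[OF A] lin(3) scale_right_distrib sum.distrib)
  next
    fix c x
    obtain K where K: "(A ^^ K) x = 0" using nil by blast
    then have "(A ^^ K) (s c x) = 0" by (simp only: lin(4)) simp
    then show "q_exp s p A (s c x) = s c (q_exp s p A x)"
      unfolding q_exp_eq[OF A K] by (simp add: q_exp_eq[OF A] lin(4) scale_sum_right scale_left_commute)
  qed
qed

section \<open>Weights\<close>

lemma compositions_0: "compositions 0 = {[]}"
proof -
  have "ms = []" if "0 \<notin> set ms" "sum_list ms = 0" for ms :: "nat list"
    using that by (cases ms) auto
  then show ?thesis by (auto simp: compositions_def)
qed

lemma uq_repD:
  assumes "uq_rep q V"
  shows "vector_space (scl V)" "Vector_Spaces.linear (scl V) (scl V) (eop V n)"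
    "Vector_Spaces.linear (scl V) (scl V) (fop V n)" "Vector_Spaces.linear (scl V) (scl V) (kop V)"
    "bij (kop V)" "Vector_Spaces.linear (scl V) (scl V) (dop V)"
    "drinfeld_relations q V" "degree_relations V"
  using assms by (auto simp: uq_rep_def)

lemma Kplus_0: "vector_space (scl V) \<Longrightarrow> Kplus q V 0 v = kop V v"
  by (simp add: Kplus_def compositions_0 vector_space.vector_space_assms(4))

text \<open>At \<open>m = -1\<close> the terms with \<open>Kplus q V (-1)\<close> vanish and
  \<open>Kplus q V 0\<close> is \<open>kop V\<close>, so the relations between \<open>Kplus\<close>
  and the currents reduce to the weights of the modes.\<close>

lemma kop_eop_fop:
  assumes V: "uq_rep q V" and q: "q \<noteq> 0"
  shows "kop V (eop V n v) = scl V (q^2) (eop V n (kop V v))"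
    "kop V (fop V n v) = scl V (1 / q^2) (fop V n (kop V v))"
proof -
  interpret vector_space "scl V" by (rule uq_repD(1)[OF V])
  define g where "g = q powr (level V / 2)"
  have g: "g \<noteq> 0" using q by (simp add: g_def)
  have "Kplus q V (-1) x = 0" for x by (simp add: Kplus_def)
  moreover have "eop V m 0 = 0" "fop V m 0 = 0" for m using linearD(5)[OF uq_repD(2)[OF V]] linearD(5)[OF uq_repD(3)[OF V]] by auto
  moreover have rel: "scl V g (Kplus q V (-1+1) (eop V n v)) - scl V (q^2) (Kplus q V (-1) (eop V (n+1) v))
        = scl V (q^2 * g) (eop V n (Kplus q V (-1+1) v)) - eop V (n+1) (Kplus q V (-1) v)"
     "scl V (1/g) (Kplus q V (-1+1) (fop V n v)) - scl V (1/q^2) (Kplus q V (-1) (fop V (n+1) v))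
        = scl V (1 / (q^2 * g)) (fop V n (Kplus q V (-1+1) v)) - fop V (n+1) (Kplus q V (-1) v)"
    using uq_repD(7)[OF V] unfolding drinfeld_relations_def Let_def g_def by blast+
  ultimately have "scl V g (kop V (eop V n v)) = scl V (q^2 * g) (eop V n (kop V v))"
    "scl V (1/g) (kop V (fop V n v)) = scl V (1 / (q^2 * g)) (fop V n (kop V v))"
    by (simp_all add: Kplus_0[OF uq_repD(1)[OF V]])
  from arg_cong[OF this(1), of "scl V (1 / g)"] arg_cong[OF this(2), of "scl V g"]
  show "kop V (eop V n v) = scl V (q^2) (eop V n (kop V v))"
    "kop V (fop V n v) = scl V (1 / q^2) (fop V n (kop V v))"
    using g by simp_all
qed

lemma weight_eop_fop:
  assumes V: "uq_rep q V" and q: "q \<noteq> 0" and v: "v \<in> weight_space V \<mu>"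
  shows "eop V n v \<in> weight_space V (fst \<mu> * q powi 2, snd \<mu> + of_int n)"
    "fop V n v \<in> weight_space V (fst \<mu> * q powi (-2), snd \<mu> + of_int n)"
proof -
  interpret vector_space "scl V" by (rule uq_repD(1)[OF V])
  have d: "dop V (eop V n v) = eop V n (dop V v) + scl V (of_int n) (eop V n v)"
    "dop V (fop V n v) = fop V n (dop V v) + scl V (of_int n) (fop V n v)"
  proof -
    have "dop V (eop V n v) - eop V n (dop V v) = scl V (of_int n) (eop V n v)"
      "dop V (fop V n v) - fop V n (dop V v) = scl V (of_int n) (fop V n v)"
      using uq_repD(8)[OF V] unfolding degree_relations_def by blast+
    then show "dop V (eop V n v) = eop V n (dop V v) + scl V (of_int n) (eop V n v)"
      "dop V (fop V n v) = fop V n (dop V v) + scl V (of_int n) (fop V n v)"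
      by (simp_all add: diff_eq_eq add.commute)
  qed
  have kd: "kop V v = scl V (fst \<mu>) v" "dop V v = scl V (snd \<mu>) v" using v by (auto simp: weight_space_def)
  show "eop V n v \<in> weight_space V (fst \<mu> * q powi 2, snd \<mu> + of_int n)"
    "fop V n v \<in> weight_space V (fst \<mu> * q powi (-2), snd \<mu> + of_int n)"
    unfolding weight_space_def
    by (simp_all add: kop_eop_fop[OF V q] d kd linearD(4)[OF uq_repD(2)[OF V]] linearD(4)[OF uq_repD(3)[OF V]]
        scale_left_distrib power_int_minus divide_inverse mult.commute)
qed

lemma foldr_eop_weight:
  assumes V: "uq_rep q V" and q: "q \<noteq> 0" and v: "v \<in> weight_space V \<mu>"
  shows "foldr (eop V) l v \<in> weight_space V (fst \<mu> * q powi (2 * int (length l)), snd \<mu> + of_int (sum_list l))"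
proof (induction l)
  case Nil
  then show ?case using v by simp
next
  case (Cons n l)
  have "q powi (2 * int (length l)) * q powi 2 = q powi (2 * int (length (n # l)))"
    using q by (subst power_int_add[symmetric]) (simp_all add: algebra_simps)
  then show ?case using weight_eop_fop(1)[OF V q Cons, of n] by (simp add: mult.assoc add_ac)
qed

lemma foldr_fop_weight:
  assumes V: "uq_rep q V" and q: "q \<noteq> 0" and v: "v \<in> weight_space V \<mu>"
  shows "foldr (fop V) l v \<in> weight_space V (fst \<mu> * q powi (2 * (- int (length l))), snd \<mu> + of_int (sum_list l))"
proof (induction l)
  case Nil
  then show ?case using v by simp
next
  case (Cons n l)
  have "q powi (2 * (- int (length l))) * q powi (-2) = q powi (2 * (- int (length (n # l))))"
    using q by (subst power_int_add[symmetric]) (simp_all add: algebra_simps)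
  then show ?case using weight_eop_fop(2)[OF V q Cons, of n] by (simp add: mult.assoc add_ac)
qed

text \<open>\<open>k\<close> acts bijectively, so 0 is no eigenvalue; only then can the power of
  \<open>q\<close> be read off from a weight.\<close>

lemma weight_nonzero:
  assumes V: "uq_rep q V" and "v \<in> weight_space V \<mu>" "v \<noteq> 0"
  shows "fst \<mu> \<noteq> 0"
proof
  interpret vector_space "scl V" by (rule uq_repD(1)[OF V])
  assume "fst \<mu> = 0"
  then have "kop V v = 0" using assms(2) by (simp add: weight_space_def)
  then have "kop V v = kop V 0" using linearD(5)[OF uq_repD(4)[OF V]] by simp
  then show False using bij_is_inj[OF uq_repD(5)[OF V]] assms(3) by (simp add: inj_eq)
qed

lemma powi_inject:
  assumes q: "q \<noteq> 0" "\<And>m::nat. m > 0 \<Longrightarrow> q ^ m \<noteq> (1::complex)" and eq: "q powi a = q powi b"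
  shows "a = b"
proof -
  have *: "a = b" if "q powi a = q powi b" "a \<le> b" for a b
  proof (rule ccontr)
    assume "a \<noteq> b"
    have "q powi (b - a) = 1" using that q by (simp add: power_int_diff)
    moreover have "q powi (b - a) = q ^ nat (b - a)" using that by (simp add: power_int_def)
    ultimately show False using q(2)[of "nat (b - a)"] that \<open>a \<noteq> b\<close> by simp
  qed
  show ?thesis using *[of a b] *[of b a] eq by (cases "a \<le> b") auto
qed

text \<open>A weight \<open>\<kappa> - a \<alpha>_0 - b \<alpha>_1\<close> gives
  \<open>S = r \<kappa> - a\<close> and \<open>S + N = r \<kappa> + d \<kappa> - b\<close>, and
  there are finitely many \<open>\<kappa>\<close>.\<close>

lemma weight_bound:
  assumes hw: "highest_weight_rep q V" and q: "q \<noteq> 0" "\<And>m::nat. m > 0 \<Longrightarrow> q ^ m \<noteq> (1::complex)"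
    and \<nu>: "fst \<nu> \<noteq> 0"
  shows "\<exists>A. \<forall>N S. weight_space V (fst \<nu> * q powi (2 * N), snd \<nu> + of_int S) \<noteq> {0} \<longrightarrow> S \<le> A \<and> S + N \<le> (A :: int)"
proof -
  have "\<exists>\<Lambda>. finite \<Lambda> \<and> (\<forall>\<mu>. weight_space V \<mu> \<noteq> {0} \<longrightarrow> (\<exists>\<kappa>\<in>\<Lambda>. \<mu> \<in> lower_cone q \<kappa>))"
    using hw unfolding highest_weight_rep_def by (elim conjE)
  then obtain \<Lambda> where \<Lambda>': "finite \<Lambda> \<and> (\<forall>\<mu>. weight_space V \<mu> \<noteq> {0} \<longrightarrow> (\<exists>\<kappa>\<in>\<Lambda>. \<mu> \<in> lower_cone q \<kappa>))" ..
  have \<Lambda>: "finite \<Lambda>" "\<exists>\<kappa>\<in>\<Lambda>. \<mu> \<in> lower_cone q \<kappa>" if "weight_space V \<mu> \<noteq> {0}" for \<mu>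
    using \<Lambda>' that by blast+
  \<comment> \<open>The exponent is meaningful only for those \<open>\<kappa>\<close> related to
    \<open>\<nu>\<close> by a power of \<open>q^2\<close>; there it is unique because
    \<open>q\<close> is not a root of unity.\<close>
  define d where "d = (\<lambda>\<kappa> :: complex \<times> complex. SOME d. fst \<kappa> = fst \<nu> * q powi (2 * d))"
  define r where "r = (\<lambda>\<kappa> :: complex \<times> complex. \<lfloor>Re (snd \<kappa> - snd \<nu>)\<rfloor>)"
  define A where "A = (\<Sum>\<kappa>\<in>\<Lambda>. \<bar>r \<kappa>\<bar> + \<bar>d \<kappa>\<bar>)"
  have "S \<le> A \<and> S + N \<le> A" if ne: "weight_space V (fst \<nu> * q powi (2 * N), snd \<nu> + of_int S) \<noteq> {0}" for N S
  proof -
    obtain \<kappa> where "\<kappa> \<in> \<Lambda>" "(fst \<nu> * q powi (2 * N), snd \<nu> + of_int S) \<in> lower_cone q \<kappa>"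
      using \<Lambda>(2)[OF ne] by blast
    moreover from this(2) obtain a b where "(fst \<nu> * q powi (2 * N), snd \<nu> + of_int S) =
        (fst \<kappa> * q powi (2 * (int a - int b)), snd \<kappa> - of_nat a)"
      unfolding lower_cone_def by blast
    ultimately have \<kappa>: "\<kappa> \<in> \<Lambda>" "fst \<nu> * q powi (2 * N) = fst \<kappa> * q powi (2 * (int a - int b))"
      "snd \<nu> + of_int S = snd \<kappa> - of_nat a"
      by (simp_all only: prod.inject)
    have "of_int S = snd \<kappa> - snd \<nu> - of_nat a" using \<kappa>(3) by (simp add: algebra_simps)
    from arg_cong[OF this, of Re] have "real_of_int S = Re (snd \<kappa> - snd \<nu>) - real a" by simp
    then have S: "S = r \<kappa> - int a" unfolding r_def by linarith
    have "fst \<kappa> = fst \<nu> * q powi (2 * (N - (int a - int b)))"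
    proof -
      have "fst \<kappa> = fst \<kappa> * q powi (2 * (int a - int b)) * q powi (- (2 * (int a - int b)))"
        using q(1) by (simp only: mult.assoc power_int_minus) simp
      also have "\<dots> = fst \<nu> * (q powi (2 * N) * q powi (- (2 * (int a - int b))))" unfolding \<kappa>(2)[symmetric] by (rule mult.assoc)
      also have "q powi (2 * N) * q powi (- (2 * (int a - int b))) = q powi (2 * (N - (int a - int b)))"
        using q(1) by (subst power_int_add[symmetric]) (simp_all add: algebra_simps)
      finally show ?thesis .
    qed
    then have "fst \<kappa> = fst \<nu> * q powi (2 * d \<kappa>)"
      unfolding d_def by (rule someI[of "\<lambda>d. fst \<kappa> = fst \<nu> * q powi (2 * d)"])
    with \<open>fst \<kappa> = fst \<nu> * q powi (2 * (N - (int a - int b)))\<close>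
    have "fst \<nu> * q powi (2 * (N - (int a - int b))) = fst \<nu> * q powi (2 * d \<kappa>)" by (rule subst)
    with \<nu> have pw: "q powi (2 * (N - (int a - int b))) = q powi (2 * d \<kappa>)"
      by (simp only: mult_cancel_left) simp
    have "2 * (N - (int a - int b)) = 2 * d \<kappa>" by (rule powi_inject[OF q(1) _ pw]) (rule q(2))
    then have "N - (int a - int b) = d \<kappa>" by simp
    then have N: "N = d \<kappa> + int a - int b" by (simp add: algebra_simps)
    have "\<bar>r \<kappa>\<bar> + \<bar>d \<kappa>\<bar> \<le> A" unfolding A_def using \<Lambda>(1)[OF ne] \<kappa>(1) by (intro member_le_sum) auto
    moreover have "r \<kappa> \<le> \<bar>r \<kappa>\<bar>" "d \<kappa> \<le> \<bar>d \<kappa>\<bar>" "0 \<le> \<bar>d \<kappa>\<bar>" by simp_all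
    ultimately show ?thesis using S N by linarith
  qed
  then show ?thesis by blast
qed

lemma foldr_eq_zero:
  assumes "\<And>n. h n 0 = 0" "foldr h l v \<noteq> 0" "l = l1 @ l2"
  shows "foldr h l2 v \<noteq> (0 :: 'v::zero)"
proof
  have z: "foldr h l1 0 = 0" using assms(1) by (induction l1) auto
  assume "foldr h l2 v = 0"
  then show False using assms(2,3) z by simp
qed

text \<open>\<open>foldr\<close> applies the last modes first, so every suffix \<open>l2\<close>
  already has to produce a nonzero vector, and \<open>weight_bound\<close> applies to its
  weight.\<close>

lemma eop_bound:
  assumes hw: "highest_weight_rep q V" and q: "q \<noteq> 0" "\<And>m::nat. m > 0 \<Longrightarrow> q ^ m \<noteq> (1::complex)"
    and v: "v \<in> weight_space V \<nu>"
  shows "\<exists>A. \<forall>l1 l2. foldr (eop V) (l1 @ l2) v \<noteq> 0 \<longrightarrow> sum_list l2 \<le> A \<and> sum_list l2 + int (length l2) \<le> (A :: int)"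
proof (cases "fst \<nu> = 0")
  case True
  have V: "uq_rep q V" using hw by (simp add: highest_weight_rep_def)
  have "v = 0" using weight_nonzero[OF V v] True by blast
  moreover have "foldr (eop V) l 0 = 0" for l using linearD(5)[OF uq_repD(2)[OF V]] by (induction l) auto
  ultimately show ?thesis by simp
next
  case False
  have V: "uq_rep q V" using hw by (simp add: highest_weight_rep_def)
  obtain A where "\<forall>N S. weight_space V (fst \<nu> * q powi (2 * N), snd \<nu> + of_int S) \<noteq> {0} \<longrightarrow> S \<le> A \<and> S + N \<le> A"
    using weight_bound[OF hw q False] ..
  then have A: "S \<le> A \<and> S + N \<le> A" if "weight_space V (fst \<nu> * q powi (2 * N), snd \<nu> + of_int S) \<noteq> {0}" for N S
    using that by blast
  have "sum_list l2 \<le> A \<and> sum_list l2 + int (length l2) \<le> A" if "foldr (eop V) (l1 @ l2) v \<noteq> 0" for l1 l2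
  proof (rule A)
    have "foldr (eop V) l2 v \<noteq> 0" by (rule foldr_eq_zero[OF _ that refl]) (rule linearD(5)[OF uq_repD(2)[OF V]])
    with foldr_eop_weight[OF V q(1) v, of l2]
    show "weight_space V (fst \<nu> * q powi (2 * int (length l2)), snd \<nu> + of_int (sum_list l2)) \<noteq> {0}" by blast
  qed
  then show ?thesis by blast
qed

lemma fop_bound:
  assumes hw: "highest_weight_rep q V" and q: "q \<noteq> 0" "\<And>m::nat. m > 0 \<Longrightarrow> q ^ m \<noteq> (1::complex)"
    and v: "v \<in> weight_space V \<nu>"
  shows "\<exists>A. \<forall>l1 l2. foldr (fop V) (l1 @ l2) v \<noteq> 0 \<longrightarrow> sum_list l2 \<le> A \<and> sum_list l2 - int (length l2) \<le> (A :: int)"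
proof (cases "fst \<nu> = 0")
  case True
  have V: "uq_rep q V" using hw by (simp add: highest_weight_rep_def)
  have "v = 0" using weight_nonzero[OF V v] True by blast
  moreover have "foldr (fop V) l 0 = 0" for l using linearD(5)[OF uq_repD(3)[OF V]] by (induction l) auto
  ultimately show ?thesis by simp
next
  case False
  have V: "uq_rep q V" using hw by (simp add: highest_weight_rep_def)
  obtain A where "\<forall>N S. weight_space V (fst \<nu> * q powi (2 * N), snd \<nu> + of_int S) \<noteq> {0} \<longrightarrow> S \<le> A \<and> S + N \<le> A"
    using weight_bound[OF hw q False] ..
  then have A: "S \<le> A \<and> S + N \<le> A" if "weight_space V (fst \<nu> * q powi (2 * N), snd \<nu> + of_int S) \<noteq> {0}" for N S
    using that by blast
  have "sum_list l2 \<le> A \<and> sum_list l2 + - int (length l2) \<le> A" if "foldr (fop V) (l1 @ l2) v \<noteq> 0" for l1 l2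
  proof (rule A)
    have "foldr (fop V) l2 v \<noteq> 0" by (rule foldr_eq_zero[OF _ that refl]) (rule linearD(5)[OF uq_repD(3)[OF V]])
    with foldr_fop_weight[OF V q(1) v, of l2]
    show "weight_space V (fst \<nu> * q powi (2 * - int (length l2)), snd \<nu> + of_int (sum_list l2)) \<noteq> {0}" by blast
  qed
  then show ?thesis by auto
qed

section \<open>From relations between modes to exchange relations\<close>

lemma to_list_upd2:
  assumes "i \<in> {1..<n}"
  shows "to_list n (k(i := a, Suc i := b)) = map k [1..<i] @ [a, b] @ map k [Suc (Suc i)..<Suc n]"
proof -
  have "[1..<Suc n] = [1..<i] @ [i..<Suc n]"
    using assms upt_add_eq_append[of 1 i "Suc n - i"] by simp
  moreover have "[i..<Suc n] = i # Suc i # [Suc (Suc i)..<Suc n]"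
    using assms by (simp add: upt_conv_Cons del: upt_Suc)
  ultimately show ?thesis by (simp add: to_list_def del: upt_Suc)
qed

lemma linear_foldr:
  assumes "vector_space s" "\<And>n. Vector_Spaces.linear s s (h n)"
  shows "Vector_Spaces.linear s s (foldr h l)"
proof (induction l)
  case Nil
  then show ?case by (auto intro!: linearI' assms(1))
next
  case (Cons n l)
  then show ?case using linear_comp[OF Cons assms(2)[of n]] by (simp add: o_def)
qed

lemma exchange_rel_foldr:
  assumes h: "\<And>n. Vector_Spaces.linear s s (h n)" and \<phi>: "Vector_Spaces.linear s (*) \<phi>"
    and rel: "\<And>m n x. h (m+1) (h n x) - s p (h m (h (n+1) x)) = s p (h n (h (m+1) x)) - h (n+1) (h m x)"
  shows "exchange_rel p n (\<lambda>k. \<phi> (foldr h (to_list n k) v))"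
  unfolding exchange_rel_def
proof (intro ballI)
  fix k i assume i: "i \<in> {1..<n}"
  interpret vector_space s by (rule linearD(1)[OF \<phi>])
  let ?u = "foldr h (map k [Suc (Suc i)..<Suc n]) v"
  define \<psi> where "\<psi> = (\<lambda>x. \<phi> (foldr h (map k [1..<i]) x))"
  have \<psi>: "Vector_Spaces.linear s (*) \<psi>"
    unfolding \<psi>_def by (rule linear_comp[OF linear_foldr[OF linearD(1)[OF \<phi>] h] \<phi>])
  have val: "\<phi> (foldr h (to_list n (k(i := a, Suc i := b))) v) = \<psi> (h a (h b ?u))" for a b
    by (simp add: to_list_upd2[OF i] \<psi>_def del: upt_Suc)
  have diff: "\<psi> (x - y) = \<psi> x - \<psi> y" for x y
    using linearD(3)[OF \<psi>, of "x - y" y] by (simp add: algebra_simps)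
  have "k(i := k i + 1, Suc i := k (Suc i)) = k(i := k i + 1)" by (rule fun_upd_idem) simp
  moreover have "k(i := k i, Suc i := k (Suc i) + 1) = k(Suc i := k (Suc i) + 1)" by simp
  ultimately have val':
    "\<phi> (foldr h (to_list n (k(i := k i + 1))) v) = \<psi> (h (k i + 1) (h (k (Suc i)) ?u))"
    "\<phi> (foldr h (to_list n (k(Suc i := k (Suc i) + 1))) v) = \<psi> (h (k i) (h (k (Suc i) + 1) ?u))"
    using val[of "k i + 1" "k (Suc i)"] val[of "k i" "k (Suc i) + 1"] by (simp_all only:)
  have "\<psi> (h (k i + 1) (h (k (Suc i)) ?u) - s p (h (k i) (h (k (Suc i) + 1) ?u))) =
        \<psi> (s p (h (k (Suc i)) (h (k i + 1) ?u)) - h (k (Suc i) + 1) (h (k i) ?u))"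
    by (simp only: rel)
  then show "\<phi> (foldr h (to_list n (k(i := k i + 1))) v) - p * \<phi> (foldr h (to_list n (k(Suc i := k (Suc i) + 1))) v) =
     p * \<phi> (foldr h (to_list n (k(i := k (Suc i), Suc i := k i + 1))) v) -
     \<phi> (foldr h (to_list n (k(i := k (Suc i) + 1, Suc i := k i))) v)"
    unfolding val' val diff linearD(4)[OF \<psi>] .
qed

lemma eop_fop_exchange:
  assumes V: "uq_rep q V"
  shows "eop V (m+1) (eop V n x) - scl V (q^2) (eop V m (eop V (n+1) x)) =
      scl V (q^2) (eop V n (eop V (m+1) x)) - eop V (n+1) (eop V m x)"
    "fop V (m+1) (fop V n x) - scl V (1/q^2) (fop V m (fop V (n+1) x)) =
      scl V (1/q^2) (fop V n (fop V (m+1) x)) - fop V (n+1) (fop V m x)"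
proof -
  note D = uq_repD(7)[OF V, unfolded drinfeld_relations_def Let_def, THEN spec, THEN spec, THEN spec, of m n x]
  show "eop V (m+1) (eop V n x) - scl V (q^2) (eop V m (eop V (n+1) x)) =
      scl V (q^2) (eop V n (eop V (m+1) x)) - eop V (n+1) (eop V m x)"
    by (rule conjunct1[OF D])
  show "fop V (m+1) (fop V n x) - scl V (1/q^2) (fop V m (fop V (n+1) x)) =
      scl V (1/q^2) (fop V n (fop V (m+1) x)) - fop V (n+1) (fop V m x)"
    by (rule conjunct1[OF conjunct2[OF D]])
qed

text \<open>Weight vectors span, and a bound that is monotone in \<open>M\<close> passes to linear
  combinations by taking maxima. In the applications \<open>i\<close> is a pair of words of modes,
  over which the bound is uniform.\<close>

lemma weight_extend:
  fixes Q :: "'i \<Rightarrow> int \<Rightarrow> bool"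
  assumes hw: "highest_weight_rep q V"
    and \<phi>: "\<And>i. Vector_Spaces.linear (scl V) s (\<phi> i)"
    and mono: "\<And>i M M'. Q i M \<Longrightarrow> M \<le> M' \<Longrightarrow> Q i M'"
    and base: "\<And>\<mu> v. v \<in> weight_space V \<mu> \<Longrightarrow> \<exists>M. \<forall>i. \<phi> i v \<noteq> 0 \<longrightarrow> Q i M"
  shows "\<exists>M. \<forall>i. \<phi> i v \<noteq> 0 \<longrightarrow> Q i M"
proof -
  have V: "uq_rep q V" and sp: "module.span (scl V) (\<Union>\<mu>. weight_space V \<mu>) = UNIV"
    using hw by (simp_all add: highest_weight_rep_def)
  interpret vector_space "scl V" by (rule uq_repD(1)[OF V])
  interpret vs2: vector_space s by (rule linearD(2)[OF \<phi>])
  let ?P = "\<lambda>v. \<exists>M. \<forall>i. \<phi> i v \<noteq> 0 \<longrightarrow> Q i M"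
  have "v \<in> span (\<Union>\<mu>. weight_space V \<mu>)" by (simp add: sp)
  then show "?P v"
  proof (rule span_induct)
    show "subspace (Collect ?P)"
      unfolding subspace_def
    proof (intro conjI ballI allI)
      show "0 \<in> Collect ?P" by (simp add: linearD(5)[OF \<phi>])
      fix x y assume "x \<in> Collect ?P" "y \<in> Collect ?P"
      then obtain M1 M2 where M: "\<forall>i. \<phi> i x \<noteq> 0 \<longrightarrow> Q i M1" "\<forall>i. \<phi> i y \<noteq> 0 \<longrightarrow> Q i M2" by auto
      have "Q i (max M1 M2)" if "\<phi> i (x + y) \<noteq> 0" for i
      proof -
        have "\<phi> i x \<noteq> 0 \<or> \<phi> i y \<noteq> 0" using that linearD(3)[OF \<phi>, of i x y] by auto
        then show ?thesis using M mono[of i M1 "max M1 M2"] mono[of i M2 "max M1 M2"] by auto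
      qed
      then show "x + y \<in> Collect ?P" by blast
    next
      fix c x assume "x \<in> Collect ?P"
      then obtain M where M: "\<forall>i. \<phi> i x \<noteq> 0 \<longrightarrow> Q i M" by auto
      have "Q i M" if "\<phi> i (scl V c x) \<noteq> 0" for i
        using that M linearD(4)[OF \<phi>, of i c x] by auto
      then show "scl V c x \<in> Collect ?P" by blast
    qed
    show "?P x" if "x \<in> (\<Union>\<mu>. weight_space V \<mu>)" for x
      using that base by auto
  qed
qed

lemma tensor_support:
  fixes Q :: "int list \<Rightarrow> int list \<Rightarrow> int \<Rightarrow> bool"
  assumes V: "highest_weight_rep q V" and W: "highest_weight_rep q W"
    and bil: "bilinear_map (scl V) (scl W) sT tens" and L: "Vector_Spaces.linear sT s L"
    and mono: "\<And>ks ls M M'. Q ks ls M \<Longrightarrow> M \<le> M' \<Longrightarrow> Q ks ls M'"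
    and base: "\<And>\<mu> \<nu> v w. v \<in> weight_space V \<mu> \<Longrightarrow> w \<in> weight_space W \<nu> \<Longrightarrow>
      \<exists>M. \<forall>ks ls. L (tens (foldr (fop V) ks v) (foldr (eop W) ls w)) \<noteq> 0 \<longrightarrow> Q ks ls M"
  shows "\<exists>M. \<forall>ks ls. L (tens (foldr (fop V) ks v) (foldr (eop W) ls w)) \<noteq> 0 \<longrightarrow> Q ks ls M"
proof -
  have rV: "uq_rep q V" and rW: "uq_rep q W" using V W by (simp_all add: highest_weight_rep_def)
  note lf = linear_foldr[OF uq_repD(1)[OF rV] uq_repD(3)[OF rV]]
    and le = linear_foldr[OF uq_repD(1)[OF rW] uq_repD(2)[OF rW]]
  let ?Q = "\<lambda>i. Q (fst i) (snd i)"
  let ?\<phi> = "\<lambda>i v w. L (tens (foldr (fop V) (fst i) v) (foldr (eop W) (snd i) w))"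
  have "\<exists>M. \<forall>i. ?\<phi> i v w \<noteq> 0 \<longrightarrow> ?Q i M"
  proof (rule weight_extend[OF V, where \<phi> = "\<lambda>i v. ?\<phi> i v w"])
    show "Vector_Spaces.linear (scl V) s (\<lambda>v. ?\<phi> i v w)" for i
      by (rule linear_comp[OF lf linear_comp[OF bilinear_mapD(2)[OF bil] L]])
    fix \<mu> v assume v: "v \<in> weight_space V \<mu>"
    show "\<exists>M. \<forall>i. ?\<phi> i v w \<noteq> 0 \<longrightarrow> ?Q i M"
    proof (rule weight_extend[OF W, where \<phi> = "\<lambda>i w. ?\<phi> i v w"])
      show "Vector_Spaces.linear (scl W) s (\<lambda>w. ?\<phi> i v w)" for i
        by (rule linear_comp[OF le linear_comp[OF bilinear_mapD(1)[OF bil] L]])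
      fix \<nu> w assume "w \<in> weight_space W \<nu>"
      from base[OF v this] show "\<exists>M. \<forall>i. ?\<phi> i v w \<noteq> 0 \<longrightarrow> ?Q i M" by auto
    qed (rule mono)
  qed (rule mono)
  then show ?thesis by simp
qed

lemma tensor_nonzero_factors:
  assumes "bilinear_map s1 s2 sT tens" "tens x y \<noteq> 0"
  shows "x \<noteq> 0" "y \<noteq> 0"
  using assms linearD(5)[OF bilinear_mapD(1)[OF assms(1), of x]] linearD(5)[OF bilinear_mapD(2)[OF assms(1), of y]] by auto

lemma sum_list_uminus: "sum_list (map uminus l) = - sum_list (l :: int list)"
  by (induction l) auto

text \<open>The \<open>e\<close>-modes bound the suffix sums of \<open>l\<close> from above, the
  \<open>f\<close>-modes with negated indices bound them from below. An entry is a difference of two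
  suffix sums, and the length is controlled by the second inequality for the
  \<open>e\<close>-modes.\<close>

lemma diagonal_support:
  assumes V: "highest_weight_rep q V" and W: "highest_weight_rep q W"
    and q: "q \<noteq> 0" "\<And>m::nat. m > 0 \<Longrightarrow> q ^ m \<noteq> (1::complex)"
    and T: "tensor_product (scl V) (scl W) sT tens"
  shows "\<exists>M. \<forall>l. tens (foldr (fop V) (map uminus l) v) (foldr (eop W) l w) \<noteq> 0 \<longrightarrow> int (length l) \<le> M \<and> set l \<subseteq> {- M..M}"
proof -
  have bil: "bilinear_map (scl V) (scl W) sT tens" and vT: "vector_space sT" using T by (auto simp: tensor_product_def)
  have id: "Vector_Spaces.linear sT sT (\<lambda>x. x)" by (rule linearI'[OF vT vT]) auto
  have "\<exists>M. \<forall>ks ls. tens (foldr (fop V) ks v) (foldr (eop W) ls w) \<noteq> 0 \<longrightarrow>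
     (ks = map uminus ls \<longrightarrow> int (length ls) \<le> M \<and> set ls \<subseteq> {- M..M})"
  proof (rule tensor_support[OF V W bil id])
    show "ks = map uminus ls \<longrightarrow> int (length ls) \<le> M' \<and> set ls \<subseteq> {- M'..M'}"
      if "ks = map uminus ls \<longrightarrow> int (length ls) \<le> M \<and> set ls \<subseteq> {- M..M}" "M \<le> M'" for ks ls M M'
      using that by auto
    fix \<mu> \<nu> v w assume v: "v \<in> weight_space V \<mu>" and w: "w \<in> weight_space W \<nu>"
    obtain A where A: "\<forall>l1 l2. foldr (eop W) (l1 @ l2) w \<noteq> 0 \<longrightarrow> sum_list l2 \<le> A \<and> sum_list l2 + int (length l2) \<le> A"
      using eop_bound[OF W q(1) _ w] q(2) by blast
    obtain B where B: "\<forall>l1 l2. foldr (fop V) (l1 @ l2) v \<noteq> 0 \<longrightarrow> sum_list l2 \<le> B \<and> sum_list l2 - int (length l2) \<le> B"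
      using fop_bound[OF V q(1) _ v] q(2) by blast
    have "int (length l) \<le> \<bar>A\<bar> + \<bar>B\<bar> \<and> set l \<subseteq> {- (\<bar>A\<bar> + \<bar>B\<bar>)..\<bar>A\<bar> + \<bar>B\<bar>}"
      if ne: "tens (foldr (fop V) (map uminus l) v) (foldr (eop W) l w) \<noteq> 0" for l
    proof -
      have sfx: "sum_list l2 \<le> A" "sum_list l2 + int (length l2) \<le> A" "- sum_list l2 \<le> B"
        if "l = l1 @ l2" for l1 l2
      proof -
        have "foldr (eop W) (l1 @ l2) w \<noteq> 0" "foldr (fop V) (map uminus l1 @ map uminus l2) v \<noteq> 0"
          using tensor_nonzero_factors[OF bil ne] that by auto
        then have "sum_list l2 \<le> A \<and> sum_list l2 + int (length l2) \<le> A" "sum_list (map uminus l2) \<le> B"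
          using A B by blast+
        then show "sum_list l2 \<le> A" "sum_list l2 + int (length l2) \<le> A" "- sum_list l2 \<le> B"
          by (simp_all add: sum_list_uminus)
      qed
      have "int (length l) \<le> \<bar>A\<bar> + \<bar>B\<bar>" using sfx[of "[]" l] by simp
      moreover have "x \<in> {- (\<bar>A\<bar> + \<bar>B\<bar>)..\<bar>A\<bar> + \<bar>B\<bar>}" if "x \<in> set l" for x
      proof -
        from split_list[OF that] obtain l1 l2 where l: "l = l1 @ x # l2" by blast
        have "x + sum_list l2 \<le> A" "- (x + sum_list l2) \<le> B" "sum_list l2 \<le> A" "- sum_list l2 \<le> B"
          using sfx[of l1 "x # l2"] sfx[of "l1 @ [x]" l2] l by simp_all
        then show ?thesis unfolding atLeastAtMost_iff by (intro conjI; linarith)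
      qed
      ultimately show ?thesis by blast
    qed
    then show "\<exists>M. \<forall>ks ls. tens (foldr (fop V) ks v) (foldr (eop W) ls w) \<noteq> 0 \<longrightarrow>
       (ks = map uminus ls \<longrightarrow> int (length ls) \<le> M \<and> set ls \<subseteq> {- M..M})" by blast
  qed
  then show ?thesis by blast
qed

text \<open>As \<open>q\<close> is not a root of unity, the weight determines \<open>(N, k)\<close>,
  so finitely many weights come from finitely many pairs.\<close>

lemma finite_weights_bound:
  fixes \<mu> :: "complex \<times> complex"
  assumes q: "q \<noteq> 0" "\<And>m::nat. m > 0 \<Longrightarrow> q ^ m \<noteq> (1::complex)" and \<mu>: "fst \<mu> \<noteq> 0" and fin: "finite S"
  shows "\<exists>M. \<forall>N k. (fst \<mu> * q powi (2 * N), snd \<mu> + of_int k) \<in> S \<longrightarrow> \<bar>N\<bar> \<le> M \<and> \<bar>k\<bar> \<le> (M :: int)"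
proof -
  let ?g = "\<lambda>(N, k). (fst \<mu> * q powi (2 * N), snd \<mu> + of_int k :: complex)"
  have "inj ?g"
  proof (rule injI)
    fix x y assume eq: "?g x = ?g y"
    obtain N k N' k' where xy: "x = (N, k)" "y = (N', k')" by (cases x, cases y)
    have "q powi (2 * N) = q powi (2 * N')" using eq \<mu> xy by simp
    then have "2 * N = 2 * N'" by (rule powi_inject[OF q(1), rotated]) (rule q(2))
    then show "x = y" using eq xy by simp
  qed
  then have f: "finite (?g -` S)" by (rule finite_vimageI[OF fin])
  let ?M = "\<Sum>(N, k)\<in>?g -` S. \<bar>N\<bar> + \<bar>k\<bar>"
  have "\<bar>N\<bar> \<le> ?M \<and> \<bar>k\<bar> \<le> ?M" if "(fst \<mu> * q powi (2 * N), snd \<mu> + of_int k) \<in> S" for N k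
  proof -
    have "(\<lambda>(N, k). \<bar>N\<bar> + \<bar>k\<bar>) (N, k) \<le> ?M" by (rule member_le_sum) (use f that in auto)
    then have "\<bar>N\<bar> + \<bar>k\<bar> \<le> ?M" by simp
    then show ?thesis by (intro conjI; linarith)
  qed
  then show ?thesis by blast
qed

text \<open>A form in the restricted dual sees finitely many pairs of weights, which bounds length
  and degrees. The last entry is a suffix of length one, hence bounded above; in an increasing word
  it is the largest entry.\<close>

lemma coefficient_support:
  assumes V: "highest_weight_rep q V" and W: "highest_weight_rep q W"
    and q: "q \<noteq> 0" "\<And>m::nat. m > 0 \<Longrightarrow> q ^ m \<noteq> (1::complex)"
    and T: "tensor_product (scl V) (scl W) sT tens" and L: "L \<in> restricted_dual V W sT tens"
  shows "\<exists>M. \<forall>ks ls. L (tens (foldr (fop V) ks v) (foldr (eop W) ls w)) \<noteq> 0 \<longrightarrow>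
    int (length ks) \<le> M \<and> \<bar>sum_list ks\<bar> \<le> M \<and> \<bar>sum_list ls\<bar> \<le> M \<and>
    (\<forall>xs x. ks = xs @ [x] \<longrightarrow> x \<le> M) \<and> (\<forall>xs x. ls = xs @ [x] \<longrightarrow> x \<le> M)"
proof -
  have bil: "bilinear_map (scl V) (scl W) sT tens" using T by (auto simp: tensor_product_def)
  have rV: "uq_rep q V" and rW: "uq_rep q W" using V W by (simp_all add: highest_weight_rep_def)
  have lin: "Vector_Spaces.linear sT (*) L"
    and fin: "finite {(\<mu>, \<nu>). \<exists>v\<in>weight_space V \<mu>. \<exists>w\<in>weight_space W \<nu>. L (tens v w) \<noteq> 0}" (is "finite ?S")
    using L by (auto simp: restricted_dual_def)
  show ?thesis
  proof (rule tensor_support[OF V W bil lin], goal_cases)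
    case (1 ks ls M M')
    then show ?case by force
  next
    case (2 \<mu> \<nu> v w)
    note v = 2(1) and w = 2(2)
    have ne: "foldr (fop V) ks v \<noteq> 0" "foldr (eop W) ls w \<noteq> 0"
      if "L (tens (foldr (fop V) ks v) (foldr (eop W) ls w)) \<noteq> 0" for ks ls
    proof -
      have "tens (foldr (fop V) ks v) (foldr (eop W) ls w) \<noteq> 0" using that linearD(5)[OF lin] by auto
      then show "foldr (fop V) ks v \<noteq> 0" "foldr (eop W) ls w \<noteq> 0" by (rule tensor_nonzero_factors[OF bil])+
    qed
    show ?case
    proof (cases "fst \<mu> = 0 \<or> fst \<nu> = 0")
      case True
      then have "v = 0 \<or> w = 0" using weight_nonzero[OF rV v] weight_nonzero[OF rW w] by blast
      moreover have "foldr (fop V) l 0 = 0" "foldr (eop W) l 0 = 0" for l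
        using linearD(5)[OF linear_foldr[where h = "fop V", OF uq_repD(1)[OF rV] uq_repD(3)[OF rV]]]
          linearD(5)[OF linear_foldr[where h = "eop W", OF uq_repD(1)[OF rW] uq_repD(2)[OF rW]]] by auto
      ultimately show ?thesis using ne by blast
    next
      case False
      obtain A where A: "\<forall>l1 l2. foldr (eop W) (l1 @ l2) w \<noteq> 0 \<longrightarrow> sum_list l2 \<le> A \<and> sum_list l2 + int (length l2) \<le> A"
        using eop_bound[OF W q(1) _ w] q(2) by blast
      obtain B where B: "\<forall>l1 l2. foldr (fop V) (l1 @ l2) v \<noteq> 0 \<longrightarrow> sum_list l2 \<le> B \<and> sum_list l2 - int (length l2) \<le> B"
        using fop_bound[OF V q(1) _ v] q(2) by blast
      obtain M1 where M1: "\<forall>N k. (fst \<mu> * q powi (2 * N), snd \<mu> + of_int k) \<in> fst ` ?S \<longrightarrow> \<bar>N\<bar> \<le> M1 \<and> \<bar>k\<bar> \<le> M1"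
        using finite_weights_bound[OF q(1) _ _ finite_imageI[OF fin], of \<mu>] q(2) False by blast
      obtain M2 where M2: "\<forall>N k. (fst \<nu> * q powi (2 * N), snd \<nu> + of_int k) \<in> snd ` ?S \<longrightarrow> \<bar>N\<bar> \<le> M2 \<and> \<bar>k\<bar> \<le> M2"
        using finite_weights_bound[OF q(1) _ _ finite_imageI[OF fin], of \<nu>] q(2) False by blast
      define M where "M = \<bar>A\<bar> + \<bar>B\<bar> + \<bar>M1\<bar> + \<bar>M2\<bar>"
      have "int (length ks) \<le> M \<and> \<bar>sum_list ks\<bar> \<le> M \<and> \<bar>sum_list ls\<bar> \<le> M \<and>
        (\<forall>xs x. ks = xs @ [x] \<longrightarrow> x \<le> M) \<and> (\<forall>xs x. ls = xs @ [x] \<longrightarrow> x \<le> M)"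
        if n0: "L (tens (foldr (fop V) ks v) (foldr (eop W) ls w)) \<noteq> 0" for ks ls
      proof -
        let ?\<mu> = "(fst \<mu> * q powi (2 * - int (length ks)), snd \<mu> + of_int (sum_list ks))"
        let ?\<nu> = "(fst \<nu> * q powi (2 * int (length ls)), snd \<nu> + of_int (sum_list ls))"
        have "(?\<mu>, ?\<nu>) \<in> ?S"
          using foldr_fop_weight[OF rV q(1) v, of ks] foldr_eop_weight[OF rW q(1) w, of ls] n0 by blast
        then have "?\<mu> \<in> fst ` ?S" "?\<nu> \<in> snd ` ?S" by force+
        then have "\<bar>- int (length ks)\<bar> \<le> M1 \<and> \<bar>sum_list ks\<bar> \<le> M1" "\<bar>sum_list ls\<bar> \<le> M2"
          using M1 M2 by blast+
        moreover have "x \<le> B" if "ks = xs @ [x]" for xs x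
          using B[rule_format, of xs "[x]"] ne(1)[OF n0] that by simp
        moreover have "x \<le> A" if "ls = xs @ [x]" for xs x
          using A[rule_format, of xs "[x]"] ne(2)[OF n0] that by simp
        ultimately show ?thesis unfolding M_def by force
      qed
      then show ?thesis by blast
    qed
  qed
qed

section \<open>The ordered product\<close>

text \<open>The denominators that the q-exponentials contribute along a word, one q-factorial for
  each distinct letter.\<close>

definition mult_weight :: "complex \<Rightarrow> int list \<Rightarrow> complex" where
  "mult_weight s l = (\<Prod>x\<in>set l. q_factorial s (count_list l x))"

lemma foldr_replicate_funpow: "foldr h (replicate k n @ l) v = (h n ^^ k) (foldr h l v)"
  by (induction k) auto

lemma count_list_replicate: "count_list (replicate k n) x = (if x = n then k else 0)"
  by (induction k) auto

lemma mult_weight_replicate: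
  assumes "n \<notin> set l"
  shows "mult_weight s (replicate k n @ l) = q_factorial s k * mult_weight s l"
proof (cases "k = 0")
  case True
  then show ?thesis by (simp add: q_factorial_def)
next
  case False
  have "count_list l n = 0" using assms by (simp add: count_list_0_iff)
  then have "mult_weight s (replicate k n @ l) = q_factorial s k * (\<Prod>x\<in>set l. q_factorial s (count_list (replicate k n @ l) x))"
    using False assms by (simp add: mult_weight_def count_list_replicate)
  also have "(\<Prod>x\<in>set l. q_factorial s (count_list (replicate k n @ l) x)) = mult_weight s l"
    unfolding mult_weight_def by (rule prod.cong) (use assms in \<open>auto simp: count_list_replicate\<close>)
  finally show ?thesis .
qed

definition sorted_lists :: "int set \<Rightarrow> nat \<Rightarrow> int list set" where
  "sorted_lists S M = {l. sorted l \<and> set l \<subseteq> S \<and> length l \<le> M}"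

lemma finite_sorted_lists: "finite S \<Longrightarrow> finite (sorted_lists S M)"
  unfolding sorted_lists_def by (rule finite_subset[OF _ finite_lists_length_le[of S M]]) auto

lemma sorted_list_split:
  fixes n :: int
  assumes "sorted l" "\<forall>x\<in>set l. n \<le> x"
  shows "\<exists>k l'. l = replicate k n @ l' \<and> sorted l' \<and> (\<forall>x\<in>set l'. n < x)"
  using assms
proof (induction l)
  case Nil
  then show ?case by simp
next
  case (Cons x l)
  show ?case
  proof (cases "x = n")
    case True
    obtain k l' where "l = replicate k n @ l'" "sorted l'" "\<forall>x\<in>set l'. n < x" using Cons by auto
    then show ?thesis using True by (intro exI[of _ "Suc k"] exI[of _ l']) simp
  next
    case False
    then show ?thesis using Cons.prems by (intro exI[of _ 0] exI[of _ "x # l"]) fastforce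
  qed
qed

lemma replicate_append_inject:
  assumes "n \<notin> set l" "n \<notin> set l'" "replicate k n @ l = replicate k' n @ l'"
  shows "k = k' \<and> l = l'"
proof -
  have "takeWhile (\<lambda>x. x = n) (replicate k n @ l) = replicate k n" if "n \<notin> set l" for k l
    using that by (cases l) (auto simp: takeWhile_append)
  from this[OF assms(1), of k] this[OF assms(2), of k'] have "replicate k n = replicate k' n"
    by (simp only: assms(3))
  then have "length (replicate k n) = length (replicate k' n)" by (rule arg_cong)
  then have "k = k'" by simp
  with assms(3) show ?thesis by simp
qed

locale tensor_pair =
  fixes q :: complex and V :: "('v::ab_group_add) uq_module" and W :: "('w::ab_group_add) uq_module"
    and sT :: "complex \<Rightarrow> 't \<Rightarrow> 't::ab_group_add" and tens :: "'v \<Rightarrow> 'w \<Rightarrow> 't"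
  assumes q_nonzero: "q \<noteq> 0"
    and q_generic: "\<And>m::nat. m > 0 \<Longrightarrow> q ^ m \<noteq> 1"
    and V: "highest_weight_rep q V"
    and W: "highest_weight_rep q W"
    and T: "tensor_product (scl V) (scl W) sT tens"
begin

abbreviation A :: "int \<Rightarrow> 't \<Rightarrow> 't" where "A \<equiv> R_exponent q V W sT tens"

abbreviation diag :: "'v \<Rightarrow> 'w \<Rightarrow> int list \<Rightarrow> 't" where
  "diag v w l \<equiv> tens (foldr (fop V) (map uminus l) v) (foldr (eop W) l w)"

lemma rV: "uq_rep q V" and rW: "uq_rep q W"
  using V W by (simp_all add: highest_weight_rep_def)

lemma vT: "vector_space sT" and bil: "bilinear_map (scl V) (scl W) sT tens"
  using T by (simp_all add: tensor_product_def)

sublocale vsT: vector_space sT by (rule vT)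

lemma A_linear: "Vector_Spaces.linear sT sT (A n)"
proof -
  note X = tensor_map(1)[OF T uq_repD(3)[OF rV, of "-n"] uq_repD(2)[OF rW, of n]]
  show ?thesis unfolding R_exponent_def[abs_def]
    by (rule linearI'[OF vT vT]) (simp_all add: linearD(3,4)[OF X] vsT.scale_right_distrib mult.commute del: minus_diff_eq)
qed

lemma A_tens: "A n (tens x y) = sT (1 / q - q) (tens (fop V (- n) x) (eop W n y))"
  by (simp add: R_exponent_def tensor_map(2)[OF T uq_repD(3)[OF rV] uq_repD(2)[OF rW]])

lemma A_funpow_tens: "(A n ^^ k) (tens x y) = sT ((1 / q - q) ^ k) (tens ((fop V (- n) ^^ k) x) ((eop W n ^^ k) y))"
proof (induction k)
  case 0
  then show ?case by simp
next
  case (Suc k)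
  then show ?case by (simp add: linearD(4)[OF A_linear] A_tens mult.commute)
qed

lemma A_funpow_diag: "(A n ^^ k) (diag v w l) = sT ((1 / q - q) ^ k) (diag v w (replicate k n @ l))"
  using foldr_replicate_funpow[of "fop V" k "-n" "map uminus l" v] foldr_replicate_funpow[of "eop W" k n l w]
  by (simp add: A_funpow_tens)

lemma diag_bound: "\<exists>M. \<forall>l. diag v w l \<noteq> 0 \<longrightarrow> length l \<le> M \<and> set l \<subseteq> {- int M..int M}"
proof -
  obtain M where M: "\<forall>l. diag v w l \<noteq> 0 \<longrightarrow> int (length l) \<le> M \<and> set l \<subseteq> {- M..M}"
    using diagonal_support[OF V W q_nonzero q_generic T, of v w] by blast
  have "length l \<le> nat M \<and> set l \<subseteq> {- int (nat M)..int (nat M)}" if "diag v w l \<noteq> 0" for l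
    using M[rule_format, OF that] by (auto simp: subset_iff)
  then show ?thesis by blast
qed

lemma tensors_induct:
  assumes tens: "\<And>v w. P (tens v w)" and zero: "P 0" and add: "\<And>x y. P x \<Longrightarrow> P y \<Longrightarrow> P (x + y)"
    and scale: "\<And>c x. P x \<Longrightarrow> P (sT c x)"
  shows "P t"
proof -
  have "t \<in> vsT.span {tens v w | v w. True}"
    by (rule tensor_span[OF T uq_repD(1)[OF rV] uq_repD(1)[OF rW]])
  then show ?thesis
    by (rule vsT.span_induct) (auto simp: vsT.subspace_def intro: assms)
qed

lemma A_nilpotent: "\<exists>k. (A n ^^ k) t = 0"
proof (induction t rule: tensors_induct)
  fix v w
  obtain M where M': "\<forall>l. diag v w l \<noteq> 0 \<longrightarrow> length l \<le> M \<and> set l \<subseteq> {- int M..int M}"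
    using diag_bound ..
  note M = M'[rule_format]
  have "diag v w (replicate (Suc M) n) = 0" using M[of "replicate (Suc M) n"] by fastforce
  then show "\<exists>k. (A n ^^ k) (tens v w) = 0" using A_funpow_diag[where n = n and k = "Suc M" and v = v and w = w and l = "[]"] by (intro exI[of _ "Suc M"]) simp
next
  show "\<exists>k. (A n ^^ k) 0 = 0" by (rule exI[of _ 0]) simp
next
  fix x y assume "\<exists>k. (A n ^^ k) x = 0" "\<exists>k. (A n ^^ k) y = 0"
  then obtain k1 k2 where k: "(A n ^^ k1) x = 0" "(A n ^^ k2) y = 0" by blast
  have "(A n ^^ (k1 + k2)) x = 0" "(A n ^^ (k1 + k2)) y = 0"
    using funpow_eq_zero[OF A_linear k(1), of "k1 + k2"] funpow_eq_zero[OF A_linear k(2), of "k1 + k2"] by simp_all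
  then show "\<exists>k. (A n ^^ k) (x + y) = 0"
    using linearD(3)[OF linear_funpow[OF A_linear[of n], of "k1 + k2"], of x y] by (intro exI[of _ "k1 + k2"]) simp
next
  fix c x assume "\<exists>k. (A n ^^ k) x = 0"
  then obtain k where "(A n ^^ k) x = 0" by blast
  then show "\<exists>k. (A n ^^ k) (sT c x) = 0"
    using linearD(4)[OF linear_funpow[OF A_linear[of n], of k], of c x] by (intro exI[of _ k]) simp
qed

abbreviation E :: "int \<Rightarrow> 't \<Rightarrow> 't" where "E n \<equiv> q_exp sT (q^2) (A n)"

lemma E_linear: "Vector_Spaces.linear sT sT (E n)"
  by (rule q_exp_linear[OF A_linear A_nilpotent])

abbreviation diag_term :: "'v \<Rightarrow> 'w \<Rightarrow> int list \<Rightarrow> 't" where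
  "diag_term v w l \<equiv> sT ((1 / q - q) ^ length l / mult_weight (q^2) l) (diag v w l)"

text \<open>The factor of the least index \<open>n\<close> acts last and puts \<open>k\<close>
  copies of \<open>n\<close> in front of a sorted word, dividing by
  \<open>q_factorial (q^2) k\<close>. Thus the ordered product runs through each sorted word
  once.\<close>

lemma E_foldr_tens:
  assumes M: "\<And>l. diag v w l \<noteq> 0 \<Longrightarrow> length l \<le> M" and ns: "sorted_wrt (<) ns"
  shows "foldr E ns (tens v w) = (\<Sum>l\<in>sorted_lists (set ns) M. diag_term v w l)"
  using ns
proof (induction ns)
  case Nil
  have "sorted_lists {} M = {[]}" by (auto simp: sorted_lists_def)
  then show ?case by (simp add: mult_weight_def)
next
  case (Cons n ns)
  let ?c = "1 / q - q" and ?S = "sorted_lists (set ns) M"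
  have ns: "n \<notin> set l" "\<forall>x\<in>set l. n < x" if "l \<in> ?S" for l
    using that Cons.prems by (auto simp: sorted_lists_def)
  have zero: "diag v w l = 0" if "length l > M" for l using M[of l] that by force
  have E: "E n (diag_term v w l) = (\<Sum>k<Suc M. diag_term v w (replicate k n @ l))" if l: "l \<in> ?S" for l
  proof -
    \<comment> \<open>Prepending \<open>Suc M\<close> letters exceeds the length that a nonzero word
      can have.\<close>
    have "(A n ^^ Suc M) (diag v w l) = 0"
      unfolding A_funpow_diag using zero[of "replicate (Suc M) n @ l"] by simp
    from q_exp_eq[OF A_linear this, of "q^2"]
    have "E n (diag v w l) = (\<Sum>k<Suc M. sT (1 / q_factorial (q^2) k * ?c ^ k) (diag v w (replicate k n @ l)))"
      by (simp only: A_funpow_diag vsT.scale_scale)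
    then have "E n (diag_term v w l) = (\<Sum>k<Suc M. sT (?c ^ length l / mult_weight (q^2) l * (1 / q_factorial (q^2) k * ?c ^ k)) (diag v w (replicate k n @ l)))"
      by (simp only: linearD(4)[OF E_linear] vsT.scale_sum_right vsT.scale_scale)
    also have "\<dots> = (\<Sum>k<Suc M. diag_term v w (replicate k n @ l))"
      by (rule sum.cong) (use mult_weight_replicate[OF ns(1)[OF l]] in \<open>simp_all add: power_add mult_ac\<close>)
    finally show ?thesis .
  qed
  have fin: "finite ?S" by (rule finite_sorted_lists) simp
  have "foldr E (n # ns) (tens v w) = (\<Sum>l\<in>?S. E n (diag_term v w l))"
    using Cons by (simp add: linearD(6)[OF E_linear])
  also have "\<dots> = (\<Sum>l\<in>?S. \<Sum>k<Suc M. diag_term v w (replicate k n @ l))"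
    by (rule sum.cong) (use E in auto)
  also have "\<dots> = (\<Sum>(l, k)\<in>?S \<times> {..<Suc M}. diag_term v w (replicate k n @ l))"
    by (rule sum.cartesian_product)
  also have "\<dots> = (\<Sum>l\<in>(\<lambda>(l, k). replicate k n @ l) ` (?S \<times> {..<Suc M}). diag_term v w l)"
  proof -
    have "inj_on (\<lambda>(l, k). replicate k n @ l) (?S \<times> {..<Suc M})"
    proof (rule inj_onI)
      fix x y assume xy: "x \<in> ?S \<times> {..<Suc M}" "y \<in> ?S \<times> {..<Suc M}"
        "(\<lambda>(l, k). replicate k n @ l) x = (\<lambda>(l, k). replicate k n @ l) y"
      obtain l k l' k' where lk: "x = (l, k)" "y = (l', k')" by (cases x, cases y)
      have "n \<notin> set l" by (rule ns(1)) (use xy(1) lk in simp)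
      moreover have "n \<notin> set l'" by (rule ns(1)) (use xy(2) lk in simp)
      moreover have "replicate k n @ l = replicate k' n @ l'" using xy(3) unfolding lk by simp
      ultimately have "k = k' \<and> l = l'" by (rule replicate_append_inject)
      then show "x = y" by (simp add: lk)
    qed
    from sum.reindex[OF this, of "diag_term v w"] show ?thesis
      by (simp only: o_def case_prod_unfold)
  qed
  \<comment> \<open>The image also contains words longer than \<open>M\<close>; their terms
    vanish.\<close>
  also have "\<dots> = (\<Sum>l\<in>sorted_lists (set (n # ns)) M. diag_term v w l)"
  proof (rule sum.mono_neutral_right)
    show "finite ((\<lambda>(l, k). replicate k n @ l) ` (?S \<times> {..<Suc M}))" using fin by auto
    show "sorted_lists (set (n # ns)) M \<subseteq> (\<lambda>(l, k). replicate k n @ l) ` (?S \<times> {..<Suc M})"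
    proof
      fix l assume l: "l \<in> sorted_lists (set (n # ns)) M"
      then have srt: "sorted l" and sub: "set l \<subseteq> insert n (set ns)" by (auto simp: sorted_lists_def)
      have "\<forall>x\<in>set l. n \<le> x"
      proof
        fix x assume "x \<in> set l"
        then have "x = n \<or> x \<in> set ns" using sub by auto
        then show "n \<le> x" using Cons.prems by auto
      qed
      from sorted_list_split[OF srt this] obtain k l' where kl: "l = replicate k n @ l'" "sorted l'" "\<forall>x\<in>set l'. n < x" by blast
      then have "l' \<in> ?S" "k < Suc M" using l by (auto simp: sorted_lists_def)
      then have "(\<lambda>(l, k). replicate k n @ l) (l', k) \<in> (\<lambda>(l, k). replicate k n @ l) ` (?S \<times> {..<Suc M})"
        by (intro imageI) auto
      then show "l \<in> (\<lambda>(l, k). replicate k n @ l) ` (?S \<times> {..<Suc M})" by (simp only: kl(1) prod.case)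
    qed
    show "\<forall>l\<in>(\<lambda>(l, k). replicate k n @ l) ` (?S \<times> {..<Suc M}) - sorted_lists (set (n # ns)) M. diag_term v w l = 0"
    proof
      fix l assume l: "l \<in> (\<lambda>(l, k). replicate k n @ l) ` (?S \<times> {..<Suc M}) - sorted_lists (set (n # ns)) M"
      then obtain l' k where lk: "l = replicate k n @ l'" "l' \<in> ?S" by auto
      have "sorted l" "set l \<subseteq> set (n # ns)"
        using lk ns(2)[OF lk(2)] by (auto simp: sorted_append sorted_lists_def)
      then have "length l > M" using l by (auto simp: sorted_lists_def)
      then show "diag_term v w l = 0" by (simp add: zero)
    qed
  qed
  finally show ?case .
qed

text \<open>Letters outside \<open>{- int M..int M}\<close> occur only in vanishing terms, so the
  finite products are constant from \<open>N = M\<close> on.\<close>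

lemma R_partial_tens:
  assumes M: "\<And>l. diag v w l \<noteq> 0 \<Longrightarrow> length l \<le> M \<and> set l \<subseteq> {- int M..int M}" and "M \<le> N"
  shows "R_partial q V W sT tens N (tens v w) = (\<Sum>l\<in>sorted_lists {- int M..int M} M. diag_term v w l)"
proof -
  have "R_partial q V W sT tens N (tens v w) = (\<Sum>l\<in>sorted_lists (set [- int N..int N]) M. diag_term v w l)"
    unfolding R_partial_def by (rule E_foldr_tens) (use M in \<open>auto intro: sorted_wrt_upto\<close>)
  also have "\<dots> = (\<Sum>l\<in>sorted_lists {- int M..int M} M. diag_term v w l)"
  proof (rule sum.mono_neutral_right)
    show "finite (sorted_lists (set [- int N..int N]) M)" by (rule finite_sorted_lists) simp
    show "sorted_lists {- int M..int M} M \<subseteq> sorted_lists (set [- int N..int N]) M"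
      using \<open>M \<le> N\<close> by (fastforce simp: sorted_lists_def)
    show "\<forall>l\<in>sorted_lists (set [- int N..int N]) M - sorted_lists {- int M..int M} M. diag_term v w l = 0"
    proof
      fix l assume "l \<in> sorted_lists (set [- int N..int N]) M - sorted_lists {- int M..int M} M"
      then have "\<not> set l \<subseteq> {- int M..int M}" unfolding sorted_lists_def by blast
      then have "diag v w l = 0" using M by blast
      then show "diag_term v w l = 0" by simp
    qed
  qed
  finally show ?thesis .
qed

lemma R_partial_linear: "Vector_Spaces.linear sT sT (R_partial q V W sT tens N)"
  unfolding R_partial_def by (rule linear_foldr[where h = E, OF vT E_linear])

lemma R_partial_eventually: "\<exists>x. \<forall>\<^sub>F N in sequentially. R_partial q V W sT tens N t = x"
proof (induction t rule: tensors_induct)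
  fix v w
  obtain M where M': "\<forall>l. diag v w l \<noteq> 0 \<longrightarrow> length l \<le> M \<and> set l \<subseteq> {- int M..int M}"
    using diag_bound ..
  note M = M'[rule_format]
  show "\<exists>x. \<forall>\<^sub>F N in sequentially. R_partial q V W sT tens N (tens v w) = x"
    using R_partial_tens[OF M] by (intro exI eventually_sequentiallyI)
next
  show "\<exists>x. \<forall>\<^sub>F N in sequentially. R_partial q V W sT tens N 0 = x"
    by (intro exI[of _ 0] always_eventually allI linearD(5)[OF R_partial_linear])
next
  fix x y assume "\<exists>x'. \<forall>\<^sub>F N in sequentially. R_partial q V W sT tens N x = x'"
    "\<exists>y'. \<forall>\<^sub>F N in sequentially. R_partial q V W sT tens N y = y'"
  then obtain x' y' where "\<forall>\<^sub>F N in sequentially. R_partial q V W sT tens N x = x'"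
    "\<forall>\<^sub>F N in sequentially. R_partial q V W sT tens N y = y'" by blast
  then have "\<forall>\<^sub>F N in sequentially. R_partial q V W sT tens N (x + y) = x' + y'"
    by eventually_elim (simp add: linearD(3)[OF R_partial_linear])
  then show "\<exists>x'. \<forall>\<^sub>F N in sequentially. R_partial q V W sT tens N (x + y) = x'" ..
next
  fix c x assume "\<exists>x'. \<forall>\<^sub>F N in sequentially. R_partial q V W sT tens N x = x'"
  then obtain x' where "\<forall>\<^sub>F N in sequentially. R_partial q V W sT tens N x = x'" by blast
  then have "\<forall>\<^sub>F N in sequentially. R_partial q V W sT tens N (sT c x) = sT c x'"
    by eventually_elim (simp add: linearD(4)[OF R_partial_linear])
  then show "\<exists>x'. \<forall>\<^sub>F N in sequentially. R_partial q V W sT tens N (sT c x) = x'" ..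
qed

lemma R_bar_exists: "\<exists>R. is_R_bar q V W sT tens R"
proof -
  have "\<exists>R. \<forall>t. \<forall>\<^sub>F N in sequentially. R_partial q V W sT tens N t = R t"
    by (rule choice) (use R_partial_eventually in blast)
  then show ?thesis unfolding is_R_bar_def using A_nilpotent by blast
qed

lemma R_bar_tens:
  assumes R: "is_R_bar q V W sT tens R"
    and M: "\<And>l. diag v w l \<noteq> 0 \<Longrightarrow> length l \<le> M \<and> set l \<subseteq> {- int M..int M}"
  shows "R (tens v w) = (\<Sum>l\<in>sorted_lists {- int M..int M} M. diag_term v w l)"
proof -
  have "\<forall>\<^sub>F N in sequentially. R_partial q V W sT tens N (tens v w) = R (tens v w)"
    using R unfolding is_R_bar_def by blast
  moreover have "\<forall>\<^sub>F N in sequentially. M \<le> N" by (rule eventually_ge_at_top)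
  ultimately have "\<forall>\<^sub>F N in sequentially. R (tens v w) = (\<Sum>l\<in>sorted_lists {- int M..int M} M. diag_term v w l)"
    by eventually_elim (use R_partial_tens[OF M] in simp)
  then show ?thesis by simp
qed

end

section \<open>Increasing exponents and sorted lists\<close>

lemma set_to_list: "set (to_list n k) = k ` {1..n}"
  by (simp add: to_list_def atLeastLessThanSuc_atLeastAtMost del: upt_Suc)

lemma sorted_to_list: "sorted (to_list n k) \<longleftrightarrow> mono_on {1..n} k"
proof
  assume s: "sorted (to_list n k)"
  show "mono_on {1..n} k"
  proof (rule monotone_onI)
    fix i j assume ij: "i \<in> {1..n}" "j \<in> {1..n}" "i \<le> j"
    have "to_list n k ! (i - 1) \<le> to_list n k ! (j - 1)"
      by (rule sorted_nth_mono[OF s]) (use ij in auto)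
    then show "k i \<le> k j" using ij by (simp add: to_list_nth)
  qed
next
  assume m: "mono_on {1..n} k"
  show "sorted (to_list n k)"
    unfolding sorted_iff_nth_mono
  proof (intro allI impI)
    fix i j assume ij: "i \<le> j" "j < length (to_list n k)"
    then have "k (Suc i) \<le> k (Suc j)" by (intro monotone_onD[OF m]) auto
    then show "to_list n k ! i \<le> to_list n k ! j" using ij by (simp add: to_list_nth)
  qed
qed

text \<open>Here the denominators of the q-exponentials meet the normalization of the symmetrized
  series: both are products of q-factorials of multiplicities.\<close>

lemma mult_weight_to_list:
  assumes "mono_on {1..n} k"
  shows "mult_weight s (to_list n k) = stab_weight s n k"
proof -
  have "count_list (to_list n k) x = card {i\<in>{1..n}. k i = x}" for x
  proof -
    have "count_list (to_list n k) x = length (filter (\<lambda>i. k i = x) [1..<Suc n])"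
      by (simp add: to_list_def count_list_eq_length_filter filter_map o_def eq_commute[of x] del: upt_Suc)
    also have "\<dots> = card ({i. k i = x} \<inter> set [1..<Suc n])"
      by (rule distinct_length_filter) simp
    also have "{i. k i = x} \<inter> set [1..<Suc n] = {i\<in>{1..n}. k i = x}" by auto
    finally show ?thesis .
  qed
  then show ?thesis
    using stab_weight_prod[OF assms, of "k ` {1..n}" s] by (simp add: mult_weight_def set_to_list)
qed

lemma sum_list_to_list: "sum_list (to_list n k) = (\<Sum>i\<in>{1..n}. k i)"
  unfolding to_list_def interv_sum_list_conv_sum_set_nat by (simp add: atLeastLessThanSuc_atLeastAtMost del: upt_Suc)

lemma to_list_uminus: "to_list n (\<lambda>i. - k i) = map uminus (to_list n k)"
  by (simp add: to_list_def)

lemma to_list_snoc: "n \<ge> 1 \<Longrightarrow> to_list n k = map k [1..<n] @ [k n]"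
  by (simp add: to_list_def)

definition bounded_mono :: "nat \<Rightarrow> nat \<Rightarrow> (nat \<Rightarrow> int) set" where
  "bounded_mono n B = {k\<in>idx n. mono_on {1..n} k \<and> (\<forall>i\<in>{1..n}. k i \<in> {- int B..int B})}"

lemma finite_bounded_mono: "finite (bounded_mono n B)"
proof (rule finite_subset)
  show "bounded_mono n B \<subseteq> {k. \<forall>i. (i \<in> {1..n} \<longrightarrow> k i \<in> {- int B..int B}) \<and> (i \<notin> {1..n} \<longrightarrow> k i = 0)}"
    by (auto simp: bounded_mono_def idx_def)
  show "finite {k. \<forall>i. (i \<in> {1..n} \<longrightarrow> k i \<in> {- int B..int B}) \<and> (i \<notin> {1..n} \<longrightarrow> k i = 0)}"
    by (rule finite_set_of_finite_funs) auto
qed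

text \<open>The last entry is the largest, so all entries are at most \<open>D\<close>; since they
  add up to at least \<open>- D\<close>, each is at least \<open>- D - (n - 1) * D\<close>. This is
  the origin of \<open>D + D * D\<close>.\<close>

lemma bounded_monoI:
  assumes k: "k \<in> idx n" "mono_on {1..n} k" and n: "n \<le> D"
    and top: "n \<ge> 1 \<Longrightarrow> k n \<le> int D" and bot: "- int D \<le> (\<Sum>i\<in>{1..n}. k i)"
  shows "k \<in> bounded_mono n (D + D * D)"
proof -
  have "k i \<in> {- int (D + D * D)..int (D + D * D)}" if i: "i \<in> {1..n}" for i
  proof -
    have le: "k j \<le> int D" if "j \<in> {1..n}" for j
      using monotone_onD[OF k(2) that, of n] top that by auto
    have "(\<Sum>j\<in>{1..n}. k j) = k i + (\<Sum>j\<in>{1..n} - {i}. k j)" by (rule sum.remove) (use i in auto)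
    moreover have "(\<Sum>j\<in>{1..n} - {i}. k j) \<le> of_nat (card ({1..n} - {i})) * int D"
      by (rule sum_bounded_above) (use le in auto)
    moreover have "of_nat (card ({1..n} - {i})) * int D \<le> int D * int D"
      by (rule mult_right_mono) (use n i in auto)
    ultimately have "- int D - int D * int D \<le> k i" using bot by linarith
    moreover have "k i \<le> int D" by (rule le[OF i])
    moreover have "0 \<le> int D * int D" by simp
    ultimately show ?thesis unfolding atLeastAtMost_iff of_nat_add of_nat_mult by (intro conjI; linarith)
  qed
  then show ?thesis using k unfolding bounded_mono_def by blast
qed

lemma sum_sorted_lists_length:
  assumes "n \<le> B"
  shows "(\<Sum>l\<in>{l\<in>sorted_lists {- int B..int B} B. length l = n}. h l) = (\<Sum>k\<in>bounded_mono n B. h (to_list n k))"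
proof (rule sum.reindex_bij_witness[of _ "to_list n" of_list])
  fix l assume l: "l \<in> {l\<in>sorted_lists {- int B..int B} B. length l = n}"
  then have len: "length l = n" by simp
  show "to_list n (of_list l) = l" by (rule to_list_of_list[OF len])
  show "of_list l \<in> bounded_mono n B"
    using l sorted_to_list[of n "of_list l"] set_to_list[of n "of_list l"]
    by (auto simp: bounded_mono_def of_list_idx to_list_of_list[OF len] sorted_lists_def)
  show "h (to_list n (of_list l)) = h l" by (simp add: to_list_of_list[OF len])
next
  fix k assume "k \<in> bounded_mono n B"
  then show "of_list (to_list n k) = k" "to_list n k \<in> {l\<in>sorted_lists {- int B..int B} B. length l = n}"
    using assms by (auto simp: bounded_mono_def of_list_to_list sorted_lists_def sorted_to_list set_to_list)
qed

section \<open>Comparison of the ordered product with the integrals\<close>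

context tensor_pair
begin

lemma R_bar_integral:
  assumes R: "is_R_bar q V W sT tens R" and L: "L \<in> restricted_dual V W sT tens"
  shows "\<exists>F. (\<forall>n\<ge>1. is_integrand q V W tens L v w n (F n)) \<and>
          (\<forall>C. (\<forall>n\<ge>1. separating_contours q n (C n)) \<longrightarrow>
             (\<lambda>n. (1/q - q) ^ Suc n / (fact (Suc n) * (2 * of_real pi * \<i>) ^ Suc n) *
                  iterated_integral (C (Suc n)) (F (Suc n)) (Suc n) (\<lambda>_. 0))
             sums (L (R (tens v w)) - L (tens v w)))"
proof -
  have lin: "Vector_Spaces.linear sT (*) L" using L by (simp add: restricted_dual_def)
  define c where "c n k l = L (tens (foldr (fop V) (to_list n k) v) (foldr (eop W) (to_list n l) w))" for n k l
  obtain M1 where M1: "\<forall>ks ls. L (tens (foldr (fop V) ks v) (foldr (eop W) ls w)) \<noteq> 0 \<longrightarrow>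
    int (length ks) \<le> M1 \<and> \<bar>sum_list ks\<bar> \<le> M1 \<and> \<bar>sum_list ls\<bar> \<le> M1 \<and>
    (\<forall>xs x. ks = xs @ [x] \<longrightarrow> x \<le> M1) \<and> (\<forall>xs x. ls = xs @ [x] \<longrightarrow> x \<le> M1)"
    using coefficient_support[OF V W q_nonzero q_generic T L, of v w] by blast
  obtain M2 where M2: "\<forall>l. diag v w l \<noteq> 0 \<longrightarrow> length l \<le> M2 \<and> set l \<subseteq> {- int M2..int M2}"
    using diag_bound ..
  \<comment> \<open>\<open>D\<close> dominates the bounds for the coefficients seen by
    \<open>L\<close> and for the nonzero diagonal words; \<open>B\<close> is the bound on entries
    that \<open>bounded_monoI\<close> yields from it.\<close>
  define D where "D = nat M1 + M2"
  define B where "B = D + D * D"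
  have D: "M1 \<le> int D" "M2 \<le> B" "D \<le> B" by (auto simp: D_def B_def)
  have supp: "n \<le> D" "\<bar>\<Sum>i\<in>{1..n}. k i\<bar> \<le> int D" "\<bar>\<Sum>i\<in>{1..n}. l i\<bar> \<le> int D"
      "n \<ge> 1 \<Longrightarrow> k n \<le> int D" "n \<ge> 1 \<Longrightarrow> l n \<le> int D"
    if "c n k l \<noteq> 0" for n k l
  proof -
    have "int n \<le> M1" "\<bar>\<Sum>i\<in>{1..n}. k i\<bar> \<le> M1" "\<bar>\<Sum>i\<in>{1..n}. l i\<bar> \<le> M1"
        "n \<ge> 1 \<Longrightarrow> k n \<le> M1" "n \<ge> 1 \<Longrightarrow> l n \<le> M1"
      using M1[rule_format, of "to_list n k" "to_list n l"] that to_list_snoc[of n k] to_list_snoc[of n l]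
      unfolding c_def length_to_list sum_list_to_list by blast+
    then show "n \<le> D" "\<bar>\<Sum>i\<in>{1..n}. k i\<bar> \<le> int D" "\<bar>\<Sum>i\<in>{1..n}. l i\<bar> \<le> int D"
      "n \<ge> 1 \<Longrightarrow> k n \<le> int D" "n \<ge> 1 \<Longrightarrow> l n \<le> int D"
      using D(1) by simp_all
  qed
  have mem: "k \<in> bounded_mono n B" if "k \<in> idx n" "mono_on {1..n} k" "c n k l \<noteq> 0 \<or> c n l k \<noteq> 0" for n k l
    unfolding B_def
  proof (rule bounded_monoI[OF that(1,2)])
    show "n \<le> D" using that(3) supp(1) by blast
    show "k n \<le> int D" if "n \<ge> 1" using that \<open>c n k l \<noteq> 0 \<or> c n l k \<noteq> 0\<close> supp(4,5) by blast
    have "\<bar>\<Sum>i\<in>{1..n}. k i\<bar> \<le> int D" using that(3) supp(2,3) by blast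
    then show "- int D \<le> (\<Sum>i\<in>{1..n}. k i)" by linarith
  qed
  \<comment> \<open>The quantity to which both sides reduce in degree \<open>n\<close>, up to the
    powers of \<open>1 / q - q\<close>.\<close>
  let ?I = "\<lambda>n. \<Sum>\<mu>\<in>bounded_mono n B. c n (\<lambda>i. - \<mu> i) \<mu> / stab_weight (q^2) n \<mu>"
  have ex: "\<exists>F. is_integrand q V W tens L v w n F \<and>
    (\<forall>C z0. separating_contours q n C \<longrightarrow> iterated_integral C F n z0 = (2 * of_real pi * \<i>) ^ n * fact n * ?I n)" for n
  proof (rule integrand_exists[where c = "c n" and K = "bounded_mono n B"])
    show "q \<noteq> 0" "\<And>m::nat. m > 0 \<Longrightarrow> q ^ m \<noteq> 1" by (rule q_nonzero) (rule q_generic)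
    show "exchange_rel (1 / q^2) n (\<lambda>k. c n k l)" for l
      unfolding c_def
      by (rule exchange_rel_foldr[where h = "fop V", OF uq_repD(3)[OF rV] linear_comp[OF bilinear_mapD(2)[OF bil] lin] eop_fop_exchange(2)[OF rV]])
    show "exchange_rel (q^2) n (c n k)" for k
      unfolding c_def
      by (rule exchange_rel_foldr[where h = "eop W", OF uq_repD(2)[OF rW] linear_comp[OF bilinear_mapD(1)[OF bil] lin] eop_fop_exchange(1)[OF rW]])
    show "finite (bounded_mono n B)" by (rule finite_bounded_mono)
    show "finite (bounded_mono n B)" by (rule finite_bounded_mono)
    show "\<kappa> \<in> idx n \<and> mono_on {1..n} \<kappa>" if "\<kappa> \<in> bounded_mono n B" for \<kappa>
      using that unfolding bounded_mono_def by blast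
    then show "\<kappa> \<in> idx n \<and> mono_on {1..n} \<kappa>" if "\<kappa> \<in> bounded_mono n B" for \<kappa>
      using that .
    show "\<kappa> \<in> bounded_mono n B" if "\<kappa> \<in> idx n" "mono_on {1..n} \<kappa>" "c n \<kappa> l \<noteq> 0" for \<kappa> l
      using mem[OF that(1,2), of l] that(3) by blast
    show "\<kappa> \<in> bounded_mono n B" if "\<kappa> \<in> idx n" "mono_on {1..n} \<kappa>" "c n k \<kappa> \<noteq> 0" for \<kappa> k
      using mem[OF that(1,2), of k] that(3) by blast
  qed (simp add: c_def)
  from choice[OF allI[OF ex]] obtain F where F: "\<forall>n. is_integrand q V W tens L v w n (F n) \<and>
    (\<forall>C z0. separating_contours q n C \<longrightarrow> iterated_integral C (F n) n z0 = (2 * of_real pi * \<i>) ^ n * fact n * ?I n)" ..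
  let ?c = "1 / q - q"
  have total: "L (R (tens v w)) - L (tens v w) = (\<Sum>n<B. ?c ^ Suc n * ?I (Suc n))"
  proof -
    have M: "length l \<le> B \<and> set l \<subseteq> {- int B..int B}" if "diag v w l \<noteq> 0" for l
      using M2[rule_format, OF that] D(2) by (auto simp: subset_iff)
    let ?S = "sorted_lists {- int B..int B} B"
    let ?t = "\<lambda>l. ?c ^ length l / mult_weight (q^2) l * L (diag v w l)"
    have "R (tens v w) = (\<Sum>l\<in>?S. diag_term v w l)" by (rule R_bar_tens[OF R M])
    then have "L (R (tens v w)) = (\<Sum>l\<in>?S. ?t l)"
      by (simp only: linearD(6)[OF lin] linearD(4)[OF lin])
    also have "\<dots> = (\<Sum>n\<in>{..B}. \<Sum>l\<in>{l\<in>?S. length l = n}. ?t l)"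
      by (rule sum.group[symmetric]) (auto simp: sorted_lists_def intro!: finite_sorted_lists[unfolded sorted_lists_def])
    also have "\<dots> = (\<Sum>n\<in>{..B}. ?c ^ n * ?I n)"
    proof (rule sum.cong[OF refl])
      fix n assume "n \<in> {..B}"
      then have "(\<Sum>l\<in>{l\<in>?S. length l = n}. ?t l) = (\<Sum>k\<in>bounded_mono n B. ?t (to_list n k))"
        by (intro sum_sorted_lists_length) simp
      also have "\<dots> = ?c ^ n * ?I n"
        unfolding sum_distrib_left
      proof (rule sum.cong[OF refl])
        fix k assume "k \<in> bounded_mono n B"
        then have "mult_weight (q^2) (to_list n k) = stab_weight (q^2) n k"
          by (intro mult_weight_to_list) (simp add: bounded_mono_def)
        then show "?t (to_list n k) = ?c ^ n * (c n (\<lambda>i. - k i) k / stab_weight (q^2) n k)"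
          by (simp add: c_def to_list_uminus)
      qed
      finally show "(\<Sum>l\<in>{l\<in>?S. length l = n}. ?t l) = ?c ^ n * ?I n" .
    qed
    also have "\<dots> = ?c ^ 0 * ?I 0 + (\<Sum>n<B. ?c ^ Suc n * ?I (Suc n))"
      unfolding lessThan_Suc_atMost[symmetric] by (rule sum.lessThan_Suc_shift)
    \<comment> \<open>The empty word accounts for the term 1 of the formula, subtracted in the
      conclusion.\<close>
    also have "?c ^ 0 * ?I 0 = L (tens v w)"
    proof -
      have "bounded_mono 0 B = {\<lambda>_. 0}" by (auto simp: bounded_mono_def idx_def fun_eq_iff monotone_on_def)
      moreover have "stab_weight (q^2) 0 (\<lambda>_. 0) = 1"
        using stab_weight_prod[of 0 "\<lambda>_. 0" "{}" "q^2"] by (simp add: monotone_on_def)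
      ultimately show ?thesis by (simp add: c_def to_list_def)
    qed
    finally show ?thesis by simp
  qed
  have "(\<lambda>n. ?c ^ Suc n / (fact (Suc n) * (2 * of_real pi * \<i>) ^ Suc n) *
      iterated_integral (C (Suc n)) (F (Suc n)) (Suc n) (\<lambda>_. 0)) sums (L (R (tens v w)) - L (tens v w))"
    if C: "\<forall>n\<ge>1. separating_contours q n (C n)" for C
  proof -
    have "iterated_integral (C (Suc n)) (F (Suc n)) (Suc n) (\<lambda>_. 0) = (2 * of_real pi * \<i>) ^ Suc n * fact (Suc n) * ?I (Suc n)" for n
    proof -
      have "separating_contours q (Suc n) (C (Suc n))" using C by simp
      then show ?thesis using F by blast
    qed
    moreover have "?c ^ Suc n / (fact (Suc n) * (2 * of_real pi * \<i>) ^ Suc n) * ((2 * of_real pi * \<i>) ^ Suc n * fact (Suc n) * I) = ?c ^ Suc n * I" for n I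
    proof -
      have "(2 * of_real pi * \<i> :: complex) ^ Suc n \<noteq> 0" "(fact (Suc n) :: complex) \<noteq> 0"
        by (simp, rule fact_nonzero)
      then show ?thesis by (simp del: power_Suc fact_Suc)
    qed
    ultimately have eq: "?c ^ Suc n / (fact (Suc n) * (2 * of_real pi * \<i>) ^ Suc n) *
      iterated_integral (C (Suc n)) (F (Suc n)) (Suc n) (\<lambda>_. 0) = ?c ^ Suc n * ?I (Suc n)" for n
      by (simp only:)
    \<comment> \<open>Words with more than \<open>D\<close> letters have zero coefficients, so the
      series of integrals is a finite sum.\<close>
    have zero: "?I n = 0" if "n > B" for n
    proof -
      have "c n k l = 0" for k l using supp(1)[of n k l] D(3) that by force
      then show ?thesis by simp
    qed
    show ?thesis
      unfolding eq total by (rule sums_finite) (use zero in auto)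
  qed
  then show ?thesis using F by (intro exI[of _ F]) auto
qed

end

theorem proposition3:
  fixes q :: complex
    and V :: "('v::ab_group_add) uq_module"
    and W :: "('w::ab_group_add) uq_module"
    and sT :: "complex \<Rightarrow> 't \<Rightarrow> 't::ab_group_add"
    and tens :: "'v \<Rightarrow> 'w \<Rightarrow> 't"
  assumes q_nonzero: "q \<noteq> 0"
    and q_generic: "\<And>m::nat. m > 0 \<Longrightarrow> q ^ m \<noteq> 1"
    and V: "highest_weight_rep q V"
    and W: "highest_weight_rep q W"
    and T: "tensor_product (scl V) (scl W) sT tens"
  shows "\<exists>R. is_R_bar q V W sT tens R \<and>
    (\<forall>v w. \<forall>L\<in>restricted_dual V W sT tens.
      \<exists>F. (\<forall>n\<ge>1. is_integrand q V W tens L v w n (F n)) \<and>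
          (\<forall>C. (\<forall>n\<ge>1. separating_contours q n (C n)) \<longrightarrow>
             (\<lambda>n. (1/q - q) ^ Suc n / (fact (Suc n) * (2 * of_real pi * \<i>) ^ Suc n) *
                  iterated_integral (C (Suc n)) (F (Suc n)) (Suc n) (\<lambda>_. 0))
             sums (L (R (tens v w)) - L (tens v w))))"
proof -
  interpret tensor_pair q V W sT tens by unfold_locales (rule assms; assumption?)+
  obtain R where R: "is_R_bar q V W sT tens R" using R_bar_exists ..
  show ?thesis
    by (intro exI[of _ R] conjI R allI ballI) (rule R_bar_integral[OF R])
qed

end
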